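(* Let $\mathbb{F}$ be a finite field and $\mathcal{A}=A_1\times\cdots\times A_m$ with nonempty $A_i\subseteq\mathbb{F}$ and $A_i=A_{m-i+1}$ for all $1\le i\le m$. Let $\mathcal{M}=\{F:\mathcal{A}\cup\{\bot\}\to\mathbb{F}\mid F(\bot)=\sum_{\vec a\in\mathcal{A}}F(\vec a)\}$ and let $\mathsf{ENC}_{\Sigma\mathrm{AntiSym}}:\mathcal{M}\to\mathbb{F}^{\bar{\mathcal{A}}}$ be the randomised encoding $\mathsf{ENC}_{\Sigma\mathrm{AntiSym}}(F)=\Sigma[F|_{\mathcal{A}}+G]$, where $G$ is uniformly random in $\mathrm{AntiSym}[\mathcal{A}]$. Then $\mathsf{ENC}_{\Sigma\mathrm{AntiSym}}$ has an $\ell$-constraint locator with $\ell(n)=n^2m^2+1+O(n^4m^4/|\mathcal{A}|)$, running in time $\mathrm{poly}(a,m,n)$, where $a=\sum_i|A_i|$ and $n$ is the size of the input subdomain.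
   Context: $\mathcal{A}_i=A_1\times\cdots\times A_i$, $\mathcal{A}_0=\{\bot\}$ (empty tuple), $\mathcal{A}_{>i}=A_{i+1}\times\cdots\times A_m$, $\bar{\mathcal{A}}=\bigcup_{i=0}^m\mathcal{A}_i$. For $w:\mathcal{A}\to\mathbb{F}$, $\Sigma[w]:\bar{\mathcal{A}}\to\mathbb{F}$ is $\Sigma[w](\vec x)=\sum_{\vec y\in\mathcal{A}_{>|\vec x|}}w(\vec x,\vec y)$. For $\vec x=(x_1,\dots,x_m)$, $\overleftarrow{x}=(x_m,\dots,x_1)$, and $\mathrm{AntiSym}[\mathcal{A}]=\{w\in\mathbb{F}^{\mathcal{A}}:w(\vec x)+w(\overleftarrow{x})=0\ \forall\vec x\in\mathcal{A}\}$. The encoding is linear (output $\mathsf{ENC}(F;\mu)$ with $\mu$ uniform in $\mathbb{F}^r$, linear in $(F,\mu)$) with message domain $\mathcal{A}\cup\{\bot\}$ and codeword domain $\bar{\mathcal{A}}$. An $\ell$-constraint locator is an algorithm that on input $I\subseteq\bar{\mathcal{A}}$ outputs $(R,Z)$ with $R\subseteq\mathcal{A}\cup\{\bot\}$, $|R|\le\ell(|I|)$, $Z\in\mathbb{F}^{k\times(R\sqcup I)}$, such that for every $F\in\mathcal{M}$ and $\vec\beta\in\mathbb{F}^I$: $(F|_R,\vec\beta)\in\ker Z$ iff there is randomness $\mu$ with $\mathsf{ENC}(F;\mu)|_I=\vec\beta$. *)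

theory Defs
  imports "HOL-Algebra.Ring" "HOL-Probability.Probability_Mass_Function"
begin

section \<open>A uniform model of computation over a field\<close>

text \<open>
  Algorithms are programs of a first-order WHILE language on binary trees in the style of
  Jones, whose leaves may carry field elements. Field arithmetic and equality of field elements
  have unit cost, as have the tree operations (trees are shared, never copied). There is no
  arithmetic on integers other than what is programmed on trees. The syntax does not mention the
  field, so one program runs over every field.
\<close>

datatype 'u data = Leaf | Elem 'u | Node "'u data" "'u data"

datatype prim = PId | PLeaf | PZero | POne | PFst | PSnd | PIsElem | PEq | PAdd | PMult | PNeg | PInv

datatype prog =
    Prim prim
  | Seq prog prog
  | Fork prog prog
  | Cond prog prog prog
  | While prog prog

text \<open>Leaf represents false, every other tree true.\<close>

definition truth :: "bool \<Rightarrow> 'u data" where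
  "truth b = (if b then Node Leaf Leaf else Leaf)"

text \<open>Operations applied to trees of the wrong shape return Leaf; the inverse of zero is zero.\<close>

fun prim_sem :: "'u ring \<Rightarrow> prim \<Rightarrow> 'u data \<Rightarrow> 'u data" where
  "prim_sem F PId v = v"
| "prim_sem F PLeaf v = Leaf"
| "prim_sem F PZero v = Elem \<zero>\<^bsub>F\<^esub>"
| "prim_sem F POne v = Elem \<one>\<^bsub>F\<^esub>"
| "prim_sem F PFst v = (case v of Node x y \<Rightarrow> x | _ \<Rightarrow> Leaf)"
| "prim_sem F PSnd v = (case v of Node x y \<Rightarrow> y | _ \<Rightarrow> Leaf)"
| "prim_sem F PIsElem v = (case v of Elem x \<Rightarrow> truth True | _ \<Rightarrow> truth False)"
| "prim_sem F PEq v = (case v of Node (Elem x) (Elem y) \<Rightarrow> truth (x = y) | _ \<Rightarrow> Leaf)"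
| "prim_sem F PAdd v = (case v of Node (Elem x) (Elem y) \<Rightarrow> Elem (x \<oplus>\<^bsub>F\<^esub> y) | _ \<Rightarrow> Leaf)"
| "prim_sem F PMult v = (case v of Node (Elem x) (Elem y) \<Rightarrow> Elem (x \<otimes>\<^bsub>F\<^esub> y) | _ \<Rightarrow> Leaf)"
| "prim_sem F PNeg v = (case v of Elem x \<Rightarrow> Elem (\<ominus>\<^bsub>F\<^esub> x) | _ \<Rightarrow> Leaf)"
| "prim_sem F PInv v =
     (case v of Elem x \<Rightarrow> Elem (if x = \<zero>\<^bsub>F\<^esub> then \<zero>\<^bsub>F\<^esub> else inv\<^bsub>F\<^esub> x) | _ \<Rightarrow> Leaf)"

text \<open>\<open>run F p v t w\<close>: over \<open>F\<close>, program \<open>p\<close> on input \<open>v\<close> halts after \<open>t\<close> steps with output \<open>w\<close>.\<close>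

inductive run :: "'u ring \<Rightarrow> prog \<Rightarrow> 'u data \<Rightarrow> nat \<Rightarrow> 'u data \<Rightarrow> bool" for F where
  run_Prim: "run F (Prim b) v 1 (prim_sem F b v)"
| run_Seq: "run F p v s w \<Longrightarrow> run F q w t x \<Longrightarrow> run F (Seq p q) v (s + t + 1) x"
| run_Fork: "run F p v s w \<Longrightarrow> run F q v t x \<Longrightarrow> run F (Fork p q) v (s + t + 1) (Node w x)"
| run_Cond_true: "run F b v s w \<Longrightarrow> w \<noteq> Leaf \<Longrightarrow> run F p v t x \<Longrightarrow> run F (Cond b p q) v (s + t + 1) x"
| run_Cond_false: "run F b v s Leaf \<Longrightarrow> run F q v t x \<Longrightarrow> run F (Cond b p q) v (s + t + 1) x"
| run_While_stop: "run F b v s Leaf \<Longrightarrow> run F (While b p) v (s + 1) v"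
| run_While_step: "run F b v s w \<Longrightarrow> w \<noteq> Leaf \<Longrightarrow> run F p v t x \<Longrightarrow> run F (While b p) x u y
    \<Longrightarrow> run F (While b p) v (s + t + u + 1) y"

inductive_cases run_PrimE: "run F (Prim b) v t w"
inductive_cases run_SeqE: "run F (Seq p q) v t w"
inductive_cases run_ForkE: "run F (Fork p q) v t w"
inductive_cases run_CondE: "run F (Cond b p q) v t w"
inductive_cases run_WhileE: "run F (While b p) v t w"

lemma run_deterministic: "run F p v t w \<Longrightarrow> run F p v t' w' \<Longrightarrow> t' = t \<and> w' = w"
proof (induction arbitrary: t' w' rule: run.induct)
  case (run_Prim b v)
  then show ?case by (auto elim: run_PrimE)
next
  case (run_Seq p v s w q t x)
  from run_Seq.prems show ?case
    by (rule run_SeqE) (metis Suc_eq_plus1 run_Seq.IH)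
next
  case (run_Fork p v s w q t x)
  from run_Fork.prems show ?case
    by (rule run_ForkE) (metis Suc_eq_plus1 run_Fork.IH)
next
  case (run_Cond_true b v s w p t x q)
  from run_Cond_true.prems show ?case
    by (rule run_CondE) (metis Suc_eq_plus1 run_Cond_true.IH run_Cond_true.hyps(2))+
next
  case (run_Cond_false b v s q t x p)
  from run_Cond_false.prems show ?case
    by (rule run_CondE) (metis Suc_eq_plus1 run_Cond_false.IH)+
next
  case (run_While_stop b v s p)
  from run_While_stop.prems show ?case
    by (rule run_WhileE) (metis Suc_eq_plus1 run_While_stop.IH)+
next
  case (run_While_step b v s w p t x u y)
  from run_While_step.prems show ?case
    by (rule run_WhileE) (metis Suc_eq_plus1 run_While_step.IH run_While_step.hyps(2))+
qed

definition list_data :: "'u data list \<Rightarrow> 'u data" where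
  "list_data vs = foldr Node vs Leaf"

definition tuple_data :: "'u list \<Rightarrow> 'u data" where
  "tuple_data x = list_data (map Elem x)"

definition tuples_data :: "'u list list \<Rightarrow> 'u data" where
  "tuples_data xs = list_data (map tuple_data xs)"

definition matrix_data :: "nat \<Rightarrow> (nat \<Rightarrow> 'c \<Rightarrow> 'u) \<Rightarrow> 'c list \<Rightarrow> 'u data" where
  "matrix_data k Z cs = tuples_data (map (\<lambda>j. map (Z j) cs) [0..<k])"


section \<open>Constraint locators\<close>

definition kernel_on :: "'u ring \<Rightarrow> nat \<Rightarrow> 'c set \<Rightarrow> (nat \<Rightarrow> 'c \<Rightarrow> 'u) \<Rightarrow> ('c \<Rightarrow> 'u) set" where
  "kernel_on F k C Z =
     {v \<in> C \<rightarrow>\<^sub>E carrier F. \<forall>j<k. (\<Oplus>\<^bsub>F\<^esub>c\<in>C. Z j c \<otimes>\<^bsub>F\<^esub> v c) = \<zero>\<^bsub>F\<^esub>}"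

text \<open>
  A randomised encoding is given by its message space \<open>M\<close>, the distribution \<open>rnd\<close> of its
  randomness, and the map \<open>enc\<close> taking a message and a value of the randomness to a codeword.
  The columns of \<open>Z\<close> are indexed by the disjoint union of \<open>R\<close> and \<open>I\<close>.
\<close>

definition locates_constraints ::
  "'u ring \<Rightarrow> ('d \<Rightarrow> 'u) set \<Rightarrow> 'r pmf \<Rightarrow> (('d \<Rightarrow> 'u) \<Rightarrow> 'r \<Rightarrow> 'e \<Rightarrow> 'u) \<Rightarrow>
   'e set \<Rightarrow> 'd set \<Rightarrow> nat \<Rightarrow> (nat \<Rightarrow> 'd + 'e \<Rightarrow> 'u) \<Rightarrow> bool" where
  "locates_constraints F M rnd enc I R k Z \<longleftrightarrow>
     (\<forall>j<k. \<forall>c\<in>R <+> I. Z j c \<in> carrier F) \<and>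
     (\<forall>f\<in>M. \<forall>\<beta>\<in>I \<rightarrow>\<^sub>E carrier F.
        restrict (case_sum f \<beta>) (R <+> I) \<in> kernel_on F k (R <+> I) Z \<longleftrightarrow>
        (\<exists>\<mu>\<in>set_pmf rnd. restrict (enc f \<mu>) I = \<beta>))"

text \<open>
  \<open>P\<close> is a \<open>bnd\<close>-constraint locator, running in time \<open>\<tau>\<close>, for the encoding with message domain \<open>D\<close>
  and codeword domain \<open>E\<close> (sets of tuples); \<open>dsc\<close> is the description of the encoding that the
  program receives besides the query set. Sets are passed as duplicate-free lists in any order.
\<close>

definition constraint_locator ::
  "'u ring \<Rightarrow> 'u list set \<Rightarrow> 'u list set \<Rightarrow> ('u list \<Rightarrow> 'u) set \<Rightarrow> 'r pmf \<Rightarrow>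
   (('u list \<Rightarrow> 'u) \<Rightarrow> 'r \<Rightarrow> 'u list \<Rightarrow> 'u) \<Rightarrow> 'u data \<Rightarrow> (nat \<Rightarrow> real) \<Rightarrow> (nat \<Rightarrow> nat) \<Rightarrow> prog \<Rightarrow> bool" where
  "constraint_locator F D E M rnd enc dsc bnd \<tau> P \<longleftrightarrow>
     (\<forall>qs. distinct qs \<and> set qs \<subseteq> E \<longrightarrow>
        (\<exists>t rs k Z.
           run F P (Node dsc (tuples_data qs)) t
             (Node (tuples_data rs) (matrix_data k Z (map Inl rs @ map Inr qs))) \<and>
           t \<le> \<tau> (card (set qs)) \<and>
           distinct rs \<and> set rs \<subseteq> D \<and> real (card (set rs)) \<le> bnd (card (set qs)) \<and>
           locates_constraints F M rnd enc (set qs) (set rs) k Z))"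


section \<open>The encoding\<close>

text \<open>
  Tuples are lists, and \<open>[]\<close> is the empty tuple, written \<open>\<bottom>\<close> in the mathematics. The sets
  \<open>A 1, \<dots>, A m\<close> are indexed from 1.
\<close>

definition prod_sets :: "(nat \<Rightarrow> 'u set) \<Rightarrow> nat \<Rightarrow> nat \<Rightarrow> 'u list set" where
  "prod_sets A i j = listset (map A [Suc i..<Suc j])"

definition full_tuples :: "(nat \<Rightarrow> 'u set) \<Rightarrow> nat \<Rightarrow> 'u list set" where
  "full_tuples A m = prod_sets A 0 m"

definition partial_tuples :: "(nat \<Rightarrow> 'u set) \<Rightarrow> nat \<Rightarrow> 'u list set" where
  "partial_tuples A m = (\<Union>i\<le>m. prod_sets A 0 i)"

definition Sigma_sum ::
  "'u ring \<Rightarrow> (nat \<Rightarrow> 'u set) \<Rightarrow> nat \<Rightarrow> ('u list \<Rightarrow> 'u) \<Rightarrow> 'u list \<Rightarrow> 'u" where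
  "Sigma_sum F A m w =
     (\<lambda>x\<in>partial_tuples A m. \<Oplus>\<^bsub>F\<^esub>y\<in>prod_sets A (length x) m. w (x @ y))"

definition AntiSym :: "'u ring \<Rightarrow> (nat \<Rightarrow> 'u set) \<Rightarrow> nat \<Rightarrow> ('u list \<Rightarrow> 'u) set" where
  "AntiSym F A m =
     {w \<in> full_tuples A m \<rightarrow>\<^sub>E carrier F. \<forall>x\<in>full_tuples A m. w x \<oplus>\<^bsub>F\<^esub> w (rev x) = \<zero>\<^bsub>F\<^esub>}"

definition messages :: "'u ring \<Rightarrow> (nat \<Rightarrow> 'u set) \<Rightarrow> nat \<Rightarrow> ('u list \<Rightarrow> 'u) set" where
  "messages F A m =
     {f \<in> (full_tuples A m \<union> {[]}) \<rightarrow>\<^sub>E carrier F. f [] = (\<Oplus>\<^bsub>F\<^esub>a\<in>full_tuples A m. f a)}"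

definition enc_Sigma_AntiSym ::
  "'u ring \<Rightarrow> (nat \<Rightarrow> 'u set) \<Rightarrow> nat \<Rightarrow> ('u list \<Rightarrow> 'u) \<Rightarrow> ('u list \<Rightarrow> 'u) \<Rightarrow> 'u list \<Rightarrow> 'u" where
  "enc_Sigma_AntiSym F A m f G =
     Sigma_sum F A m (\<lambda>x\<in>full_tuples A m. f x \<oplus>\<^bsub>F\<^esub> G x)"

definition enumerates :: "'u list list \<Rightarrow> (nat \<Rightarrow> 'u set) \<Rightarrow> nat \<Rightarrow> bool" where
  "enumerates L A m \<longleftrightarrow> length L = m \<and> (\<forall>i<m. distinct (L ! i) \<and> set (L ! i) = A (Suc i))"

end

theory Submission
  imports Defs "HOL-Library.Sublist"
begin

text \<open>
  Let \<open>I\<close> be the query set and let \<open>cls a\<close> be the longest prefix of the full tuple \<open>a\<close> in \<open>I\<close>, or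
  \<open>\<bottom>\<close> if there is none. A functional on the queried values is determined by a function \<open>U\<close> on the
  classes: its pairing with \<open>\<Sigma>[w]\<close> is \<open>\<Sum>\<^sub>a U (cls a) w a\<close>. It vanishes on antisymmetric \<open>w\<close> iff
  \<open>U (cls a) = U (cls (rev a))\<close> for all \<open>a\<close> and, in characteristic 2, \<open>U (cls a) = 0\<close> for palindromes
  \<open>a\<close>. Hence the constraints are spanned by the indicators of the connected components of the graph
  on the classes with edges \<open>{cls a, cls (rev a)}\<close>, and no linear algebra is needed to find them.
  Completeness holds because an antisymmetric \<open>w\<close> is a flow on this graph, and a function is the
  divergence of a flow as soon as it sums to zero on every component. An extra vertex \<open>dead\<close> absorbs
  the components on which \<open>U\<close> has to vanish.

  One component contains all but at most \<open>n\<^sup>2 m\<^sup>2\<close> full tuples. Indeed let \<open>i\<close> and \<open>j\<close> be the depths at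
  which \<open>a\<close> and \<open>rev a\<close> leave the prefix tree of \<open>I\<close>. Tuples with \<open>i + j \<ge> m\<close> are glued from two
  prefixes of queries, so there are few of them, and two exit nodes of depths \<open>i\<close> and \<open>j\<close> with
  \<open>i + j + 1 < m\<close> are always adjacent. What remains is the case \<open>i = j\<close>, \<open>m = 2 i + 1\<close>, where an exit node
  outside the component of the one with the most exits has at least as many
  children as exits. The large component is accounted for by the value of the message at \<open>\<bottom>\<close>, all other tuples go into \<open>R\<close>.
\<close>

section \<open>Longest prefixes and overlays\<close>

text \<open>The labels computed by the program have two opposite duties. They must agree on
  \<open>cls a\<close> and \<open>cls (rev a)\<close>: the rows need this in order to hold for
  genuine codewords, and it is all that the count of the tuples in \<open>R\<close> uses, so the
  counting lemmas quantify over every \<open>lab\<close> with this invariance. Conversely, every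
  vertex must be joined to its label by an antisymmetric flow; then values that satisfy the rows
  come from a codeword. There are exponentially many full tuples, so both the edges and
  \<open>R\<close> have to be read off the list \<open>S\<close>. For the edges it suffices that
  \<open>S\<close> meets every pair of exit nodes. For \<open>R\<close> the tuples themselves must
  lie in \<open>S\<close>; they do, because a tuple outside the large component has
  \<open>i + j + 1 \<ge> m\<close>, and then its two exit prefixes determine it. The constant:
  gluing yields at most \<open>2 n + n^2 (m - 1)\<close> tuples, the case \<open>i = j\<close> at
  most \<open>n^2\<close>, and the total is at most \<open>n^2 (m + 2)\<close>, hence at most
  \<open>n^2 m^2\<close> when \<open>m \<ge> 2\<close>; \<open>m = 1\<close> is treated apart. The
  empty tuple adds 1.\<close>

definition cls :: "'a list set \<Rightarrow> 'a list \<Rightarrow> 'a list" where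
  "cls X a = (case filter (\<lambda>x. x \<in> X) (rev (prefixes a)) of [] \<Rightarrow> [] | x # _ \<Rightarrow> x)"

lemma cls_Nil [simp]: "cls X [] = []"
  by (simp add: cls_def)

lemma cls_snoc: "cls X (b @ [c]) = (if b @ [c] \<in> X then b @ [c] else cls X b)"
  by (simp add: cls_def)

lemma prefix_cls: "prefix (cls X a) a"
  by (induction a rule: rev_induct) (auto simp: cls_snoc intro: prefix_prefix)

lemma cls_in: "cls X a \<in> insert [] X"
  by (induction a rule: rev_induct) (auto simp: cls_snoc)

lemma prefix_cls_iff: "x \<in> X \<Longrightarrow> prefix x (cls X a) \<longleftrightarrow> prefix x a"
  by (induction a rule: rev_induct) (auto simp: cls_snoc prefix_snoc)

lemma cls_self: "x \<in> insert [] X \<Longrightarrow> cls X x = x"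
  by (cases x rule: rev_cases) (auto simp: cls_snoc)

lemma cls_eqI:
  assumes "\<And>x. x \<in> X \<Longrightarrow> prefix x a \<longleftrightarrow> prefix x b"
  shows "cls X a = cls X b"
proof (rule prefix_order.antisym)
  show "prefix (cls X a) (cls X b)"
    using cls_in[of X a] prefix_cls[of X a] assms prefix_cls_iff by fastforce
  show "prefix (cls X b) (cls X a)"
    using cls_in[of X b] prefix_cls[of X b] assms prefix_cls_iff by fastforce
qed

lemma take_prefix_eq: "prefix p a \<Longrightarrow> k \<le> length p \<Longrightarrow> take k a = take k p"
  by (auto simp: prefix_def)

definition overlay :: "'a list \<Rightarrow> 'a list \<Rightarrow> 'a list" where
  "overlay x w = x @ drop (length x) w"

lemma length_overlay: "length (overlay x w) = max (length x) (length w)"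
  by (simp add: overlay_def)

lemma nth_overlay: "i < max (length x) (length w) \<Longrightarrow>
    overlay x w ! i = (if i < length x then x ! i else w ! i)"
  by (auto simp: overlay_def nth_append)

text \<open>Writes \<open>x\<close> over the front of \<open>w\<close> and the reversal of
  \<open>y\<close> over its end; where the two overlap, \<open>y\<close> wins. This prescribes the
  beginnings of a tuple and of its reversal at once.\<close>

definition graft :: "'a list \<Rightarrow> 'a list \<Rightarrow> 'a list \<Rightarrow> 'a list" where
  "graft w x y = rev (overlay y (rev (overlay x w)))"

section \<open>Exit nodes of a query set\<close>

text \<open>
  A full tuple \<open>a\<close> leaves the prefix tree \<open>T\<close> of \<open>I\<close> at its longest prefix \<open>node a\<close> in \<open>T\<close>, and its
  class depends on this exit node only. The set \<open>S\<close> has polynomial size and realises every pair of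
  exit nodes of \<open>a\<close> and \<open>rev a\<close>. For a suitable \<open>u\<close> the filling \<open>overlay u (rev base)\<close> is a palindrome, so
  that palindromes are realised by palindromes.
\<close>

locale query =
  fixes L :: "'a list list" and I :: "'a list set"
  assumes dist: "\<And>i. i < length L \<Longrightarrow> distinct (L ! i)"
    and nonempty: "\<And>i. i < length L \<Longrightarrow> L ! i \<noteq> []"
    and sym: "\<And>i. i < length L \<Longrightarrow> set (L ! i) = set (L ! (length L - 1 - i))"
    and fin: "finite I"
    and I_len: "\<And>q. q \<in> I \<Longrightarrow> length q \<le> length L"
    and I_nth: "\<And>q i. q \<in> I \<Longrightarrow> i < length q \<Longrightarrow> q ! i \<in> set (L ! i)"
begin

abbreviation "m \<equiv> length L"

definition part :: "'a list set" where
  "part = {a. length a \<le> m \<and> (\<forall>i<length a. a ! i \<in> set (L ! i))}"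

definition full :: "'a list set" where
  "full = {a \<in> part. length a = m}"

definition T :: "'a list set" where
  "T = {p. \<exists>q\<in>insert [] I. prefix p q}"

text \<open>Contains each full tuple cut one letter after its exit from \<open>T\<close>; a tuple
  that never leaves \<open>T\<close> is its own cut. The empty tuple is added for
  \<open>m = 0\<close>.\<close>

definition Tp :: "'a list set" where
  "Tp = insert [] {p @ [c] | p c. p \<in> T \<and> length p < m \<and> c \<in> set (L ! length p)}"

definition base :: "'a list" where
  "base = map hd L"

text \<open>The filling is palindromic when \<open>u\<close> is the first half of
  \<open>base\<close>; running through all prefixes of \<open>base\<close> lets the program avoid
  halving \<open>m\<close>.\<close>

definition S :: "'a list set" where
  "S = {graft (overlay u (rev base)) x y | u x y. prefix u base \<and> x \<in> Tp \<and> y \<in> Tp}"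

definition ex :: "'a list \<Rightarrow> 'a set" where
  "ex p = (if length p < m then {c \<in> set (L ! length p). p @ [c] \<notin> T} else {})"

definition T1 :: "'a list set" where
  "T1 = {p \<in> T. ex p \<noteq> {}}"

abbreviation "node \<equiv> cls T"
abbreviation "dep a \<equiv> length (node a)"

lemma fullD: "a \<in> full \<Longrightarrow> length a = m" "a \<in> full \<Longrightarrow> i < m \<Longrightarrow> a ! i \<in> set (L ! i)"
  by (auto simp: full_def part_def)

lemma fullI: "length a = m \<Longrightarrow> (\<And>i. i < m \<Longrightarrow> a ! i \<in> set (L ! i)) \<Longrightarrow> a \<in> full"
  by (auto simp: full_def part_def)

lemma finite_part: "finite part"
proof -
  have "part \<subseteq> {a. set a \<subseteq> (\<Union>i<m. set (L ! i)) \<and> length a \<le> m}"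
    by (fastforce simp: part_def in_set_conv_nth)
  then show ?thesis by (rule finite_subset) (auto intro: finite_lists_length_le)
qed

lemma finite_full: "finite full"
  using finite_part by (simp add: full_def)

lemma rev_full: "a \<in> full \<Longrightarrow> rev a \<in> full"
proof (rule fullI)
  fix i assume a: "a \<in> full" and i: "i < m"
  then have "a ! (m - 1 - i) \<in> set (L ! (m - 1 - i))" by (intro fullD) auto
  then show "rev a ! i \<in> set (L ! i)"
    using fullD(1)[OF a] i sym[OF i] by (simp add: rev_nth)
qed (simp add: fullD)

lemma overlay_full: "x \<in> part \<Longrightarrow> w \<in> full \<Longrightarrow> overlay x w \<in> full"
  by (rule fullI) (auto simp: length_overlay nth_overlay part_def fullD max_def)

lemma graft_full: "w \<in> full \<Longrightarrow> x \<in> part \<Longrightarrow> y \<in> part \<Longrightarrow> graft w x y \<in> full"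
  unfolding graft_def by (intro rev_full overlay_full)

lemma base_full: "base \<in> full"
  by (rule fullI) (auto simp: base_def nonempty)

lemma part_prefix: "a \<in> part \<Longrightarrow> prefix p a \<Longrightarrow> p \<in> part"
  by (auto simp: part_def prefix_def nth_append) (metis trans_less_add1)

lemma full_part: "a \<in> full \<Longrightarrow> a \<in> part"
  by (simp add: full_def)

lemma I_part: "I \<subseteq> part"
  using I_len I_nth by (auto simp: part_def)

lemma T_part: "T \<subseteq> part"
proof
  fix p assume "p \<in> T"
  then obtain q where "q \<in> insert [] I" "prefix p q" by (auto simp: T_def)
  moreover have "[] \<in> part" by (simp add: part_def)
  ultimately show "p \<in> part" using I_part part_prefix by blast
qed

lemma Nil_T [simp]: "[] \<in> T"
  by (auto simp: T_def)

lemma T_prefix: "p \<in> T \<Longrightarrow> prefix r p \<Longrightarrow> r \<in> T"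
  by (auto simp: T_def intro: prefix_order.trans)

lemma I_T: "I \<subseteq> T"
  by (auto simp: T_def)

lemma snoc_part: "p \<in> part \<Longrightarrow> length p < m \<Longrightarrow> c \<in> set (L ! length p) \<Longrightarrow> p @ [c] \<in> part"
  by (auto simp: part_def nth_append less_Suc_eq)

lemma Tp_part: "Tp \<subseteq> part"
  using T_part snoc_part Nil_T by (auto simp: Tp_def)

lemma S_full: "S \<subseteq> full"
  unfolding S_def using Tp_part
  by (auto intro!: graft_full overlay_full rev_full base_full
      intro: part_prefix[OF full_part[OF base_full]])

lemma node_T: "node a \<in> T"
  using cls_in[of T a] by auto

lemma node_eqI:
  assumes "p \<in> T" "prefix p a" "length p < length a \<Longrightarrow> take (Suc (length p)) a \<notin> T"
  shows "node a = p"
proof (rule ccontr)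
  assume "node a \<noteq> p"
  moreover have "prefix p (node a)" using assms(1,2) prefix_cls_iff by blast
  ultimately have "strict_prefix p (node a)" by (simp add: strict_prefix_def)
  then have *: "length p < dep a" by (rule prefix_length_less)
  then have "prefix (take (Suc (length p)) a) (node a)"
    using take_prefix_eq[OF prefix_cls[of T a], of "Suc (length p)"] take_is_prefix by simp
  then have "take (Suc (length p)) a \<in> T" using T_prefix node_T by blast
  moreover have "length p < length a" using * prefix_length_le[OF prefix_cls[of T a]] by simp
  ultimately show False using assms(3) by blast
qed

lemma node_take: "node a = take (dep a) a"
  using take_prefix_eq[OF prefix_cls[of T a], of "dep a"] by simp

lemma node_exit: "dep a < length a \<Longrightarrow> take (Suc (dep a)) a \<notin> T"
proof
  assume a: "dep a < length a" and "take (Suc (dep a)) a \<in> T"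
  then have "prefix (take (Suc (dep a)) a) (node a)"
    by (simp add: prefix_cls_iff take_is_prefix)
  then show False using a prefix_length_le by fastforce
qed

lemma dep_le: "a \<in> full \<Longrightarrow> dep a \<le> m"
  using prefix_length_le[OF prefix_cls[of T a]] by (simp add: fullD)

text \<open>Queries are nodes of \<open>T\<close>, so a query is a prefix of \<open>a\<close>
  exactly if it is a prefix of \<open>node a\<close>. Hence exit nodes refine classes.\<close>

lemma cls_node: "cls I (node a) = cls I a"
  by (rule cls_eqI) (use I_T prefix_cls_iff in blast)

text \<open>\<open>b\<close> agrees with \<open>a\<close> up to one letter past the exit, so it
  leaves \<open>T\<close> at the same node; if \<open>a\<close> never leaves \<open>T\<close>, then
  \<open>b = a\<close>.\<close>

lemma node_same_exit:
  assumes "a \<in> full" "b \<in> full" "prefix (take (Suc (dep a)) a) b"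
  shows "node b = node a"
proof (rule node_eqI[OF node_T])
  have "prefix (node a) (take (Suc (dep a)) a)"
    using take_is_prefix[of "dep a" "take (Suc (dep a)) a"] node_take[of a] by (simp add: min_def)
  then show "prefix (node a) b" using assms(3) prefix_order.trans by blast
  assume "dep a < length b"
  then have *: "dep a < length a" using assms by (simp add: fullD)
  then have "take (Suc (dep a)) b = take (Suc (dep a)) a"
    using assms(3) by (auto simp: prefix_def)
  then show "take (Suc (dep a)) b \<notin> T" using node_exit[OF *] by simp
qed

lemma exit_Tp:
  assumes "a \<in> full"
  shows "take (Suc (dep a)) a \<in> Tp"
proof (cases "m = 0")
  case True
  then have "a = []" using fullD(1)[OF assms] by simp
  then show ?thesis unfolding Tp_def by simp
next
  case False
  \<comment> \<open>If \<open>a\<close> stays inside \<open>T\<close>, then \<open>dep a = m\<close>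
    and there is no letter at that position; capping at \<open>m - 1\<close> presents
    \<open>a\<close> as a child of its longest proper prefix.\<close>
  let ?k = "min (dep a) (m - 1)"
  have "take (Suc (dep a)) a = take (Suc ?k) a"
    using False dep_le[OF assms] fullD(1)[OF assms] by (auto simp: min_def)
  also have "\<dots> = take ?k a @ [a ! ?k]"
    using False fullD(1)[OF assms] by (intro take_Suc_conv_app_nth) linarith
  finally have eq: "take (Suc (dep a)) a = take ?k a @ [a ! ?k]" .
  have "prefix (take ?k a) (node a)"
    using take_prefix_eq[OF prefix_cls[of T a], of ?k] take_is_prefix[of ?k "node a"] by simp
  then have "take ?k a \<in> T" using T_prefix node_T by blast
  moreover have "?k < m" using False by linarith
  moreover from this have "length (take ?k a) = ?k" using fullD(1)[OF assms] by simp
  ultimately show ?thesis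
    using fullD(2)[OF assms, of ?k] unfolding eq Tp_def by auto
qed

section \<open>Grafting two exit prefixes into one tuple\<close>

lemma graft_eq:
  assumes "length w = m" "length x \<le> m" "length y \<le> m"
  shows "graft w x y = take (m - length y) (overlay x w) @ rev y"
  using assms by (simp add: graft_def overlay_def[of y] rev_drop length_overlay max_def)

lemma prefix_graft:
  assumes "length w = m" "length x + length y \<le> m"
  shows "prefix x (graft w x y)"
  using assms by (simp add: graft_eq overlay_def)

lemma prefix_rev_graft: "prefix y (rev (graft w x y))"
  by (simp add: graft_def overlay_def)

text \<open>The two pieces reach every position between them, so nothing of the filling
  \<open>w\<close> survives.\<close>

lemma graft_takes:
  assumes "length w = m" "length a = m" "m \<le> min m i + min m j"
  shows "graft w (take i a) (take j (rev a)) = a"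
proof -
  have "m - min m j \<le> min m i" using assms(3) by linarith
  then have "take (m - min m j) (overlay (take i a) w) = take (m - min m j) a"
    using assms by (simp add: overlay_def min_def split: if_splits)
  moreover have "rev (take j (rev a)) = drop (m - min m j) a"
    using assms by (simp add: rev_take min_def)
  ultimately have "graft w (take i a) (take j (rev a)) = take (m - min m j) a @ drop (m - min m j) a"
    using graft_eq[of w "take i a" "take j (rev a)"] assms by simp
  then show ?thesis by simp
qed

text \<open>Mirrored entries of \<open>L\<close> agree only as sets, so their heads may differ and
  \<open>base\<close> need not be a palindrome. Writing the first half of \<open>base\<close> over
  its reversal repairs this; for odd \<open>m\<close> the middle position is its own mirror
  image.\<close>

lemma palindromic_base: "\<exists>u. prefix u base \<and> rev (overlay u (rev base)) = overlay u (rev base)"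
proof (intro exI conjI)
  let ?u = "take (m div 2) base"
  let ?w = "overlay ?u (rev base)"
  have len: "length base = m" by (simp add: base_def)
  show "prefix ?u base" by (rule take_is_prefix)
  show "rev ?w = ?w"
  proof (rule nth_equalityI)
    fix i assume "i < length (rev ?w)"
    then have i: "i < m" using len by (simp add: length_overlay)
    show "rev ?w ! i = ?w ! i"
    proof (cases "i < m div 2")
      case True
      then show ?thesis using i len by (auto simp: rev_nth length_overlay nth_overlay)
    next
      case False
      show ?thesis
      proof (cases "m - Suc i < m div 2")
        case True
        then show ?thesis using False i len by (auto simp: rev_nth length_overlay nth_overlay)
      next
        case f: False
        have "m - Suc i = i" using False f i by linarith
        then show ?thesis using i len by (simp add: rev_nth length_overlay)
      qed
    qed
  qed simp
qed

text \<open>Cut \<open>a\<close> and \<open>rev a\<close> one letter past their exits. If the cuts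
  fit into one tuple, every graft of them has the same two exit nodes; otherwise they cover
  \<open>a\<close>, and the graft is \<open>a\<close> itself.\<close>

lemma S_represents:
  assumes a: "a \<in> full"
  shows "\<exists>s\<in>S. cls I s = cls I a \<and> cls I (rev s) = cls I (rev a) \<and> (rev a = a \<longrightarrow> rev s = s)"
proof -
  obtain u where u: "prefix u base" "rev (overlay u (rev base)) = overlay u (rev base)"
    using palindromic_base by blast
  let ?w = "overlay u (rev base)"
  let ?x = "take (Suc (dep a)) a" and ?y = "take (Suc (dep (rev a))) (rev a)"
  let ?s = "graft ?w ?x ?y"
  have len: "length a = m" by (rule fullD[OF a])
  have w: "?w \<in> full"
    using u(1) part_prefix[OF full_part[OF base_full]] by (intro overlay_full rev_full base_full)
  have lw: "length ?w = m" using fullD(1)[OF w] .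
  have s: "?s \<in> S" using exit_Tp[OF a] exit_Tp[OF rev_full[OF a]] u(1) unfolding S_def by blast
  then have sf: "?s \<in> full" using S_full by blast
  show ?thesis
  proof (cases "length ?x + length ?y \<le> m")
    case True
    have "cls I ?s = cls I a"
      using node_same_exit[OF a sf prefix_graft[OF lw True]] cls_node by metis
    moreover have "cls I (rev ?s) = cls I (rev a)"
      using node_same_exit[OF rev_full[OF a] rev_full[OF sf] prefix_rev_graft] cls_node by metis
    moreover have "rev ?s = ?s" if "rev a = a"
    proof -
      have yx: "?y = ?x" using that by simp
      define k where "k = length ?x"
      have k: "k + k \<le> m" using True yx by (simp only: k_def)
      have "?s = take (m - k) (overlay ?x ?w) @ rev ?x"
        using graft_eq[OF lw, of ?x ?y] len yx by (simp only: k_def) simp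
      also have "take (m - k) (overlay ?x ?w) = ?x @ take (m - k - k) (drop k ?w)"
      proof -
        have "take (m - k) ?x = ?x" using k unfolding k_def by (intro take_all) linarith
        then show ?thesis by (simp only: overlay_def[of ?x] k_def[symmetric] take_append)
      qed
      finally have eq: "?s = ?x @ take (m - k - k) (drop k ?w) @ rev ?x" by simp
      \<comment> \<open>The cuts at both ends have the same length \<open>k\<close>, so what is left
        of the palindrome \<open>?w\<close> is a centred window, again a palindrome.\<close>
      have "rev (take (m - k - k) (drop k ?w)) = take (m - k - k) (drop k (rev ?w))"
        using k lw by (simp add: rev_take rev_drop drop_take)
      then show ?thesis using u(2) by (subst (1 2) eq) simp
    qed
    ultimately show ?thesis using s by blast
  next
    case False
    then have "?s = a"
      using len by (intro graft_takes[OF lw len]) simp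
    then show ?thesis using s by auto
  qed
qed

text \<open>The two cuts cover \<open>a\<close>, so grafting returns \<open>a\<close> and not merely
  a representative. This is what allows \<open>R\<close> to be found by searching
  \<open>S\<close>.\<close>

lemma deep_in_S:
  assumes a: "a \<in> full" and "m \<le> dep a + dep (rev a) + 1"
  shows "a \<in> S"
proof -
  let ?x = "take (Suc (dep a)) a" and ?y = "take (Suc (dep (rev a))) (rev a)"
  have w: "overlay [] (rev base) \<in> full"
    using rev_full[OF base_full] by (simp add: overlay_def)
  have "graft (overlay [] (rev base)) ?x ?y = a"
    using assms(2) by (intro graft_takes[OF fullD(1)[OF w] fullD(1)[OF a]]) linarith
  then show ?thesis
    using exit_Tp[OF a] exit_Tp[OF rev_full[OF a]] unfolding S_def
    by (metis (mono_tags, lifting) Nil_prefix mem_Collect_eq)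
qed

section \<open>Adjacency of exit nodes\<close>

lemma ex_props: "c \<in> ex p \<Longrightarrow> length p < m" "c \<in> ex p \<Longrightarrow> c \<in> set (L ! length p)"
  "c \<in> ex p \<Longrightarrow> p @ [c] \<notin> T"
  by (auto simp: ex_def split: if_splits)

lemma ex_iff: "length p < m \<Longrightarrow> c \<in> ex p \<longleftrightarrow> c \<in> set (L ! length p) \<and> p @ [c] \<notin> T"
  by (auto simp: ex_def)

lemma finite_ex: "finite (ex p)"
  by (simp add: ex_def)

lemma node_exI:
  assumes "p \<in> T" "c \<in> ex p" "prefix (p @ [c]) a"
  shows "node a = p"
proof (rule node_eqI[OF assms(1)])
  show "prefix p a" using assms(3) by (meson append_prefixD)
  show "take (Suc (length p)) a \<notin> T"
    using take_prefix_eq[OF assms(3), of "Suc (length p)"] ex_props(3)[OF assms(2)] by simp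
qed

lemma node_in_T1:
  assumes "a \<in> full" "dep a < m"
  shows "node a \<in> T1" "a ! dep a \<in> ex (node a)"
proof -
  have "take (Suc (dep a)) a = node a @ [a ! dep a]"
    using assms fullD(1)[OF assms(1)] node_take[of a] by (simp add: take_Suc_conv_app_nth)
  then show "a ! dep a \<in> ex (node a)"
    using node_exit[of a] assms by (simp add: ex_iff fullD)
  then show "node a \<in> T1" using node_T by (auto simp: T1_def)
qed

text \<open>The exit prefixes \<open>p @ [c]\<close> and \<open>q @ [d]\<close> fit into one full
  tuple without overlap, for any choice of exits.\<close>

lemma connect_far:
  assumes lab: "\<And>a. a \<in> full \<Longrightarrow> lab (cls I a) = lab (cls I (rev a))"
    and p: "p \<in> T1" "q \<in> T1" and len: "length p + length q + 2 \<le> m"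
  shows "lab (cls I p) = lab (cls I q)"
proof -
  obtain c d where cd: "c \<in> ex p" "d \<in> ex q" using p by (auto simp: T1_def)
  have pq: "p \<in> T" "q \<in> T" using p by (auto simp: T1_def)
  let ?s = "graft base (p @ [c]) (q @ [d])"
  have s: "?s \<in> full"
    using pq T_part cd by (intro graft_full base_full snoc_part) (auto dest: ex_props)
  have "node ?s = p"
    using len by (intro node_exI[OF pq(1) cd(1)] prefix_graft) (auto simp: base_def)
  moreover have "node (rev ?s) = q"
    by (intro node_exI[OF pq(2) cd(2)] prefix_rev_graft)
  ultimately show ?thesis using lab[OF s] cls_node by metis
qed

text \<open>Only one free position remains between \<open>p\<close> and the reversal of
  \<open>q\<close>. Its letter is read from both ends, so it has to be an exit of both
  nodes.\<close>

lemma connect_near: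
  assumes lab: "\<And>a. a \<in> full \<Longrightarrow> lab (cls I a) = lab (cls I (rev a))"
    and p: "p \<in> T" "q \<in> T" and len: "length p + length q + 1 = m"
    and c: "c \<in> ex p" "c \<in> ex q"
  shows "lab (cls I p) = lab (cls I q)"
proof -
  let ?s = "graft base (p @ [c]) q"
  have s: "?s \<in> full"
    using p T_part c by (intro graft_full base_full snoc_part) (auto dest: ex_props)
  have eq: "?s = p @ [c] @ rev q"
  proof -
    have "m - length q = length (p @ [c])" using len by simp
    then show ?thesis using len
      by (subst graft_eq) (simp_all add: base_def overlay_def del: append_assoc length_append)
  qed
  have "node ?s = p"
    by (rule node_exI[OF p(1) c(1)]) (simp add: eq)
  moreover have "node (rev ?s) = q"
    by (rule node_exI[OF p(2) c(2)]) (simp add: eq)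
  ultimately show ?thesis using lab[OF s] cls_node by metis
qed

section \<open>Counting the tuples outside the large component\<close>

lemma T_level: "card {x \<in> T. length x = Suc d} \<le> card I"
proof -
  have "{x \<in> T. length x = Suc d} \<subseteq> take (Suc d) ` I"
  proof
    fix x assume x: "x \<in> {x \<in> T. length x = Suc d}"
    then obtain q where "q \<in> I" "prefix x q" by (auto simp: T_def)
    then show "x \<in> take (Suc d) ` I"
      using x take_prefix_eq[of x q "Suc d"] by (intro image_eqI[of _ _ q]) auto
  qed
  then show ?thesis using fin by (meson card_image_le card_mono finite_imageI le_trans)
qed

text \<open>For \<open>m = 0\<close> the empty tuple is a full tuple in \<open>T\<close> that need
  not be queried.\<close>

lemma T_full:
  assumes "a \<in> T" "length a = m" "m \<noteq> 0"
  shows "a \<in> I"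
proof -
  obtain q where q: "q \<in> insert [] I" "prefix a q" using assms(1) by (auto simp: T_def)
  moreover have "a \<noteq> []" using assms(2,3) by auto
  ultimately have "q \<in> I" by auto
  moreover obtain zs where zs: "q = a @ zs" using q(2) by (rule prefixE)
  moreover have "length q \<le> length a" using I_len[OF \<open>q \<in> I\<close>] assms(2) by simp
  ultimately show ?thesis by simp
qed

text \<open>Cut \<open>a\<close> at its exit depth \<open>i\<close>. The front is a prefix of a
  query, and so is the reversal of the rest, because \<open>dep (rev a)\<close> is at least
  \<open>m - i\<close>. A depth equal to \<open>m\<close> means that \<open>a\<close> or
  \<open>rev a\<close> is itself a query.\<close>

lemma deep_subset:
  assumes "m \<noteq> 0"
  shows "{a \<in> full. m \<le> dep a + dep (rev a)} \<subseteq>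
    I \<union> rev ` I \<union> (\<lambda>(p, q, i). take i p @ rev (take (m - i) q)) ` (I \<times> I \<times> {1..<m})"
proof
  fix a assume "a \<in> {a \<in> full. m \<le> dep a + dep (rev a)}"
  then have a: "a \<in> full" and deep: "m \<le> dep a + dep (rev a)" by auto
  have len: "length a = m" by (rule fullD[OF a])
  consider "dep a = m" | "dep (rev a) = m" | "dep a < m" "dep (rev a) < m"
    using dep_le[OF a] dep_le[OF rev_full[OF a]] by linarith
  then show "a \<in> I \<union> rev ` I \<union> (\<lambda>(p, q, i). take i p @ rev (take (m - i) q)) ` (I \<times> I \<times> {1..<m})"
  proof cases
    case 1
    then have "a \<in> T" using node_take[of a] node_T[of a] len by simp
    then show ?thesis using T_full len assms by blast
  next
    case 2
    then have "rev a \<in> T" using node_take[of "rev a"] node_T[of "rev a"] len by simp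
    then have "rev a \<in> I" using T_full len assms by simp
    then have "a \<in> rev ` I" by (intro image_eqI[of _ _ "rev a"]) simp_all
    then show ?thesis by blast
  next
    case 3
    define i where "i = dep a"
    \<comment> \<open>Both depths are positive, so the nodes extend to genuine queries and not to
      the empty tuple added to \<open>T\<close>; this also leaves only \<open>m - 1\<close> values
      of \<open>i\<close>.\<close>
    have i: "1 \<le> i" "i < m" "m - i \<le> dep (rev a)" "1 \<le> dep (rev a)" using 3 deep by (auto simp: i_def)
    obtain p where p: "p \<in> I" "prefix (node a) p"
      using node_T[of a] i by (auto simp: T_def i_def)
    obtain q where q: "q \<in> I" "prefix (node (rev a)) q"
      using node_T[of "rev a"] i by (auto simp: T_def)
    have "take i p = take i a"
      using take_prefix_eq[OF p(2), of i] take_prefix_eq[OF prefix_cls[of T a], of i] by (simp add: i_def)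
    moreover have "take (m - i) q = take (m - i) (rev a)"
      using take_prefix_eq[OF q(2) i(3)] take_prefix_eq[OF prefix_cls[of T "rev a"] i(3)] by simp
    ultimately have "a = take i p @ rev (take (m - i) q)"
      using len i by (simp add: rev_take)
    then show ?thesis using p q i by (intro UnI2 image_eqI[of _ _ "(p, q, i)"]) auto
  qed
qed

text \<open>Least depth makes far connections to \<open>r\<close> as frequent as possible; the
  number of exits matters only among nodes of that depth. If \<open>T1\<close> is empty, every full
  tuple stays in \<open>T\<close>, and \<open>[]\<close> is a default.\<close>

definition optimal_exit :: "'a list \<Rightarrow> bool" where
  "optimal_exit r \<longleftrightarrow> (if T1 = {} then r = [] else r \<in> T1 \<and> (\<forall>q\<in>T1. length r \<le> length q) \<and>
     (\<forall>q\<in>T1. length q = length r \<longrightarrow> card (ex q) \<le> card (ex r)))"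

text \<open>By \<open>connect_far\<close>, each of the two depths plus \<open>length r\<close> is at
  least \<open>m - 1\<close>, while the two depths add up to at most \<open>m - 1\<close>. As
  \<open>length r\<close> is least possible, all three are equal and \<open>m\<close> is twice that
  depth plus 1. Then \<open>connect_near\<close> forbids common exits.\<close>

lemma shallow_outsider:
  assumes lab: "\<And>a. a \<in> full \<Longrightarrow> lab (cls I a) = lab (cls I (rev a))"
    and r: "optimal_exit r" and a: "a \<in> full" "dep a + dep (rev a) < m"
    and out: "lab (cls I a) \<noteq> lab (cls I r)"
  shows "dep a = length r" "dep (rev a) = length r" "m = 2 * length r + 1"
    "ex (node a) \<inter> ex r = {}" "ex (node (rev a)) \<inter> ex r = {}" "node a \<in> T1" "node (rev a) \<in> T1" "r \<in> T1"
proof -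
  have p: "node a \<in> T1" and q: "node (rev a) \<in> T1"
    using a node_in_T1(1)[of a] node_in_T1(1)[of "rev a"] rev_full by auto
  then have r': "r \<in> T1" "\<And>q. q \<in> T1 \<Longrightarrow> length r \<le> length q"
    using r by (auto simp: optimal_exit_def split: if_splits)
  have out2: "lab (cls I (node a)) \<noteq> lab (cls I r)" "lab (cls I (node (rev a))) \<noteq> lab (cls I r)"
    using out lab[OF a(1)] by (auto simp: cls_node)
  have "\<not> dep a + length r + 2 \<le> m" "\<not> dep (rev a) + length r + 2 \<le> m"
    using connect_far[OF lab p r'(1)] connect_far[OF lab q r'(1)] out2 by auto
  then show len: "dep a = length r" "dep (rev a) = length r" "m = 2 * length r + 1"
    using r'(2)[OF p] r'(2)[OF q] a(2) by linarith+
  have rT: "r \<in> T" using r'(1) by (simp add: T1_def)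
  show "ex (node a) \<inter> ex r = {}"
    using connect_near[OF lab node_T rT, of a] len out2(1) by auto
  show "ex (node (rev a)) \<inter> ex r = {}"
    using connect_near[OF lab node_T rT, of "rev a"] len out2(2) by auto
  show "node a \<in> T1" "node (rev a) \<in> T1" "r \<in> T1" by fact+
qed

text \<open>
  At the critical depth every outsider's exit node has at most as many exits as children in \<open>T\<close>,
  and there are at most \<open>card I\<close> children altogether.
\<close>

lemma card_shallow_outsiders:
  assumes lab: "\<And>a. a \<in> full \<Longrightarrow> lab (cls I a) = lab (cls I (rev a))"
    and r: "optimal_exit r"
  shows "card {a \<in> full. dep a + dep (rev a) < m \<and> lab (cls I a) \<noteq> lab (cls I r)} \<le> card I ^ 2"
    (is "card ?N \<le> _")
proof (cases "?N = {}")
  case False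
  define d where "d = length r"
  define X where "X = {p \<in> T1. length p = d \<and> ex p \<inter> ex r = {}}"
  define ch where "ch p = {c \<in> set (L ! d). p @ [c] \<in> T}" for p
  obtain a0 where "a0 \<in> ?N" using False by blast
  then have rT1: "r \<in> T1" and md: "m = 2 * d + 1"
    using shallow_outsider[OF lab r, of a0] by (auto simp: d_def)
  have finX: "finite X"
  proof (rule finite_subset)
    show "X \<subseteq> take d ` insert [] I"
    proof
      fix p assume "p \<in> X"
      then obtain q where "q \<in> insert [] I" "prefix p q" "length p = d" by (auto simp: X_def T1_def T_def)
      then show "p \<in> take d ` insert [] I"
        using take_prefix_eq[of p q d] by (metis image_eqI order_refl take_all)
    qed
  qed (use fin in auto)
  have finch: "finite (ch p)" for p by (simp add: ch_def)
  have card_ex: "card (ex p) \<le> card (ch p)" "1 \<le> card (ch p)" if "p \<in> X" for p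
  proof -
    have p: "p \<in> T1" "length p = d" "ex p \<inter> ex r = {}" using that by (auto simp: X_def)
    have "ex p \<noteq> {}" using p by (simp add: T1_def)
    then have "1 \<le> card (ex p)" using finite_ex[of p] by (simp add: Suc_le_eq card_gt_0_iff)
    moreover have "card (ex p) \<le> card (ex r)"
      using r p rT1 by (auto simp: optimal_exit_def d_def split: if_splits)
    \<comment> \<open>At the middle depth both nodes choose from the same alphabet. A letter that
      leaves \<open>T\<close> at \<open>r\<close> does not leave it at \<open>p\<close>, so it leads
      from \<open>p\<close> to a child in \<open>T\<close>.\<close>
    moreover have "ex r \<subseteq> ch p"
    proof
      fix c assume c: "c \<in> ex r"
      then have "c \<in> set (L ! d)" using ex_props(2) by (simp add: d_def)
      moreover have "c \<notin> ex p" using c p(3) by blast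
      ultimately show "c \<in> ch p" using md p(2) by (simp add: ch_def ex_iff)
    qed
    then have "card (ex r) \<le> card (ch p)" using finch card_mono by blast
    ultimately show "card (ex p) \<le> card (ch p)" "1 \<le> card (ch p)" by linarith+
  qed
  have "(\<Sum>p\<in>X. card (ch p)) = card (Sigma X ch)"
    using finX finch by simp
  also have "\<dots> = card ((\<lambda>(p, c). p @ [c]) ` Sigma X ch)"
    by (rule card_image[symmetric]) (auto simp: inj_on_def)
  also have "\<dots> \<le> card {x \<in> T. length x = Suc d}"
  proof (rule card_mono)
    show "finite {x \<in> T. length x = Suc d}"
      by (rule finite_subset[of _ "part"]) (use T_part finite_part in auto)
  qed (auto simp: X_def ch_def)
  also have "\<dots> \<le> card I" by (rule T_level)
  finally have ch: "(\<Sum>p\<in>X. card (ch p)) \<le> card I" .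
  have 1: "card X \<le> card I"
    using ch sum_mono[of X "\<lambda>_. 1" "\<lambda>p. card (ch p)"] card_ex(2) by simp
  have 2: "card (Sigma X ex) \<le> card I"
    using ch sum_mono[of X "\<lambda>p. card (ex p)" "\<lambda>p. card (ch p)"] card_ex(1) finX finite_ex by simp
  \<comment> \<open>A tuple is determined by its front node together with the middle letter, which
    is an exit there, and by its back node: \<open>card I\<close> choices for each of the two
    parts.\<close>
  have "?N \<subseteq> (\<lambda>((p, c), q). p @ [c] @ rev q) ` (Sigma X ex \<times> X)"
  proof
    fix a assume a: "a \<in> ?N"
    then have af: "a \<in> full" and sh: "dep a + dep (rev a) < m" by auto
    have out: "lab (cls I a) \<noteq> lab (cls I r)" using a by blast
    note * = shallow_outsider[OF lab r af sh out]
    have X: "node a \<in> X" "node (rev a) \<in> X" using * by (auto simp: X_def d_def)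
    have "a ! d \<in> ex (node a)" using node_in_T1(2)[OF af] sh *(1) by (simp add: d_def)
    moreover have "a = node a @ [a ! d] @ rev (node (rev a))"
    proof -
      have "node a = take d a" using node_take[of a] *(1) by (simp add: d_def)
      moreover have "rev (node (rev a)) = drop (Suc d) a"
        using node_take[of "rev a"] *(2) md fullD(1)[OF af] by (simp add: d_def rev_take)
      ultimately show ?thesis using md fullD(1)[OF af] by (simp add: id_take_nth_drop[symmetric])
    qed
    ultimately show "a \<in> (\<lambda>((p, c), q). p @ [c] @ rev q) ` (Sigma X ex \<times> X)"
      using X by (intro image_eqI[of _ _ "((node a, a ! d), node (rev a))"]) auto
  qed
  then have "card ?N \<le> card (Sigma X ex \<times> X)"
    using finX finite_ex by (intro surj_card_le) auto
  also have "\<dots> \<le> card I * card I"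
    using 1 2 by (simp only: card_cartesian_product mult_le_mono)
  finally show ?thesis by (simp add: power2_eq_square)
qed (simp only: card.empty zero_le)

text \<open>Shallow outsiders have depths with sum exactly \<open>m - 1\<close>, just within the
  reach of \<open>deep_in_S\<close>.\<close>

lemma outsiders_in_S:
  assumes lab: "\<And>a. a \<in> full \<Longrightarrow> lab (cls I a) = lab (cls I (rev a))"
    and r: "optimal_exit r" and a: "a \<in> full" "lab (cls I a) \<noteq> lab (cls I r)"
  shows "a \<in> S"
proof (rule deep_in_S[OF a(1)])
  show "m \<le> dep a + dep (rev a) + 1"
    using shallow_outsider[OF lab r a(1) _ a(2)] by linarith
qed

lemma card_outsiders:
  assumes lab: "\<And>a. a \<in> full \<Longrightarrow> lab (cls I a) = lab (cls I (rev a))"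
    and r: "optimal_exit r"
  shows "card {a \<in> full. lab (cls I a) \<noteq> lab (cls I r)} \<le> card I ^ 2 * m ^ 2" (is "card ?N \<le> _")
proof -
  let ?D = "{a \<in> full. m \<le> dep a + dep (rev a)}"
  let ?M = "{a \<in> full. dep a + dep (rev a) < m \<and> lab (cls I a) \<noteq> lab (cls I r)}"
  have N: "?N \<subseteq> ?D \<union> ?M" by auto
  consider "m = 0" | "m = 1" | "2 \<le> m" by linarith
  then show ?thesis
  proof cases
    case 1
    then have "ex p = {}" for p unfolding ex_def by simp
    then have "r = []" using r by (simp add: optimal_exit_def T1_def)
    then have "?N = {}" using 1 fullD(1) by fastforce
    then show ?thesis by (simp only: card.empty zero_le)
  next
    case 2
    \<comment> \<open>Here the exit node and the root both have depth 0, so they coincide, and a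
      nonempty set of exits is not disjoint from itself.\<close>
    have "?M = {}"
    proof (rule ccontr)
      assume "?M \<noteq> {}"
      then obtain a where a: "a \<in> full" "dep a + dep (rev a) < m" "lab (cls I a) \<noteq> lab (cls I r)" by blast
      note * = shallow_outsider[OF lab r a]
      have "node a = r" using *(1,3) 2 by simp
      then show False using *(4,8) by (simp add: T1_def)
    qed
    moreover have "?D \<subseteq> I"
    proof
      fix a assume a: "a \<in> ?D"
      then have "length a = 1" using fullD(1) 2 by auto
      then have ra: "rev a = a" by (cases a) auto
      have "m \<noteq> 0" using 2 by simp
      from subsetD[OF deep_subset[OF this] a] have "a \<in> I \<union> rev ` I"
        unfolding 2 by (simp only: atLeastLessThan_empty[OF order_refl] Sigma_empty2 image_empty Un_empty_right)
      then show "a \<in> I" using ra by (auto simp: rev_swap)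
    qed
    ultimately have "card ?N \<le> card I" using N fin by (intro card_mono) auto
    also have "\<dots> \<le> card I ^ 2 * m ^ 2" using 2 by (simp add: power2_eq_square)
    finally show ?thesis .
  next
    case 3
    let ?f = "\<lambda>(p, q, i). take i p @ rev (take (m - i) q)"
    have "card ?D \<le> card (I \<union> rev ` I \<union> ?f ` (I \<times> I \<times> {1..<m}))"
      using 3 fin by (intro card_mono deep_subset) auto
    also have "\<dots> \<le> card (I \<union> rev ` I) + card (?f ` (I \<times> I \<times> {1..<m}))" by (rule card_Un_le)
    also have "\<dots> \<le> (card I + card (rev ` I)) + card (I \<times> I \<times> {1..<m})"
      using fin by (intro add_mono card_Un_le card_image_le) auto
    also have "\<dots> \<le> 2 * card I + card I ^ 2 * (m - 1)"
      using card_image_le[OF fin, of rev] by (simp add: power2_eq_square card_cartesian_product)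
    finally have D: "card ?D \<le> 2 * card I + card I ^ 2 * (m - 1)" .
    have "card ?N \<le> card (?D \<union> ?M)"
      using finite_full by (intro card_mono N) auto
    also have "\<dots> \<le> card ?D + card ?M" by (rule card_Un_le)
    also have "\<dots> \<le> 2 * card I + card I ^ 2 * (m - 1) + card I ^ 2"
      using D card_shallow_outsiders[OF lab r] by linarith
    also have "\<dots> \<le> 2 * card I ^ 2 + card I ^ 2 * (m - 1) + card I ^ 2"
      by (simp add: power2_eq_square)
    also have "\<dots> = card I ^ 2 * (m + 2)" using 3 by (cases m) (auto simp: algebra_simps)
    also have "\<dots> \<le> card I ^ 2 * m ^ 2"
    proof (rule mult_left_mono)
      have "m + 2 \<le> 2 * m" using 3 by simp
      also have "\<dots> \<le> m * m" using 3 by (intro mult_right_mono) auto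
      finally show "m + 2 \<le> m ^ 2" by (simp add: power2_eq_square)
    qed simp
    finally show ?thesis .
  qed
qed

end

section \<open>Finite sums\<close>

lemma (in abelian_monoid) finsum_swap:
  assumes "finite A" "finite B" "\<And>a b. a \<in> A \<Longrightarrow> b \<in> B \<Longrightarrow> f a b \<in> carrier G"
  shows "(\<Oplus>a\<in>A. \<Oplus>b\<in>B. f a b) = (\<Oplus>b\<in>B. \<Oplus>a\<in>A. f a b)"
  using assms(1,3)
proof (induction A rule: finite_induct)
  case empty
  then show ?case by (simp add: finsum_zero)
next
  case (insert x A)
  have "(\<Oplus>b\<in>B. \<Oplus>a\<in>insert x A. f a b) = (\<Oplus>b\<in>B. f x b \<oplus> (\<Oplus>a\<in>A. f a b))"
    using insert by (intro finsum_cong' refl) (auto intro!: finsum_insert a_closed finsum_closed)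
  also have "\<dots> = (\<Oplus>b\<in>B. f x b) \<oplus> (\<Oplus>b\<in>B. \<Oplus>a\<in>A. f a b)"
    using insert by (intro finsum_addf) (auto intro!: finsum_closed)
  also have "\<dots> = (\<Oplus>a\<in>insert x A. \<Oplus>b\<in>B. f a b)"
    using insert by (subst finsum_insert) (auto intro!: finsum_closed)
  finally show ?case ..
qed

lemma (in abelian_monoid) finsum_delta:
  assumes "finite A" "a \<in> A" "f a \<in> carrier G"
  shows "(\<Oplus>x\<in>A. if x = a then f x else \<zero>) = f a"
proof -
  have "(\<Oplus>x\<in>A. if x = a then f x else \<zero>) = (\<Oplus>x\<in>A. if a = x then f a else \<zero>)"
    using assms by (intro finsum_cong') auto
  also have "\<dots> = f a" using finsum_singleton[of a A "\<lambda>_. f a"] assms by simp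
  finally show ?thesis .
qed

lemma (in abelian_monoid) finsum_zeroI:
  "(\<And>x. x \<in> A \<Longrightarrow> f x = \<zero>) \<Longrightarrow> finsum G f A = \<zero>"
  using add.finprod_one_eqI by blast

lemma (in abelian_monoid) finsum_Plus:
  assumes "finite A" "finite B" "f \<in> A <+> B \<rightarrow> carrier G"
  shows "finsum G f (A <+> B) = (\<Oplus>a\<in>A. f (Inl a)) \<oplus> (\<Oplus>b\<in>B. f (Inr b))"
proof -
  have "finsum G f (A <+> B) = finsum G f (Inl ` A) \<oplus> finsum G f (Inr ` B)"
    unfolding Plus_def using assms by (intro finsum_Un_disjoint) auto
  then show ?thesis using assms by (subst (asm) (1 2) finsum_reindex) auto
qed

text \<open>Orbits of the involution are removed one at a time, and pairs cancel. At a fixed point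
  antisymmetry yields only \<open>H a \<oplus> H a = \<zero>\<close>, which says nothing in
  characteristic 2; hence the last hypothesis.\<close>

lemma (in abelian_group) finsum_antisymmetric:
  assumes "finite X" "\<And>a. a \<in> X \<Longrightarrow> \<sigma> a \<in> X" "\<And>a. a \<in> X \<Longrightarrow> \<sigma> (\<sigma> a) = a"
    "\<And>a. a \<in> X \<Longrightarrow> H a \<in> carrier G" "\<And>a. a \<in> X \<Longrightarrow> H a \<oplus> H (\<sigma> a) = \<zero>"
    "\<And>a. a \<in> X \<Longrightarrow> \<sigma> a = a \<Longrightarrow> H a = \<zero>"
  shows "(\<Oplus>a\<in>X. H a) = \<zero>"
  using assms
proof (induction X rule: finite_psubset_induct)
  case (psubset X)
  show ?case
  proof (cases "X = {}")
    case False
    then obtain a where a: "a \<in> X" by blast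
    let ?Y = "X - {a, \<sigma> a}"
    have Y: "(\<Oplus>a\<in>?Y. H a) = \<zero>"
    proof (rule psubset.IH)
      show "?Y \<subset> X" using a by blast
      show "\<sigma> b \<in> ?Y" if "b \<in> ?Y" for b
        using that psubset.prems(1)[of b] psubset.prems(2)[of b] psubset.prems(2)[OF a] by auto
    qed (use psubset.prems in auto)
    show ?thesis
    proof (cases "\<sigma> a = a")
      case True
      have X: "X = insert a ?Y" using a True by blast
      have "(\<Oplus>a\<in>insert a ?Y. H a) = H a \<oplus> (\<Oplus>a\<in>?Y. H a)"
        using psubset.hyps psubset.prems(3) a by (intro finsum_insert) auto
      then show ?thesis using psubset.prems(5)[OF a True] X Y by simp
    next
      case False
      have X: "X = insert a (insert (\<sigma> a) ?Y)" using a psubset.prems(1)[OF a] by blast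
      have "(\<Oplus>a\<in>insert a (insert (\<sigma> a) ?Y). H a) = H a \<oplus> (\<Oplus>a\<in>insert (\<sigma> a) ?Y. H a)"
        using psubset.hyps psubset.prems(1,3) False a by (intro finsum_insert) auto
      also have "(\<Oplus>a\<in>insert (\<sigma> a) ?Y. H a) = H (\<sigma> a) \<oplus> (\<Oplus>a\<in>?Y. H a)"
        using psubset.hyps psubset.prems(1,3) False a by (intro finsum_insert) auto
      finally have "(\<Oplus>a\<in>X. H a) = H a \<oplus> H (\<sigma> a)"
        using X Y psubset.prems(1,3) a by simp
      then show ?thesis using psubset.prems(4)[OF a] by simp
    qed
  qed simp
qed

section \<open>Constraints from class functions\<close>

context ring
begin

text \<open>Moebius inversion on the tree of queries: \<open>cls I (butlast x)\<close> is the next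
  shorter query below \<open>x\<close>, so adding these differences along the prefixes of a tuple
  leaves the value of \<open>U\<close> at its class.\<close>

definition zc :: "'c list set \<Rightarrow> ('c list \<Rightarrow> 'a) \<Rightarrow> 'c list \<Rightarrow> 'a" where
  "zc I U x = (if x = [] then U x else U x \<oplus> \<ominus> U (cls I (butlast x)))"

lemma zc_closed: "(\<And>x. U x \<in> carrier R) \<Longrightarrow> zc I U x \<in> carrier R"
  by (simp add: zc_def)

text \<open>The class \<open>[]\<close> serves two purposes: the empty query and the tuples with no
  queried prefix. For the latter the sum is empty, so \<open>U []\<close> has to vanish when the
  empty tuple is not queried.\<close>

lemma zc_telescope:
  assumes U: "\<And>x. U x \<in> carrier R" and "finite I" "[] \<notin> I \<Longrightarrow> U [] = \<zero>"
  shows "(\<Oplus>x\<in>I. if prefix x a then zc I U x else \<zero>) = U (cls I a)"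
proof (induction a rule: rev_induct)
  case Nil
  show ?case
  proof (cases "[] \<in> I")
    case True
    then show ?thesis using finsum_delta[of I "[]" "zc I U"] assms zc_closed[of U, OF U]
      by (simp add: zc_def)
  next
    case False
    then show ?thesis using assms(3) by (auto intro!: finsum_zeroI)
  qed
next
  case (snoc c b)
  show ?case
  proof (cases "b @ [c] \<in> I")
    case True
    have "(\<Oplus>x\<in>I. if prefix x (b @ [c]) then zc I U x else \<zero>) =
      (\<Oplus>x\<in>I. (if x = b @ [c] then zc I U x else \<zero>) \<oplus> (if prefix x b then zc I U x else \<zero>))"
      using zc_closed[of U, OF U] by (intro finsum_cong') (auto simp: prefix_snoc)
    also have "\<dots> = zc I U (b @ [c]) \<oplus> U (cls I b)"
      using zc_closed[of U, OF U] True assms(2) snoc.IH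
      by (subst finsum_addf) (auto simp: finsum_delta)
    also have "\<dots> = U (b @ [c])"
      using U by (simp add: zc_def a_assoc l_neg)
    finally show ?thesis using True by (simp add: cls_snoc)
  next
    case False
    then have "(\<Oplus>x\<in>I. if prefix x (b @ [c]) then zc I U x else \<zero>) =
      (\<Oplus>x\<in>I. if prefix x b then zc I U x else \<zero>)"
      using zc_closed[of U, OF U] by (intro finsum_cong') (auto simp: prefix_snoc)
    then show ?thesis using False snoc.IH by (simp add: cls_snoc)
  qed
qed

text \<open>Exchange the sums and telescope the inner one. The index set \<open>X\<close> is left
  open: it will be the full tuples when \<open>w\<close> is a message, and the queries themselves
  when \<open>w\<close> is a mass placed on them.\<close>

lemma zc_pairing:
  assumes U: "\<And>x. U x \<in> carrier R" and I: "finite I" "[] \<notin> I \<Longrightarrow> U [] = \<zero>"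
    and X: "finite X" "\<And>a. a \<in> X \<Longrightarrow> w a \<in> carrier R"
  shows "(\<Oplus>x\<in>I. zc I U x \<otimes> (\<Oplus>a\<in>X. if prefix x a then w a else \<zero>)) = (\<Oplus>a\<in>X. U (cls I a) \<otimes> w a)"
proof -
  let ?e = "\<lambda>x a. (if prefix x a then zc I U x else \<zero>) \<otimes> w a"
  note zc_closed[of U, OF U, simp]
  have "zc I U x \<otimes> (\<Oplus>a\<in>X. if prefix x a then w a else \<zero>) = (\<Oplus>a\<in>X. ?e x a)" for x
  proof -
    have "zc I U x \<otimes> (\<Oplus>a\<in>X. if prefix x a then w a else \<zero>) =
      (\<Oplus>a\<in>X. zc I U x \<otimes> (if prefix x a then w a else \<zero>))"
      using X by (intro finsum_rdistr) auto
    also have "\<dots> = (\<Oplus>a\<in>X. ?e x a)"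
      using X by (intro finsum_cong') auto
    finally show ?thesis .
  qed
  then have "(\<Oplus>x\<in>I. zc I U x \<otimes> (\<Oplus>a\<in>X. if prefix x a then w a else \<zero>)) = (\<Oplus>x\<in>I. \<Oplus>a\<in>X. ?e x a)"
    by simp
  also have "\<dots> = (\<Oplus>a\<in>X. \<Oplus>x\<in>I. ?e x a)"
    using X I by (intro finsum_swap) auto
  also have "\<dots> = (\<Oplus>a\<in>X. U (cls I a) \<otimes> w a)"
  proof (intro finsum_cong' refl)
    fix a assume a: "a \<in> X"
    have "(\<Oplus>x\<in>I. ?e x a) = (\<Oplus>x\<in>I. if prefix x a then zc I U x else \<zero>) \<otimes> w a"
      using X a I by (intro finsum_ldistr[symmetric]) auto
    then show "(\<Oplus>x\<in>I. ?e x a) = U (cls I a) \<otimes> w a"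
      using zc_telescope[of U I a] U I by simp
  qed (use U X in auto)
  finally show ?thesis .
qed

text \<open>The prefix order makes the system unitriangular, so arbitrary values on \<open>I\<close>
  are prefix sums of masses placed at the queries themselves.\<close>

lemma prefix_triangular:
  assumes "finite I" "\<And>x. x \<in> I \<Longrightarrow> \<eta> x \<in> carrier R"
  shows "\<exists>t. (\<forall>y. t y \<in> carrier R) \<and> (\<forall>x\<in>I. (\<Oplus>y\<in>I. if prefix x y then t y else \<zero>) = \<eta> x)"
  using assms
\<comment> \<open>Ranking by negative length makes the new query a shortest one. No other query is a
  prefix of it, so its mass enters its own equation only.\<close>
proof (induction I rule: finite_ranking_induct[where f = "\<lambda>x. - int (length x)"])
  case empty
  then show ?case by (intro exI[of _ "\<lambda>_. \<zero>"]) auto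
next
  case (insert x0 J)
  show ?case
  proof (cases "x0 \<in> J")
    case True
    then show ?thesis using insert by (simp add: insert_absorb)
  next
    case False
    obtain t where t: "\<And>y. t y \<in> carrier R" "\<And>x. x \<in> J \<Longrightarrow> (\<Oplus>y\<in>J. if prefix x y then t y else \<zero>) = \<eta> x"
      using insert.IH[OF insert.prems[OF insertI2]] by blast
    define s where "s = (\<Oplus>y\<in>J. if prefix x0 y then t y else \<zero>)"
    have s: "s \<in> carrier R" unfolding s_def using t by (auto intro!: finsum_closed)
    define t' where "t' = t(x0 := \<eta> x0 \<oplus> \<ominus> s)"
    have x0: "\<eta> x0 \<in> carrier R" using insert.prems by simp
    have t': "t' y \<in> carrier R" for y using t(1) s x0 by (simp add: t'_def)
    have step: "(\<Oplus>y\<in>insert x0 J. if prefix x y then t' y else \<zero>) =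
      (if prefix x x0 then \<eta> x0 \<oplus> \<ominus> s else \<zero>) \<oplus> (\<Oplus>y\<in>J. if prefix x y then t y else \<zero>)" for x
    proof -
      have "(\<Oplus>y\<in>insert x0 J. if prefix x y then t' y else \<zero>) =
        (if prefix x x0 then t' x0 else \<zero>) \<oplus> (\<Oplus>y\<in>J. if prefix x y then t' y else \<zero>)"
        using insert.hyps False t' by (intro finsum_insert) auto
      also have "(\<Oplus>y\<in>J. if prefix x y then t' y else \<zero>) = (\<Oplus>y\<in>J. if prefix x y then t y else \<zero>)"
        using False t(1) by (intro finsum_cong') (auto simp: t'_def)
      finally show ?thesis by (simp add: t'_def)
    qed
    have "(\<Oplus>y\<in>insert x0 J. if prefix x y then t' y else \<zero>) = \<eta> x" if "x \<in> insert x0 J" for x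
    proof (cases "x = x0")
      case True
      then show ?thesis using s x0 unfolding step s_def[symmetric]
        by (simp add: a_assoc l_neg s_def[symmetric])
    next
      case neq: False
      then have "x \<in> J" using that by simp
      moreover have "\<not> prefix x x0"
      proof
        assume "prefix x x0"
        then have "strict_prefix x x0" using neq by (simp add: strict_prefix_def)
        then have "length x < length x0" by (rule prefix_length_less)
        then show False using insert.hyps(2)[OF \<open>x \<in> J\<close>] by simp
      qed
      ultimately show ?thesis using t insert.prems by (simp add: step)
    qed
    then show ?thesis using t' by blast
  qed
qed

end

section \<open>Antisymmetric flows on the classes\<close>

locale sym_enc = field F + query L I
  for F :: "'a ring" (structure) and L :: "'a list list" and I :: "'a list set" +
  fixes dead :: "'a list"
  assumes dead_long: "m < length dead"
begin

text \<open>On partial tuples this is \<open>Sigma_sum\<close>, but indexed by full tuples, so that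
  all positions share one index set.\<close>

definition psum :: "('a list \<Rightarrow> 'a) \<Rightarrow> 'a list \<Rightarrow> 'a" where
  "psum w x = (\<Oplus>a\<in>full. if prefix x a then w a else \<zero>)"

definition anti :: "('a list \<Rightarrow> 'a) set" where
  "anti = {w \<in> full \<rightarrow>\<^sub>E carrier F. \<forall>x\<in>full. w x \<oplus> w (rev x) = \<zero>}"

text \<open>The achievable offsets: what the randomness can add to the queried values.\<close>

definition ach :: "('a list \<Rightarrow> 'a) \<Rightarrow> bool" where
  "ach \<eta> \<longleftrightarrow> (\<exists>G\<in>anti. \<forall>x\<in>I. psum G x = \<eta> x)"

text \<open>What the queries see of a unit mass in class \<open>y\<close>. Mass at
  \<open>dead\<close> is invisible, which is how this vertex can absorb any amount.\<close>

definition chi :: "'a list \<Rightarrow> 'a list \<Rightarrow> 'a" where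
  "chi y x = (if y = dead \<or> \<not> prefix x y then \<zero> else \<one>)"

text \<open>Two vertices are equivalent if any amount can be sent from one to the other by an antisymmetric flow.\<close>

definition flow_equiv :: "'a list \<Rightarrow> 'a list \<Rightarrow> bool" where
  "flow_equiv y z \<longleftrightarrow> (\<forall>c\<in>carrier F. ach (\<lambda>x. c \<otimes> (chi y x \<ominus> chi z x)))"

lemma chi_closed [simp]: "chi y x \<in> carrier F"
  by (simp add: chi_def)

lemma anti_closed: "G \<in> anti \<Longrightarrow> a \<in> full \<Longrightarrow> G a \<in> carrier F"
  by (auto simp: anti_def)

lemma psum_closed: "(\<And>a. a \<in> full \<Longrightarrow> w a \<in> carrier F) \<Longrightarrow> psum w x \<in> carrier F"
  by (auto simp: psum_def intro!: finsum_closed)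

lemma psum_add:
  assumes "\<And>a. a \<in> full \<Longrightarrow> v a \<in> carrier F" "\<And>a. a \<in> full \<Longrightarrow> w a \<in> carrier F"
    "\<And>a. a \<in> full \<Longrightarrow> u a = v a \<oplus> w a"
  shows "psum u x = psum v x \<oplus> psum w x"
proof -
  have "psum u x = (\<Oplus>a\<in>full. (if prefix x a then v a else \<zero>) \<oplus> (if prefix x a then w a else \<zero>))"
    unfolding psum_def using assms by (intro finsum_cong') auto
  also have "\<dots> = psum v x \<oplus> psum w x"
    unfolding psum_def using assms by (intro finsum_addf) auto
  finally show ?thesis .
qed

lemma psum_delta:
  assumes "a \<in> full" "c \<in> carrier F" "\<And>b. b \<in> full \<Longrightarrow> u b = (if b = a then c else \<zero>)"
  shows "psum u x = (if prefix x a then c else \<zero>)"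
proof -
  have "psum u x = (\<Oplus>b\<in>full. if b = a then (if prefix x a then c else \<zero>) else \<zero>)"
    unfolding psum_def using assms by (intro finsum_cong') auto
  also have "\<dots> = (if prefix x a then c else \<zero>)"
    using finsum_delta[OF finite_full assms(1), of "\<lambda>_. if prefix x a then c else \<zero>"] assms(2) by simp
  finally show ?thesis .
qed

lemma ach_cong: "ach \<eta> \<Longrightarrow> (\<And>x. x \<in> I \<Longrightarrow> \<eta> x = \<theta> x) \<Longrightarrow> ach \<theta>"
  by (auto simp: ach_def)

lemma antiI:
  assumes "\<And>a. a \<in> full \<Longrightarrow> w a \<in> carrier F" "\<And>a. a \<in> full \<Longrightarrow> w a \<oplus> w (rev a) = \<zero>"
  shows "restrict w full \<in> anti"
  using assms rev_full by (auto simp: anti_def)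

lemma ach_zero: "ach (\<lambda>x. \<zero>)"
proof -
  have "restrict (\<lambda>_. \<zero>) full \<in> anti" by (intro antiI) auto
  moreover have "psum (restrict (\<lambda>_. \<zero>) full) x = \<zero>" for x
    unfolding psum_def by (rule finsum_zeroI) auto
  ultimately show ?thesis unfolding ach_def by blast
qed

lemma ach_add:
  assumes "ach \<eta>" "ach \<theta>"
  shows "ach (\<lambda>x. \<eta> x \<oplus> \<theta> x)"
proof -
  obtain G H where G: "G \<in> anti" "\<And>x. x \<in> I \<Longrightarrow> psum G x = \<eta> x"
    and H: "H \<in> anti" "\<And>x. x \<in> I \<Longrightarrow> psum H x = \<theta> x"
    using assms unfolding ach_def by blast
  let ?K = "restrict (\<lambda>a. G a \<oplus> H a) full"
  have "?K \<in> anti"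
  proof (rule antiI)
    fix a assume a: "a \<in> full"
    have c: "G a \<in> carrier F" "H a \<in> carrier F" "G (rev a) \<in> carrier F" "H (rev a) \<in> carrier F"
      using anti_closed G H a rev_full by auto
    then show "G a \<oplus> H a \<in> carrier F" by simp
    have "G a \<oplus> H a \<oplus> (G (rev a) \<oplus> H (rev a)) = (G a \<oplus> G (rev a)) \<oplus> (H a \<oplus> H (rev a))"
      using c by (simp add: a_ac)
    then show "G a \<oplus> H a \<oplus> (G (rev a) \<oplus> H (rev a)) = \<zero>"
      using G(1) H(1) a by (simp add: anti_def)
  qed
  moreover have "psum ?K x = psum G x \<oplus> psum H x" for x
    using anti_closed G(1) H(1) by (intro psum_add) auto
  ultimately show ?thesis using G(2) H(2) unfolding ach_def by (intro bexI[of _ ?K]) auto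
qed

lemma ach_finsum:
  assumes "finite Y" "\<And>y. y \<in> Y \<Longrightarrow> ach (h y)" "\<And>y x. y \<in> Y \<Longrightarrow> x \<in> I \<Longrightarrow> h y x \<in> carrier F"
  shows "ach (\<lambda>x. \<Oplus>y\<in>Y. h y x)"
  using assms
proof (induction Y rule: finite_induct)
  case empty
  then show ?case using ach_zero by simp
next
  case (insert y Y)
  then have "ach (\<lambda>x. h y x \<oplus> (\<Oplus>y\<in>Y. h y x))" by (intro ach_add) auto
  then show ?case by (rule ach_cong) (use insert in \<open>auto intro!: finsum_insert[symmetric]\<close>)
qed

lemma flow_equiv_refl: "flow_equiv y y"
  unfolding flow_equiv_def using ach_zero by (auto simp: r_neg a_minus_def)

lemma flow_equiv_sym:
  assumes "flow_equiv y z"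
  shows "flow_equiv z y"
  unfolding flow_equiv_def
proof
  fix c assume c: "c \<in> carrier F"
  then have "ach (\<lambda>x. (\<ominus> c) \<otimes> (chi y x \<ominus> chi z x))" using assms by (simp add: flow_equiv_def)
  then show "ach (\<lambda>x. c \<otimes> (chi z x \<ominus> chi y x))"
  proof (rule ach_cong)
    fix x
    show "(\<ominus> c) \<otimes> (chi y x \<ominus> chi z x) = c \<otimes> (chi z x \<ominus> chi y x)"
      using c chi_closed[of y x] chi_closed[of z x] by algebra
  qed
qed

lemma flow_equiv_trans:
  assumes "flow_equiv y z" "flow_equiv z w"
  shows "flow_equiv y w"
  unfolding flow_equiv_def
proof
  fix c assume c: "c \<in> carrier F"
  then have "ach (\<lambda>x. c \<otimes> (chi y x \<ominus> chi z x) \<oplus> c \<otimes> (chi z x \<ominus> chi w x))"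
    using assms by (intro ach_add) (auto simp: flow_equiv_def)
  then show "ach (\<lambda>x. c \<otimes> (chi y x \<ominus> chi w x))"
  proof (rule ach_cong)
    fix x
    show "c \<otimes> (chi y x \<ominus> chi z x) \<oplus> c \<otimes> (chi z x \<ominus> chi w x) = c \<otimes> (chi y x \<ominus> chi w x)"
      using c chi_closed[of y x] chi_closed[of z x] chi_closed[of w x] by algebra
  qed
qed

lemma equivp_flow_equiv: "equivp flow_equiv"
  by (intro equivpI reflpI sympI transpI flow_equiv_refl) (auto intro: flow_equiv_sym flow_equiv_trans)

lemma chi_cls:
  assumes "a \<in> full" "x \<in> I"
  shows "chi (cls I a) x = (if prefix x a then \<one> else \<zero>)"
proof -
  have "length (cls I a) \<le> m"
    using prefix_length_le[OF prefix_cls[of I a]] fullD(1)[OF assms(1)] by simp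
  then have "cls I a \<noteq> dead" using dead_long by auto
  then show ?thesis using assms prefix_cls_iff by (auto simp: chi_def)
qed

lemma chi_dead [simp]: "chi dead x = \<zero>"
  by (simp add: chi_def)

text \<open>Put \<open>c\<close> on \<open>a\<close> and \<open>- c\<close> on \<open>rev a\<close>.
  The two are added as separate terms, so that for a palindrome they cancel and no case distinction
  arises.\<close>

lemma flow_equiv_reverse:
  assumes a: "a \<in> full"
  shows "flow_equiv (cls I a) (cls I (rev a))"
  unfolding flow_equiv_def
proof
  fix c assume c: "c \<in> carrier F"
  let ?p = "\<lambda>b. if b = a then c else \<zero>" and ?q = "\<lambda>b. if b = rev a then \<ominus> c else \<zero>"
  let ?G = "restrict (\<lambda>b. ?p b \<oplus> ?q b) full"
  have "?G \<in> anti"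
  proof (rule antiI)
    fix b
    have "rev b = a \<longleftrightarrow> b = rev a" "rev b = rev a \<longleftrightarrow> b = a" by auto
    then show "?p b \<oplus> ?q b \<oplus> (?p (rev b) \<oplus> ?q (rev b)) = \<zero>"
      using c by (auto simp: r_neg l_neg)
  qed (use c in auto)
  moreover have "psum ?G x = c \<otimes> (chi (cls I a) x \<ominus> chi (cls I (rev a)) x)" if "x \<in> I" for x
  proof -
    have "psum ?G x = psum ?p x \<oplus> psum ?q x"
      using c by (intro psum_add) auto
    also have "\<dots> = (if prefix x a then c else \<zero>) \<oplus> (if prefix x (rev a) then \<ominus> c else \<zero>)"
      using psum_delta[OF a c, of ?p x] psum_delta[OF rev_full[OF a], of "\<ominus> c" ?q x] c by simp
    also have "\<dots> = c \<otimes> (chi (cls I a) x \<ominus> chi (cls I (rev a)) x)"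
      using chi_cls[OF a that] chi_cls[OF rev_full[OF a] that] c by (auto simp: r_neg a_minus_def r_minus)
    finally show ?thesis .
  qed
  ultimately show "ach (\<lambda>x. c \<otimes> (chi (cls I a) x \<ominus> chi (cls I (rev a)) x))"
    unfolding ach_def by blast
qed

lemma double_char2: "\<one> \<oplus> \<one> = \<zero> \<Longrightarrow> c \<in> carrier F \<Longrightarrow> c \<oplus> c = \<zero>"
  by (metis l_distr l_null l_one one_closed)

text \<open>In characteristic 2 an antisymmetric function may take any value at a palindrome, so
  mass can be created there.\<close>

lemma flow_equiv_palindrome:
  assumes a: "a \<in> full" "rev a = a" and two: "\<one> \<oplus> \<one> = \<zero>"
  shows "flow_equiv (cls I a) dead"
  unfolding flow_equiv_def
proof
  fix c assume c: "c \<in> carrier F"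
  let ?G = "restrict (\<lambda>b. if b = a then c else \<zero>) full"
  have "?G \<in> anti"
  proof (rule antiI)
    fix b
    have "rev b = a \<longleftrightarrow> b = a" using a(2) by (metis rev_rev_ident)
    then show "(if b = a then c else \<zero>) \<oplus> (if rev b = a then c else \<zero>) = \<zero>"
      using double_char2[OF two c] by simp
  qed (use c in auto)
  moreover have "psum ?G x = c \<otimes> (chi (cls I a) x \<ominus> chi dead x)" if "x \<in> I" for x
    using psum_delta[OF a(1) c, of ?G x] chi_cls[OF a(1) that] c by (simp add: a_minus_def)
  ultimately show "ach (\<lambda>x. c \<otimes> (chi (cls I a) x \<ominus> chi dead x))"
    unfolding ach_def by blast
qed

text \<open>When the empty tuple is not queried, no query is a prefix of it, so mass in its class is
  as invisible as mass at \<open>dead\<close>.\<close>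

lemma flow_equiv_Nil:
  assumes "[] \<notin> I"
  shows "flow_equiv [] dead"
proof -
  have "chi [] x = \<zero>" if "x \<in> I" for x using that assms by (auto simp: chi_def)
  then show ?thesis unfolding flow_equiv_def
    by (auto intro!: ach_cong[OF ach_zero] simp: a_minus_def)
qed

text \<open>The component of \<open>dead\<close> gets the zero function, since class functions that
  vanish on antisymmetric \<open>w\<close> must vanish there.\<close>

definition cind :: "('a list \<Rightarrow> 'a list) \<Rightarrow> 'a list \<Rightarrow> 'a list \<Rightarrow> 'a" where
  "cind lab l x = (if lab x = l \<and> l \<noteq> lab dead then \<one> else \<zero>)"

lemma cind_closed [simp]: "cind lab l x \<in> carrier F"
  by (simp add: cind_def)

text \<open>Push the mass \<open>t y\<close> from each \<open>y\<close> to its label. What gathers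
  at a label is the total mass of its component; either it is zero by hypothesis, or the label is
  joined to \<open>dead\<close>, which absorbs it.\<close>

lemma ach_of_class_sums:
  assumes lab: "\<And>y. flow_equiv y (lab y)"
    and t: "\<And>y. t y \<in> carrier F"
    and zero: "\<And>l. l \<in> lab ` I \<Longrightarrow> (\<Oplus>y\<in>I. cind lab l y \<otimes> t y) = \<zero>"
  shows "ach (\<lambda>x. \<Oplus>y\<in>I. if prefix x y then t y else \<zero>)"
proof -
  define s where "s l = (\<Oplus>y\<in>I. if lab y = l then t y else \<zero>)" for l
  have s: "s l \<in> carrier F" for l unfolding s_def using t by (auto intro!: finsum_closed)
  have 1: "ach (\<lambda>x. \<Oplus>y\<in>I. t y \<otimes> (chi y x \<ominus> chi (lab y) x))"
    using lab t fin by (intro ach_finsum) (auto simp: flow_equiv_def)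
  have "ach (\<lambda>x. s l \<otimes> chi l x)" if "l \<in> lab ` I" for l
  proof (cases "l = lab dead")
    case True
    then have "ach (\<lambda>x. s l \<otimes> (chi l x \<ominus> chi dead x))"
      using flow_equiv_sym[OF lab[of dead]] s by (simp add: flow_equiv_def)
    then show ?thesis by (rule ach_cong) (simp add: a_minus_def)
  next
    case False
    have "s l = (\<Oplus>y\<in>I. cind lab l y \<otimes> t y)"
      unfolding s_def using False t by (intro finsum_cong') (auto simp: cind_def)
    then have "s l = \<zero>" using zero[OF that] by simp
    then show ?thesis using ach_zero by (auto intro: ach_cong)
  qed
  then have 2: "ach (\<lambda>x. \<Oplus>l\<in>lab ` I. s l \<otimes> chi l x)"
    using fin s by (intro ach_finsum) auto
  have 3: "(\<Oplus>l\<in>lab ` I. s l \<otimes> chi l x) = (\<Oplus>y\<in>I. t y \<otimes> chi (lab y) x)" for x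
  proof -
    have "s l \<otimes> chi l x = (\<Oplus>y\<in>I. (if lab y = l then t y else \<zero>) \<otimes> chi l x)" for l
      unfolding s_def using fin t by (intro finsum_ldistr) auto
    then have "(\<Oplus>l\<in>lab ` I. s l \<otimes> chi l x) =
      (\<Oplus>l\<in>lab ` I. \<Oplus>y\<in>I. (if lab y = l then t y else \<zero>) \<otimes> chi l x)" by simp
    also have "\<dots> = (\<Oplus>y\<in>I. \<Oplus>l\<in>lab ` I. (if lab y = l then t y else \<zero>) \<otimes> chi l x)"
      using fin t by (intro finsum_swap) auto
    also have "\<dots> = (\<Oplus>y\<in>I. t y \<otimes> chi (lab y) x)"
    proof (intro finsum_cong' refl)
      fix y assume y: "y \<in> I"
      have "(\<Oplus>l\<in>lab ` I. (if lab y = l then t y else \<zero>) \<otimes> chi l x) =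
        (\<Oplus>l\<in>lab ` I. if l = lab y then t y \<otimes> chi l x else \<zero>)"
        using t by (intro finsum_cong') auto
      also have "\<dots> = t y \<otimes> chi (lab y) x"
        using finsum_delta[of "lab ` I" "lab y" "\<lambda>l. t y \<otimes> chi l x"] fin t y by simp
      finally show "(\<Oplus>l\<in>lab ` I. (if lab y = l then t y else \<zero>) \<otimes> chi l x) = t y \<otimes> chi (lab y) x" .
    qed (use t in auto)
    finally show ?thesis .
  qed
  have "ach (\<lambda>x. (\<Oplus>y\<in>I. t y \<otimes> (chi y x \<ominus> chi (lab y) x)) \<oplus> (\<Oplus>l\<in>lab ` I. s l \<otimes> chi l x))"
    by (rule ach_add[OF 1 2])
  then show ?thesis
  proof (rule ach_cong)
    fix x assume "x \<in> I"
    have "(\<Oplus>y\<in>I. t y \<otimes> (chi y x \<ominus> chi (lab y) x)) \<oplus> (\<Oplus>y\<in>I. t y \<otimes> chi (lab y) x) =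
      (\<Oplus>y\<in>I. t y \<otimes> (chi y x \<ominus> chi (lab y) x) \<oplus> t y \<otimes> chi (lab y) x)"
      using t by (intro finsum_addf[symmetric]) auto
    also have "\<dots> = (\<Oplus>y\<in>I. if prefix x y then t y else \<zero>)"
    proof (intro finsum_cong' refl)
      fix y assume y: "y \<in> I"
      then have "y \<noteq> dead" using I_len dead_long by fastforce
      moreover have "t y \<otimes> (chi y x \<ominus> chi (lab y) x) \<oplus> t y \<otimes> chi (lab y) x = t y \<otimes> chi y x"
        using t[of y] chi_closed[of y x] chi_closed[of "lab y" x] by algebra
      ultimately show "t y \<otimes> (chi y x \<ominus> chi (lab y) x) \<oplus> t y \<otimes> chi (lab y) x = (if prefix x y then t y else \<zero>)"
        using t[of y] by (simp add: chi_def)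
    qed (use t in auto)
    finally show "(\<Oplus>y\<in>I. t y \<otimes> (chi y x \<ominus> chi (lab y) x)) \<oplus> (\<Oplus>l\<in>lab ` I. s l \<otimes> chi l x) =
      (\<Oplus>y\<in>I. if prefix x y then t y else \<zero>)" by (simp only: 3)
  qed
qed

text \<open>The raw constraint equates the pairing of \<open>zc\<close> with \<beta> to the sum of
  \<open>cind lab l (cls I a) \<otimes> f a\<close> over all full tuples. Adding
  \<open>cind lab l g\<close> times the message identity, the sum of all \<open>f a\<close> minus
  \<open>f []\<close>, cancels the coefficients on the component of \<open>g\<close> and leaves only
  the other tuples and \<bottom>.\<close>

definition Zrow :: "('a list \<Rightarrow> 'a list) \<Rightarrow> 'a list \<Rightarrow> 'a list \<Rightarrow> 'a list + 'a list \<Rightarrow> 'a" where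
  "Zrow lab g l = (\<lambda>c. case c of
     Inl a \<Rightarrow> if a = [] then \<ominus> cind lab l g else cind lab l g \<oplus> \<ominus> cind lab l (cls I a)
   | Inr x \<Rightarrow> zc I (cind lab l) x)"

lemma Zrow_closed: "Zrow lab g l c \<in> carrier F"
  by (auto simp: Zrow_def zc_closed split: sum.splits)

lemma Zrow_sum:
  assumes f: "\<And>a. a \<in> full \<Longrightarrow> f a \<in> carrier F" "f [] = (\<Oplus>a\<in>full. f a)"
    and \<beta>: "\<And>x. x \<in> I \<Longrightarrow> \<beta> x \<in> carrier F"
    and N: "N = {a \<in> full. lab (cls I a) \<noteq> lab g}" "[] \<notin> N"
  shows "(\<Oplus>c\<in>insert [] N <+> I. Zrow lab g l c \<otimes> restrict (case_sum f \<beta>) (insert [] N <+> I) c) =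
    (\<Oplus>x\<in>I. zc I (cind lab l) x \<otimes> \<beta> x) \<ominus> (\<Oplus>a\<in>full. cind lab l (cls I a) \<otimes> f a)"
proof -
  let ?C = "insert [] N <+> I"
  let ?\<kappa> = "cind lab l g" and ?U = "\<lambda>a. cind lab l (cls I a)"
  let ?d = "\<lambda>a. (?\<kappa> \<oplus> \<ominus> ?U a) \<otimes> f a"
  have finN: "finite N" using N finite_full by simp
  have N_full: "N \<subseteq> full" using N by blast
  have f0: "f [] \<in> carrier F" using f by (auto intro!: finsum_closed)
  note zc_closed[of "cind lab l" I, simp]
  have "(\<Oplus>c\<in>?C. Zrow lab g l c \<otimes> restrict (case_sum f \<beta>) ?C c) =
    (\<Oplus>a\<in>insert [] N. Zrow lab g l (Inl a) \<otimes> restrict (case_sum f \<beta>) ?C (Inl a)) \<oplus>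
    (\<Oplus>x\<in>I. Zrow lab g l (Inr x) \<otimes> restrict (case_sum f \<beta>) ?C (Inr x))"
    using finN fin f f0 \<beta> N_full Zrow_closed by (intro finsum_Plus) auto
  also have "(\<Oplus>x\<in>I. Zrow lab g l (Inr x) \<otimes> restrict (case_sum f \<beta>) ?C (Inr x)) =
    (\<Oplus>x\<in>I. zc I (cind lab l) x \<otimes> \<beta> x)"
    using \<beta> by (intro finsum_cong') (auto simp: Zrow_def)
  also have "(\<Oplus>a\<in>insert [] N. Zrow lab g l (Inl a) \<otimes> restrict (case_sum f \<beta>) ?C (Inl a)) =
    Zrow lab g l (Inl []) \<otimes> restrict (case_sum f \<beta>) ?C (Inl []) \<oplus>
    (\<Oplus>a\<in>N. Zrow lab g l (Inl a) \<otimes> restrict (case_sum f \<beta>) ?C (Inl a))"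
    using finN N(2) f f0 N_full Zrow_closed by (intro finsum_insert) auto
  also have "Zrow lab g l (Inl []) \<otimes> restrict (case_sum f \<beta>) ?C (Inl []) = (\<ominus> ?\<kappa>) \<otimes> f []"
    by (simp add: Zrow_def InlI)
  also have "(\<Oplus>a\<in>N. Zrow lab g l (Inl a) \<otimes> restrict (case_sum f \<beta>) ?C (Inl a)) = (\<Oplus>a\<in>N. ?d a)"
    using f N_full N(2) by (intro finsum_cong') (auto simp: Zrow_def)
  \<comment> \<open>The coefficient of \<open>f a\<close> is zero on the component of
    \<open>g\<close>, so the sum may run over all full tuples; there the contribution of
    \<open>?\<kappa>\<close> is \<open>?\<kappa> \<otimes> f []\<close> and cancels the column of
    \<bottom>.\<close>
  also have "(\<Oplus>a\<in>N. ?d a) = (\<Oplus>a\<in>full. ?d a)"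
  proof (rule add.finprod_mono_neutral_cong_left[OF finite_full N_full])
    fix a assume "a \<in> full - N"
    then have "lab (cls I a) = lab g" and a: "a \<in> full" using N by auto
    then show "?d a = \<zero>" using f(1)[OF a] by (simp add: cind_def r_neg)
  qed (use f in auto)
  also have "(\<Oplus>a\<in>full. ?d a) = (\<Oplus>a\<in>full. ?\<kappa> \<otimes> f a \<oplus> (\<ominus> \<one>) \<otimes> (?U a \<otimes> f a))"
    using f by (intro finsum_cong') (auto simp: l_distr l_minus)
  also have "\<dots> = (\<Oplus>a\<in>full. ?\<kappa> \<otimes> f a) \<oplus> (\<Oplus>a\<in>full. (\<ominus> \<one>) \<otimes> (?U a \<otimes> f a))"
    using f by (intro finsum_addf) auto
  also have "(\<Oplus>a\<in>full. ?\<kappa> \<otimes> f a) = ?\<kappa> \<otimes> f []"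
    unfolding f(2) using f finite_full by (intro finsum_rdistr[symmetric]) auto
  also have "(\<Oplus>a\<in>full. (\<ominus> \<one>) \<otimes> (?U a \<otimes> f a)) = (\<ominus> \<one>) \<otimes> (\<Oplus>a\<in>full. ?U a \<otimes> f a)"
    using f finite_full by (intro finsum_rdistr[symmetric]) auto
  finally have eq: "(\<Oplus>c\<in>?C. Zrow lab g l c \<otimes> restrict (case_sum f \<beta>) ?C c) =
    (\<ominus> ?\<kappa>) \<otimes> f [] \<oplus> (?\<kappa> \<otimes> f [] \<oplus> (\<ominus> \<one>) \<otimes> (\<Oplus>a\<in>full. ?U a \<otimes> f a)) \<oplus> (\<Oplus>x\<in>I. zc I (cind lab l) x \<otimes> \<beta> x)" .
  have c: "(\<Oplus>a\<in>full. ?U a \<otimes> f a) \<in> carrier F" "(\<Oplus>x\<in>I. zc I (cind lab l) x \<otimes> \<beta> x) \<in> carrier F"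
    "?\<kappa> \<in> carrier F"
    using f \<beta> by (auto intro!: finsum_closed)
  have "(\<ominus> k) \<otimes> y \<oplus> (k \<otimes> y \<oplus> (\<ominus> \<one>) \<otimes> s) \<oplus> b = b \<ominus> s"
    if "k \<in> carrier F" "y \<in> carrier F" "s \<in> carrier F" "b \<in> carrier F" for k y s b
    using that by algebra
  then show ?thesis unfolding eq using c f0 by (simp only:)
qed

lemma minus_eq_zero_iff:
  assumes "x \<in> carrier F" "y \<in> carrier F"
  shows "x \<ominus> y = \<zero> \<longleftrightarrow> x = y"
proof
  assume "x \<ominus> y = \<zero>"
  moreover have "x = x \<ominus> y \<oplus> y" using assms by algebra
  ultimately show "x = y" using assms by simp
qed (use assms in \<open>simp add: a_minus_def r_neg\<close>)

text \<open>The rows hold for codewords because a class function invariant under reversal pairs to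
  zero with \<open>G\<close>. Conversely, the discrepancy between \<beta> and \<open>psum f\<close>
  is written as prefix sums of masses at the queries; the rows say that these masses sum to zero on
  each component other than that of \<open>dead\<close>, so a flow realises them.\<close>

lemma locates:
  assumes lab_sym: "\<And>a. a \<in> full \<Longrightarrow> lab (cls I a) = lab (cls I (rev a))"
    and lab_pal: "\<And>a. a \<in> full \<Longrightarrow> rev a = a \<Longrightarrow> \<one> \<oplus> \<one> = \<zero> \<Longrightarrow> lab (cls I a) = lab dead"
    and lab_Nil: "[] \<notin> I \<Longrightarrow> lab [] = lab dead"
    and lab_flow: "\<And>y. flow_equiv y (lab y)"
    and V: "I \<subseteq> set V"
    and N: "N = {a \<in> full. lab (cls I a) \<noteq> lab g}" "[] \<notin> N"
    and f: "\<And>a. a \<in> full \<Longrightarrow> f a \<in> carrier F" "f [] = (\<Oplus>a\<in>full. f a)"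
    and \<beta>: "\<beta> \<in> I \<rightarrow>\<^sub>E carrier F"
  shows "restrict (case_sum f \<beta>) (insert [] N <+> I) \<in>
      kernel_on F (length V) (insert [] N <+> I) (\<lambda>j. Zrow lab g (lab (V ! j))) \<longleftrightarrow>
    (\<exists>G\<in>anti. \<forall>x\<in>I. psum (\<lambda>a. f a \<oplus> G a) x = \<beta> x)"
    (is "?L \<longleftrightarrow> ?R")
proof -
  let ?C = "insert [] N <+> I"
  have \<beta>c: "\<beta> x \<in> carrier F" if "x \<in> I" for x using \<beta> that by auto
  have f0: "f [] \<in> carrier F" using f by (auto intro!: finsum_closed)
  define row where "row l \<longleftrightarrow>
    (\<Oplus>x\<in>I. zc I (cind lab l) x \<otimes> \<beta> x) = (\<Oplus>a\<in>full. cind lab l (cls I a) \<otimes> f a)" for l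
  have c: "(\<Oplus>x\<in>I. zc I (cind lab l) x \<otimes> \<beta> x) \<in> carrier F"
    "(\<Oplus>a\<in>full. cind lab l (cls I a) \<otimes> f a) \<in> carrier F" for l
    using f \<beta>c zc_closed[of "cind lab l" I] by (auto intro!: finsum_closed)
  have U_Nil: "cind lab l [] = \<zero>" if "[] \<notin> I" for l using lab_Nil[OF that] by (auto simp: cind_def)
  have "(\<Oplus>c\<in>?C. Zrow lab g l c \<otimes> restrict (case_sum f \<beta>) ?C c) = \<zero> \<longleftrightarrow> row l" for l
  proof -
    have "(\<Oplus>c\<in>?C. Zrow lab g l c \<otimes> restrict (case_sum f \<beta>) ?C c) =
      (\<Oplus>x\<in>I. zc I (cind lab l) x \<otimes> \<beta> x) \<ominus> (\<Oplus>a\<in>full. cind lab l (cls I a) \<otimes> f a)"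
      by (rule Zrow_sum) (fact f \<beta>c N)+
    then show ?thesis unfolding row_def using minus_eq_zero_iff[OF c[of l]] by (simp only:)
  qed
  moreover have "restrict (case_sum f \<beta>) ?C \<in> ?C \<rightarrow>\<^sub>E carrier F"
    using f f0 \<beta>c N by auto
  ultimately have L: "?L \<longleftrightarrow> (\<forall>j<length V. row (lab (V ! j)))"
    unfolding kernel_on_def by simp
  show ?thesis
  proof
    assume ?R
    then obtain G where G: "G \<in> anti" "\<And>x. x \<in> I \<Longrightarrow> psum (\<lambda>a. f a \<oplus> G a) x = \<beta> x" by blast
    note Gc = anti_closed[OF G(1)]
    have "row l" for l
    proof -
      let ?U = "\<lambda>a. cind lab l (cls I a)"
      have "(\<Oplus>x\<in>I. zc I (cind lab l) x \<otimes> \<beta> x) =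
        (\<Oplus>x\<in>I. zc I (cind lab l) x \<otimes> (\<Oplus>a\<in>full. if prefix x a then f a \<oplus> G a else \<zero>))"
        using G(2) \<beta>c zc_closed[of "cind lab l" I] f Gc
        by (intro finsum_cong') (auto simp: psum_def intro!: m_closed finsum_closed)
      also have "\<dots> = (\<Oplus>a\<in>full. ?U a \<otimes> (f a \<oplus> G a))"
        using U_Nil fin finite_full f Gc by (intro zc_pairing) auto
      also have "\<dots> = (\<Oplus>a\<in>full. ?U a \<otimes> f a \<oplus> ?U a \<otimes> G a)"
        using f Gc by (intro finsum_cong') (auto simp: r_distr)
      also have "\<dots> = (\<Oplus>a\<in>full. ?U a \<otimes> f a) \<oplus> (\<Oplus>a\<in>full. ?U a \<otimes> G a)"
        using f Gc by (intro finsum_addf) auto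
      also have "(\<Oplus>a\<in>full. ?U a \<otimes> G a) = \<zero>"
      proof (rule finsum_antisymmetric[where \<sigma> = rev])
        fix a assume a: "a \<in> full"
        have "?U (rev a) = ?U a" using lab_sym[OF a] by (simp add: cind_def)
        then have "?U a \<otimes> G a \<oplus> ?U (rev a) \<otimes> G (rev a) = ?U a \<otimes> (G a \<oplus> G (rev a))"
          using Gc a rev_full by (simp add: r_distr)
        then show "?U a \<otimes> G a \<oplus> ?U (rev a) \<otimes> G (rev a) = \<zero>"
          using G(1) a by (simp add: anti_def)
        assume pal: "rev a = a"
        show "?U a \<otimes> G a = \<zero>"
        proof (cases "\<one> \<oplus> \<one> = \<zero>")
          case True
          then show ?thesis using lab_pal[OF a pal] Gc[OF a] by (auto simp: cind_def)
        next
          \<comment> \<open>Away from characteristic 2, antisymmetry forces \<open>G\<close> to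
            vanish on palindromes, whatever their label.\<close>
          case False
          have "(\<one> \<oplus> \<one>) \<otimes> G a = G a \<oplus> G a" using Gc[OF a] by (simp add: l_distr)
          also have "\<dots> = \<zero>" using G(1) a pal by (auto simp: anti_def)
          finally have "G a = \<zero>" using False Gc[OF a] integral by blast
          then show ?thesis by simp
        qed
      qed (use finite_full rev_full Gc in auto)
      finally show ?thesis unfolding row_def using c by simp
    qed
    then show ?L using L by blast
  next
    assume ?L
    then have rows: "row l" if "l \<in> lab ` I" for l
      using that V L by (auto simp: in_set_conv_nth subset_iff) 
    define \<eta> where "\<eta> x = \<beta> x \<ominus> psum f x" for x
    have pf: "psum f x \<in> carrier F" for x using f by (intro psum_closed)
    obtain t where t: "\<And>y. t y \<in> carrier F"
      "\<And>x. x \<in> I \<Longrightarrow> (\<Oplus>y\<in>I. if prefix x y then t y else \<zero>) = \<eta> x"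
    proof -
      have "\<eta> x \<in> carrier F" if "x \<in> I" for x using \<beta>c[OF that] pf by (simp add: \<eta>_def)
      then have "\<exists>t. (\<forall>y. t y \<in> carrier F) \<and> (\<forall>x\<in>I. (\<Oplus>y\<in>I. if prefix x y then t y else \<zero>) = \<eta> x)"
        by (rule prefix_triangular[OF fin])
      then obtain t where "\<forall>y. t y \<in> carrier F"
        "\<forall>x\<in>I. (\<Oplus>y\<in>I. if prefix x y then t y else \<zero>) = \<eta> x" by (elim exE conjE)
      then show ?thesis by (intro that[of t]) auto
    qed
    have "(\<Oplus>y\<in>I. cind lab l y \<otimes> t y) = \<zero>" if "l \<in> lab ` I" for l
    proof -
      note zc = zc_closed[of "cind lab l" I, OF cind_closed]
      have "(\<Oplus>y\<in>I. cind lab l y \<otimes> t y) = (\<Oplus>y\<in>I. cind lab l (cls I y) \<otimes> t y)"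
        using t by (intro finsum_cong') (auto simp: cls_self)
      also have "\<dots> = (\<Oplus>x\<in>I. zc I (cind lab l) x \<otimes> (\<Oplus>y\<in>I. if prefix x y then t y else \<zero>))"
        using U_Nil fin t by (intro zc_pairing[symmetric]) auto
      finally have 1: "(\<Oplus>y\<in>I. cind lab l y \<otimes> t y) =
        (\<Oplus>x\<in>I. zc I (cind lab l) x \<otimes> (\<Oplus>y\<in>I. if prefix x y then t y else \<zero>))" .
      have 2: "(\<Oplus>a\<in>full. cind lab l (cls I a) \<otimes> f a) = (\<Oplus>x\<in>I. zc I (cind lab l) x \<otimes> psum f x)"
        unfolding psum_def using U_Nil fin finite_full f by (intro zc_pairing[symmetric]) auto
      have "(\<Oplus>x\<in>I. zc I (cind lab l) x \<otimes> (\<Oplus>y\<in>I. if prefix x y then t y else \<zero>)) \<oplus>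
          (\<Oplus>x\<in>I. zc I (cind lab l) x \<otimes> psum f x) =
        (\<Oplus>x\<in>I. zc I (cind lab l) x \<otimes> (\<Oplus>y\<in>I. if prefix x y then t y else \<zero>) \<oplus> zc I (cind lab l) x \<otimes> psum f x)"
        using zc t(1) pf by (intro finsum_addf[symmetric]) (auto intro!: m_closed finsum_closed)
      also have "\<dots> = (\<Oplus>x\<in>I. zc I (cind lab l) x \<otimes> \<beta> x)"
      proof (intro finsum_cong' refl)
        fix x assume x: "x \<in> I"
        have "zc I (cind lab l) x \<otimes> (\<beta> x \<ominus> psum f x) \<oplus> zc I (cind lab l) x \<otimes> psum f x =
          zc I (cind lab l) x \<otimes> \<beta> x"
          using zc[of x] \<beta>c[OF x] pf[of x] by algebra
        then show "zc I (cind lab l) x \<otimes> (\<Oplus>y\<in>I. if prefix x y then t y else \<zero>) \<oplus> zc I (cind lab l) x \<otimes> psum f x =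
          zc I (cind lab l) x \<otimes> \<beta> x" using t(2)[OF x] by (simp add: \<eta>_def)
      qed (use zc \<beta>c in auto)
      also have "\<dots> = (\<Oplus>x\<in>I. zc I (cind lab l) x \<otimes> psum f x)"
        using rows[OF that] 2 by (simp add: row_def)
      finally show ?thesis unfolding 1
        using zc t(1) pf by (simp add: add.r_cancel_one finsum_closed)
    qed
    then have "ach (\<lambda>x. \<Oplus>y\<in>I. if prefix x y then t y else \<zero>)"
      by (rule ach_of_class_sums[OF lab_flow t(1)])
    then have "ach \<eta>" by (rule ach_cong) (rule t(2))
    then obtain G where G: "G \<in> anti" "\<And>x. x \<in> I \<Longrightarrow> psum G x = \<eta> x" unfolding ach_def by blast
    have "psum (\<lambda>a. f a \<oplus> G a) x = \<beta> x" if "x \<in> I" for x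
    proof -
      have "psum (\<lambda>a. f a \<oplus> G a) x = psum f x \<oplus> (\<beta> x \<ominus> psum f x)"
        using psum_add[of f G _ x] f anti_closed[OF G(1)] G(2)[OF that] by (simp add: \<eta>_def)
      also have "\<dots> = \<beta> x" using \<beta>c[OF that] pf[of x] by algebra
      finally show ?thesis .
    qed
    then show ?R using G(1) by blast
  qed
qed

end

section \<open>Polynomial-time functions on trees\<close>

text \<open>Such functions are monotone and closed under composition, so a bound on the size of an
  argument may be substituted into a time bound.\<close>

inductive polyf :: "(nat \<Rightarrow> nat) \<Rightarrow> bool" where
  polyf_const: "polyf (\<lambda>n. k)"
| polyf_id: "polyf (\<lambda>n. n)"
| polyf_add: "polyf f \<Longrightarrow> polyf g \<Longrightarrow> polyf (\<lambda>n. f n + g n)"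
| polyf_mult: "polyf f \<Longrightarrow> polyf g \<Longrightarrow> polyf (\<lambda>n. f n * g n)"

lemma polyf_Suc: "polyf f \<Longrightarrow> polyf (\<lambda>n. Suc (f n))"
  using polyf_add[OF _ polyf_const[of 1]] by simp

lemma polyf_comp: "polyf f \<Longrightarrow> polyf g \<Longrightarrow> polyf (\<lambda>n. f (g n))"
  by (induction rule: polyf.induct) (auto intro: polyf.intros)

lemmas polyf_intros = polyf_const polyf_id polyf_Suc polyf_add polyf_mult

lemma polyf_mono: "polyf f \<Longrightarrow> i \<le> j \<Longrightarrow> f i \<le> f j"
  by (induction rule: polyf.induct) (auto intro: add_mono mult_mono)

lemma polyf_bound: "polyf f \<Longrightarrow> \<exists>c d. \<forall>n. f n \<le> c * n ^ d + c"
proof -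
  \<comment> \<open>\<open>Suc n\<close> is at least 1, so enlarging the exponent only enlarges the
    power; this makes two such bounds addable.\<close>
  have key: "\<exists>c d. \<forall>n. f n \<le> c * Suc n ^ d" if "polyf f" for f
    using that
  proof (induction rule: polyf.induct)
    case (polyf_const k)
    show ?case by (rule exI[of _ k], rule exI[of _ 0]) simp
  next
    case polyf_id
    show ?case by (rule exI[of _ 1], rule exI[of _ 1]) simp
  next
    case (polyf_add f g)
    then obtain c d c' d' where *: "\<And>n. f n \<le> c * Suc n ^ d" "\<And>n. g n \<le> c' * Suc n ^ d'"
      by blast
    have "f n + g n \<le> (c + c') * Suc n ^ (d + d')" for n
    proof -
      have "f n \<le> c * Suc n ^ (d + d')"
        by (rule order_trans[OF *(1)], rule mult_left_mono, rule power_increasing) auto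
      moreover have "g n \<le> c' * Suc n ^ (d + d')"
        by (rule order_trans[OF *(2)], rule mult_left_mono, rule power_increasing) auto
      ultimately show ?thesis by (simp only: distrib_right add_mono)
    qed
    then show ?case by blast
  next
    case (polyf_mult f g)
    then obtain c d c' d' where *: "\<And>n. f n \<le> c * Suc n ^ d" "\<And>n. g n \<le> c' * Suc n ^ d'"
      by blast
    have "f n * g n \<le> (c * c') * Suc n ^ (d + d')" for n
      using mult_mono[OF *(1)[of n] *(2)[of n]] by (simp only: power_add) (simp only: ac_simps)
    then show ?case by blast
  qed
  assume "polyf f"
  then obtain c d where *: "\<And>n. f n \<le> c * Suc n ^ d" using key by blast
  \<comment> \<open>For positive \<open>n\<close> the factor \<open>2 ^ d\<close> comes from
    \<open>Suc n\<close> being at most \<open>2 * n\<close>; the value at 0 is covered by the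
    additive constant.\<close>
  have "f n \<le> (c * 2 ^ d) * n ^ d + c * 2 ^ d" for n
  proof (cases n)
    case 0
    then show ?thesis using *[of 0] by simp (metis le_add1 le_trans mult.commute mult_le_mono1 nat_mult_1 one_le_numeral one_le_power trans_le_add2)
  next
    case (Suc k)
    have "Suc n ^ d \<le> (2 * n) ^ d" using Suc by (intro power_mono) auto
    then have "c * Suc n ^ d \<le> (c * 2 ^ d) * n ^ d" by (simp add: power_mult_distrib)
    then show ?thesis using *[of n] by linarith
  qed
  then show ?thesis by blast
qed

fun dsize :: "'u data \<Rightarrow> nat" where
  "dsize Leaf = 1"
| "dsize (Elem x) = 1"
| "dsize (Node x y) = dsize x + dsize y + 1"

fun dfst :: "'u data \<Rightarrow> 'u data" where
  "dfst (Node x y) = x"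
| "dfst v = Leaf"

fun dsnd :: "'u data \<Rightarrow> 'u data" where
  "dsnd (Node x y) = y"
| "dsnd v = Leaf"

lemma dsize_pos: "1 \<le> dsize v"
  by (induction v) auto

lemma dsize_dfst: "dsize (dfst v) \<le> dsize v"
  by (cases v) auto

lemma dsize_dsnd: "dsize (dsnd v) \<le> dsize v"
  by (cases v) auto

text \<open>
  Trees are shared in memory, so a short running time does not bound the size of the output;
  the bound on the output size is what makes the class closed under composition.
\<close>

definition ptime :: "('u ring \<Rightarrow> 'u data \<Rightarrow> 'u data) \<Rightarrow> bool" where
  "ptime f \<longleftrightarrow> (\<exists>P b. polyf b \<and>
     (\<forall>F v. (\<exists>t\<le>b (dsize v). run F P v t (f F v)) \<and> dsize (f F v) \<le> b (dsize v)))"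

lemma ptime_prim:
  assumes "\<And>F (v :: 'u data). dsize (prim_sem F b v) \<le> dsize v + 2"
  shows "ptime (\<lambda>F (v :: 'u data). prim_sem F b v)"
  unfolding ptime_def
  by (rule exI[of _ "Prim b"], rule exI[of _ "\<lambda>n. n + 2"])
     (use assms in \<open>auto intro!: polyf_intros exI[of _ 1] simp: run_Prim[simplified]\<close>)

lemma ptime_comp:
  assumes "ptime f" "ptime g"
  shows "ptime (\<lambda>F v. f F (g F v))"
proof -
  obtain P b where f: "polyf b" "\<And>F v. \<exists>t\<le>b (dsize v). run F P v t (f F v)"
    "\<And>F v. dsize (f F v) \<le> b (dsize v)"
    using assms(1) unfolding ptime_def by blast
  obtain Q c where g: "polyf c" "\<And>F v. \<exists>t\<le>c (dsize v). run F Q v t (g F v)"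
    "\<And>F v. dsize (g F v) \<le> c (dsize v)"
    using assms(2) unfolding ptime_def by blast
  have le: "b (dsize (g F v)) \<le> b (c (dsize v))" for F v
    using f(1) g(3) by (rule polyf_mono)
  let ?d = "\<lambda>n. c n + b (c n) + 1"
  have "(\<exists>t\<le>?d (dsize v). run F (Seq Q P) v t (f F (g F v))) \<and>
    dsize (f F (g F v)) \<le> ?d (dsize v)" for F v
  proof -
    obtain s t where "s \<le> c (dsize v)" "run F Q v s (g F v)"
      "t \<le> b (dsize (g F v))" "run F P (g F v) t (f F (g F v))"
      using f(2) g(2) by blast
    then show ?thesis
      using le[of F v] f(3)[of F "g F v"]
      by (intro conjI exI[of _ "s + t + 1"] run_Seq) auto
  qed
  moreover have "polyf ?d" by (intro polyf_intros polyf_comp[OF f(1)] f g)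
  ultimately show ?thesis unfolding ptime_def by blast
qed

lemma ptime_Node:
  assumes "ptime f" "ptime g"
  shows "ptime (\<lambda>F v. Node (f F v) (g F v))"
proof -
  obtain P b where f: "polyf b" "\<And>F v. \<exists>t\<le>b (dsize v). run F P v t (f F v)"
    "\<And>F v. dsize (f F v) \<le> b (dsize v)"
    using assms(1) unfolding ptime_def by blast
  obtain Q c where g: "polyf c" "\<And>F v. \<exists>t\<le>c (dsize v). run F Q v t (g F v)"
    "\<And>F v. dsize (g F v) \<le> c (dsize v)"
    using assms(2) unfolding ptime_def by blast
  let ?d = "\<lambda>n. b n + c n + 1"
  have "(\<exists>t\<le>?d (dsize v). run F (Fork P Q) v t (Node (f F v) (g F v))) \<and>
    dsize (Node (f F v) (g F v)) \<le> ?d (dsize v)" for F v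
  proof -
    obtain s t where "s \<le> b (dsize v)" "run F P v s (f F v)"
      "t \<le> c (dsize v)" "run F Q v t (g F v)"
      using f(2) g(2) by blast
    then show ?thesis
      using f(3)[of F v] g(3)[of F v]
      by (intro conjI exI[of _ "s + t + 1"] run_Fork) auto
  qed
  moreover have "polyf ?d" by (intro polyf_intros f g)
  ultimately show ?thesis unfolding ptime_def by blast
qed

lemma ptime_if:
  assumes "ptime h" "ptime f" "ptime g"
  shows "ptime (\<lambda>F v. if h F v \<noteq> Leaf then f F v else g F v)"
proof -
  obtain H a where h: "polyf a" "\<And>F v. \<exists>t\<le>a (dsize v). run F H v t (h F v)"
    using assms(1) unfolding ptime_def by blast
  obtain P b where f: "polyf b" "\<And>F v. \<exists>t\<le>b (dsize v). run F P v t (f F v)"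
    "\<And>F v. dsize (f F v) \<le> b (dsize v)"
    using assms(2) unfolding ptime_def by blast
  obtain Q c where g: "polyf c" "\<And>F v. \<exists>t\<le>c (dsize v). run F Q v t (g F v)"
    "\<And>F v. dsize (g F v) \<le> c (dsize v)"
    using assms(3) unfolding ptime_def by blast
  let ?d = "\<lambda>n. a n + b n + c n + 1"
  let ?k = "\<lambda>F v. if h F v \<noteq> Leaf then f F v else g F v"
  have "(\<exists>t\<le>?d (dsize v). run F (Cond H P Q) v t (?k F v)) \<and> dsize (?k F v) \<le> ?d (dsize v)" for F v
  proof -
    obtain r s t where *: "r \<le> a (dsize v)" "run F H v r (h F v)"
      "s \<le> b (dsize v)" "run F P v s (f F v)" "t \<le> c (dsize v)" "run F Q v t (g F v)"
      using f(2) g(2) h(2) by blast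
    show ?thesis
    proof (cases "h F v = Leaf")
      case True
      then show ?thesis using * g(3)[of F v] run_Cond_false[of F H v r Q t "g F v" P]
        by (intro conjI exI[of _ "r + t + 1"]) auto
    next
      case False
      then show ?thesis using * f(3)[of F v] run_Cond_true[of F H v r "h F v" P s "f F v" Q]
        by (intro conjI exI[of _ "r + s + 1"]) auto
    qed
  qed
  moreover have "polyf ?d" by (intro polyf_intros f g h)
  ultimately show ?thesis unfolding ptime_def by blast
qed

lemma ptime_id: "ptime (\<lambda>F v. v)"
  using ptime_prim[of PId] by simp

lemma ptime_Leaf: "ptime (\<lambda>F v. Leaf)"
  using ptime_prim[of PLeaf] by simp

lemma ptime_dfst: "ptime f \<Longrightarrow> ptime (\<lambda>F v. dfst (f F v))"
proof -
  have "prim_sem F PFst v = dfst v" for F and v :: "'a data" by (cases v) auto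
  moreover have "ptime (\<lambda>F (v :: 'a data). prim_sem F PFst v)"
    by (rule ptime_prim) (auto split: data.splits)
  ultimately have "ptime (\<lambda>F (v :: 'a data). dfst v)" by (simp only:)
  then show "ptime f \<Longrightarrow> ptime (\<lambda>F v. dfst (f F v))" by (rule ptime_comp)
qed

lemma ptime_dsnd: "ptime f \<Longrightarrow> ptime (\<lambda>F v. dsnd (f F v))"
proof -
  have "prim_sem F PSnd v = dsnd v" for F and v :: "'a data" by (cases v) auto
  moreover have "ptime (\<lambda>F (v :: 'a data). prim_sem F PSnd v)"
    by (rule ptime_prim) (auto split: data.splits)
  ultimately have "ptime (\<lambda>F (v :: 'a data). dsnd v)" by (simp only:)
  then show "ptime f \<Longrightarrow> ptime (\<lambda>F v. dsnd (f F v))" by (rule ptime_comp)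
qed

lemma dsize_truth: "dsize (truth b) \<le> 3"
  by (simp add: truth_def)

lemma ptime_prims:
  fixes f g :: "'a ring \<Rightarrow> 'a data \<Rightarrow> 'a data"
  shows "ptime (\<lambda>F (v :: 'a data). Elem \<zero>\<^bsub>F\<^esub>)"
  "ptime (\<lambda>F (v :: 'a data). Elem \<one>\<^bsub>F\<^esub>)"
  "ptime f \<Longrightarrow> ptime (\<lambda>F v. prim_sem F PIsElem (f F v))"
  "ptime f \<Longrightarrow> ptime (\<lambda>F v. prim_sem F PNeg (f F v))"
  "ptime f \<Longrightarrow> ptime g \<Longrightarrow> ptime (\<lambda>F v. prim_sem F PEq (Node (f F v) (g F v)))"
  "ptime f \<Longrightarrow> ptime g \<Longrightarrow> ptime (\<lambda>F v. prim_sem F PAdd (Node (f F v) (g F v)))"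
proof -
  have *: "dsize (prim_sem F b v) \<le> dsize v + 2" if "b \<in> {PZero, POne, PIsElem, PNeg, PEq, PAdd}"
    for F b and v :: "'a data"
    using that dsize_pos[of v] dsize_truth
    by (auto split: data.splits simp: truth_def)
  have prim: "ptime (\<lambda>F (v :: 'a data). prim_sem F b v)" if "b \<in> {PZero, POne, PIsElem, PNeg, PEq, PAdd}" for b
    using * that by (intro ptime_prim) auto
  show "ptime (\<lambda>F (v :: 'a data). Elem \<zero>\<^bsub>F\<^esub>)" using prim[of PZero] by simp
  show "ptime (\<lambda>F (v :: 'a data). Elem \<one>\<^bsub>F\<^esub>)" using prim[of POne] by simp
  show "ptime f \<Longrightarrow> ptime (\<lambda>F (v :: 'a data). prim_sem F PIsElem (f F v))"
    by (rule ptime_comp[OF prim]) auto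
  show "ptime f \<Longrightarrow> ptime (\<lambda>F (v :: 'a data). prim_sem F PNeg (f F v))"
    by (rule ptime_comp[OF prim]) auto
  show "ptime f \<Longrightarrow> ptime g \<Longrightarrow> ptime (\<lambda>F (v :: 'a data). prim_sem F PEq (Node (f F v) (g F v)))"
    by (rule ptime_comp[OF prim]) (auto intro: ptime_Node)
  show "ptime f \<Longrightarrow> ptime g \<Longrightarrow> ptime (\<lambda>F (v :: 'a data). prim_sem F PAdd (Node (f F v) (g F v)))"
    by (rule ptime_comp[OF prim]) (auto intro: ptime_Node)
qed

lemmas ptime_base = ptime_id ptime_Leaf ptime_dfst ptime_dsnd ptime_prims ptime_Node ptime_if

text \<open>Arguments are packed into a pair. In this way the function given to a fold or filter can
  depend on the outer input: it reads that input as the first component.\<close>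

lemma ptime_lift2:
  assumes "ptime (\<lambda>F w. h F (dfst w) (dsnd w))" "ptime f" "ptime g"
  shows "ptime (\<lambda>F v. h F (f F v) (g F v))"
  using ptime_comp[OF assms(1) ptime_Node[OF assms(2,3)]] by simp

lemma ptime_lift3:
  assumes "ptime (\<lambda>F w. h F (dfst w) (dfst (dsnd w)) (dsnd (dsnd w)))" "ptime e" "ptime f" "ptime g"
  shows "ptime (\<lambda>F v. h F (e F v) (f F v) (g F v))"
  using ptime_comp[OF assms(1) ptime_Node[OF assms(2) ptime_Node[OF assms(3,4)]]] by simp

section \<open>Folds along the right spine of a tree\<close>

fun items :: "'u data \<Rightarrow> 'u data list" where
  "items (Node x y) = x # items y"
| "items v = []"

lemma items_list_data [simp]: "items (list_data vs) = vs"
  by (induction vs) (auto simp: list_data_def)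

lemma list_data_simps [simp]: "list_data [] = Leaf" "list_data (v # vs) = Node v (list_data vs)"
  by (auto simp: list_data_def)

lemma list_data_eq_Leaf [simp]: "list_data vs = Leaf \<longleftrightarrow> vs = []"
  by (cases vs) auto

lemma dsize_items: "x \<in> set (items v) \<Longrightarrow> dsize x \<le> dsize v"
  by (induction v) auto

lemma length_items: "length (items v) \<le> dsize v"
  by (induction v) auto

lemma dsize_list_data: "dsize (list_data vs) = 1 + (\<Sum>v\<leftarrow>vs. dsize v + 1)"
  by (induction vs) auto

lemma dsize_list_data_items: "dsize (list_data (items v)) \<le> dsize v"
  by (induction v) auto

text \<open>The loop state holds the fixed input \<open>v\<close>, the accumulator and the rest of
  the list. A spine may end in a field element, which counts as true, so the test maps it to
  \<open>Leaf\<close>; \<open>z\<close> is whatever the spine ends in.\<close>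

lemma run_While_foldl:
  fixes s :: "'u data \<Rightarrow> 'u data \<Rightarrow> 'u data"
  assumes test: "\<And>w. \<exists>t\<le>b (dsize w). run F B w t
      (if prim_sem F PIsElem (dsnd (dsnd w)) \<noteq> Leaf then Leaf else dsnd (dsnd w))"
    and body: "\<And>a x l. \<exists>t\<le>c (dsize (Node v (Node a (Node x l)))).
      run F H (Node v (Node a (Node x l))) t (Node v (Node (s a x) l))"
    and poly: "polyf b" "polyf c"
    and "\<And>k. k \<le> length (items l) \<Longrightarrow> dsize (foldl s a (take k (items l))) \<le> N"
    and "dsize l \<le> N'"
  shows "\<exists>t z. t \<le> (length (items l) + 1) * (b (dsize v + N + N' + 2) + c (dsize v + N + N' + 2) + 1) \<and>
    run F (While B H) (Node v (Node a l)) t (Node v (Node (foldl s a (items l)) z))"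
  using assms(5,6)
proof (induction l arbitrary: a)
  case Leaf
  have "dsize a \<le> N" using Leaf.prems(1)[of 0] by simp
  then have *: "b (dsize (Node v (Node a Leaf))) \<le> b (dsize v + N + N' + 2)"
    using Leaf.prems(2) by (intro polyf_mono[OF poly(1)]) auto
  obtain t where "t \<le> b (dsize (Node v (Node a Leaf)))" "run F B (Node v (Node a Leaf)) t Leaf"
    using test[of "Node v (Node a Leaf)"] by (auto simp: truth_def)
  then show ?case using run_While_stop[of F B "Node v (Node a Leaf)" t H] *
    by (intro exI[of _ "t + 1"] exI[of _ Leaf]) auto
next
  case (Elem e)
  have "dsize a \<le> N" using Elem.prems(1)[of 0] by simp
  then have *: "b (dsize (Node v (Node a (Elem e)))) \<le> b (dsize v + N + N' + 2)"
    using Elem.prems(2) by (intro polyf_mono[OF poly(1)]) auto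
  obtain t where "t \<le> b (dsize (Node v (Node a (Elem e))))" "run F B (Node v (Node a (Elem e))) t Leaf"
    using test[of "Node v (Node a (Elem e))"] by (auto simp: truth_def)
  then show ?case using run_While_stop[of F B "Node v (Node a (Elem e))" t H] *
    by (intro exI[of _ "t + 1"] exI[of _ "Elem e"]) auto
next
  case (Node x l)
  let ?w = "Node v (Node a (Node x l))"
  let ?M = "dsize v + N + N' + 2"
  have "dsize a \<le> N" using Node.prems(1)[of 0] by simp
  then have *: "b (dsize ?w) \<le> b ?M" "c (dsize ?w) \<le> c ?M"
    using Node.prems(2) by (intro polyf_mono[OF poly(1)] polyf_mono[OF poly(2)]; simp)+
  obtain t1 where t1: "t1 \<le> b (dsize ?w)" "run F B ?w t1 (Node x l)"
    using test[of ?w] by (auto simp: truth_def)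
  obtain t2 where t2: "t2 \<le> c (dsize ?w)" "run F H ?w t2 (Node v (Node (s a x) l))"
    using body[of a x l] by auto
  have "dsize (foldl s (s a x) (take k (items l))) \<le> N" if "k \<le> length (items l)" for k
    using Node.prems(1)[of "Suc k"] that by simp
  moreover have "dsize l \<le> N'" using Node.prems(2) by simp
  ultimately obtain t z where t: "t \<le> (length (items l) + 1) * (b ?M + c ?M + 1)"
    "run F (While B H) (Node v (Node (s a x) l)) t (Node v (Node (foldl s (s a x) (items l)) z))"
    using Node.IH(2)[of "s a x"] by blast
  have "run F (While B H) ?w (t1 + t2 + t + 1) (Node v (Node (foldl s a (items (Node x l))) z))"
    using run_While_step[OF t1(2) _ t2(2) t(2)] by simp
  moreover have "t1 + t2 + t + 1 \<le> (length (items (Node x l)) + 1) * (b ?M + c ?M + 1)"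
    using t(1) t1(1) t2(1) * by simp
  ultimately show ?case by blast
qed

text \<open>Iterating a polynomial-time step need not be polynomial, since the accumulator may grow
  by a factor in each round. Hence the bound on every intermediate accumulator.\<close>

lemma ptime_foldl:
  fixes a l :: "'a ring \<Rightarrow> 'a data \<Rightarrow> 'a data"
  assumes s: "ptime (\<lambda>F w. s F (dfst w) (dfst (dsnd w)) (dsnd (dsnd w)))"
    and a: "ptime a" and l: "ptime l" and poly: "polyf b"
    and bound: "\<And>F v k. k \<le> length (items (l F v)) \<Longrightarrow>
      dsize (foldl (s F v) (a F v) (take k (items (l F v)))) \<le> b (dsize v)"
  shows "ptime (\<lambda>F v. foldl (s F v) (a F v) (items (l F v)))"
proof -
  let ?test = "\<lambda>F (w :: 'a data). if prim_sem F PIsElem (dsnd (dsnd w)) \<noteq> Leaf then Leaf else dsnd (dsnd w)"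
  let ?body = "\<lambda>F w. Node (dfst w)
    (Node (s F (dfst w) (dfst (dsnd w)) (dfst (dsnd (dsnd w)))) (dsnd (dsnd (dsnd w))))"
  have "ptime ?test" by (intro ptime_base)
  then obtain B c where B: "polyf c" "\<And>F v. \<exists>t\<le>c (dsize v). run F B v t (?test F v)"
    unfolding ptime_def by blast
  have "ptime ?body"
    by (intro ptime_base ptime_lift3[OF s])
  then obtain H d where H: "polyf d" "\<And>F v. \<exists>t\<le>d (dsize v). run F H v t (?body F v)"
    unfolding ptime_def by blast
  have "ptime (\<lambda>F v. Node v (Node (a F v) (l F v)))" by (intro ptime_base a l)
  then obtain Q q where Q: "polyf q" "\<And>F v. \<exists>t\<le>q (dsize v). run F Q v t (Node v (Node (a F v) (l F v)))"
    "\<And>F v. dsize (Node v (Node (a F v) (l F v))) \<le> q (dsize v)"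
    unfolding ptime_def by blast
  let ?M = "\<lambda>n. n + b n + q n + 2"
  let ?e = "\<lambda>n. q n + (q n + 1) * (c (?M n) + d (?M n) + 1) + 5 + b n"
  let ?P = "Seq Q (Seq (While B H) (Seq (Prim PSnd) (Prim PFst)))"
  have "(\<exists>t\<le>?e (dsize v). run F ?P v t (foldl (s F v) (a F v) (items (l F v)))) \<and>
    dsize (foldl (s F v) (a F v) (items (l F v))) \<le> ?e (dsize v)" for F v
  proof -
    let ?r = "foldl (s F v) (a F v) (items (l F v))"
    have lq: "dsize (l F v) \<le> q (dsize v)" using Q(3)[of v F] by simp
    have "\<exists>t z. t \<le> (length (items (l F v)) + 1) * (c (?M (dsize v)) + d (?M (dsize v)) + 1) \<and>
      run F (While B H) (Node v (Node (a F v) (l F v))) t (Node v (Node ?r z))"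
    proof (rule run_While_foldl[where b = c and c = d, OF B(2) _ B(1) H(1) _ lq])
      show "\<exists>t\<le>d (dsize (Node v (Node a (Node x l)))).
        run F H (Node v (Node a (Node x l))) t (Node v (Node (s F v a x) l))" for a x l
        using H(2)[of "Node v (Node a (Node x l))" F] by simp
    qed (rule bound)
    then obtain t z where t: "t \<le> (length (items (l F v)) + 1) * (c (?M (dsize v)) + d (?M (dsize v)) + 1)"
      "run F (While B H) (Node v (Node (a F v) (l F v))) t (Node v (Node ?r z))" by blast
    obtain r where r: "r \<le> q (dsize v)" "run F Q v r (Node v (Node (a F v) (l F v)))"
      using Q(2) by blast
    have "run F (Seq (Prim PSnd) (Prim PFst)) (Node v (Node ?r z)) (1 + 1 + 1) ?r"
      using run_Seq[OF run_Prim[of F PSnd] run_Prim[of F PFst], of "Node v (Node ?r z)"]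
      by (simp only: prim_sem.simps data.case)
    then have "run F ?P v (r + (t + (1 + 1 + 1) + 1) + 1) ?r"
      by (rule run_Seq[OF r(2) run_Seq[OF t(2)]])
    moreover have "t \<le> (q (dsize v) + 1) * (c (?M (dsize v)) + d (?M (dsize v)) + 1)"
      using lq length_items[of "l F v"] by (intro order_trans[OF t(1)] mult_right_mono) auto
    then have "r + (t + (1 + 1 + 1) + 1) + 1 \<le> ?e (dsize v)"
      using r(1) by linarith
    moreover have "dsize ?r \<le> ?e (dsize v)"
      using bound[of "length (items (l F v))" F v] by simp
    ultimately show ?thesis by blast
  qed
  moreover have "polyf ?e" by (intro polyf_intros polyf_comp[OF B(1)] polyf_comp[OF H(1)] Q(1) poly)
  ultimately show ?thesis unfolding ptime_def by blast
qed

text \<open>Growth by an amount that depends only on the input and the current item adds up over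
  polynomially many rounds. \<open>Inv\<close> is for steps whose growth depends on the
  accumulator.\<close>

lemma ptime_foldl_additive:
  fixes a l :: "'a ring \<Rightarrow> 'a data \<Rightarrow> 'a data"
  assumes s: "ptime (\<lambda>F w. s F (dfst w) (dfst (dsnd w)) (dsnd (dsnd w)))"
    and a: "ptime a" and l: "ptime l" and poly: "polyf b"
    and "\<And>F v. Inv F v (a F v)"
    and "\<And>F v u x. Inv F v u \<Longrightarrow> x \<in> set (items (l F v)) \<Longrightarrow> Inv F v (s F v u x)"
    and "\<And>F v u x. Inv F v u \<Longrightarrow> x \<in> set (items (l F v)) \<Longrightarrow>
      dsize (s F v u x) \<le> dsize u + b (dsize v + dsize x)"
  shows "ptime (\<lambda>F v. foldl (s F v) (a F v) (items (l F v)))"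
proof -
  obtain c where c: "polyf c" "\<And>F v. dsize (a F v) \<le> c (dsize v)"
    using a unfolding ptime_def by blast
  obtain d where d: "polyf d" "\<And>F v. dsize (l F v) \<le> d (dsize v)"
    using l unfolding ptime_def by blast
  let ?e = "\<lambda>n. c n + d n * b (n + d n)"
  have "polyf ?e" by (intro polyf_intros polyf_comp[OF poly] c(1) d(1))
  then show ?thesis
  proof (rule ptime_foldl[OF s a l])
    fix F v k
    assume k: "k \<le> length (items (l F v))"
    have "Inv F v (foldl (s F v) (a F v) (take k (items (l F v)))) \<and>
      dsize (foldl (s F v) (a F v) (take k (items (l F v)))) \<le> c (dsize v) + k * b (dsize v + d (dsize v))"
      using k
    proof (induction k)
      case 0
      then show ?case using assms(5) c(2) by simp
    next
      case (Suc k)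
      let ?u = "foldl (s F v) (a F v) (take k (items (l F v)))"
      let ?x = "items (l F v) ! k"
      have x: "?x \<in> set (items (l F v))" using Suc.prems by simp
      have "dsize ?x \<le> d (dsize v)" using dsize_items[OF x] d(2) le_trans by blast
      then have "b (dsize v + dsize ?x) \<le> b (dsize v + d (dsize v))"
        by (intro polyf_mono[OF poly]) simp
      then show ?case
        using Suc assms(6)[OF _ x, of ?u] assms(7)[OF _ x, of ?u]
        by (auto simp: take_Suc_conv_app_nth)
    qed
    moreover have "k \<le> d (dsize v)" using k length_items d(2) le_trans by blast
    then have "k * b (dsize v + d (dsize v)) \<le> d (dsize v) * b (dsize v + d (dsize v))"
      by (rule mult_right_mono) simp
    ultimately show "dsize (foldl (s F v) (a F v) (take k (items (l F v)))) \<le> ?e (dsize v)"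
      by linarith
  qed
qed

section \<open>List operations in polynomial time\<close>

definition drev :: "'u data \<Rightarrow> 'u data" where
  "drev l = list_data (rev (items l))"

definition dapp :: "'u data \<Rightarrow> 'u data \<Rightarrow> 'u data" where
  "dapp u w = list_data (items u @ items w)"

definition dmap :: "('u data \<Rightarrow> 'u data) \<Rightarrow> 'u data \<Rightarrow> 'u data" where
  "dmap f l = list_data (map f (items l))"

definition dfilter :: "('u data \<Rightarrow> 'u data) \<Rightarrow> 'u data \<Rightarrow> 'u data" where
  "dfilter f l = list_data (filter (\<lambda>x. f x \<noteq> Leaf) (items l))"

definition dcmap :: "('u data \<Rightarrow> 'u data) \<Rightarrow> 'u data \<Rightarrow> 'u data" where
  "dcmap f l = list_data (concat (map (\<lambda>x. items (f x)) (items l)))"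

lemma foldl_Node: "foldl (\<lambda>u x. Node x u) a xs = foldr Node (rev xs) a"
  by (induction xs arbitrary: a) auto

lemma drev_foldl: "drev l = foldl (\<lambda>u x. Node x u) Leaf (items l)"
  by (simp add: drev_def list_data_def foldl_Node)

lemma dsize_drev: "dsize (drev l) \<le> dsize l"
proof -
  have "dsize (drev l) = dsize (list_data (items l))"
    by (simp add: drev_def dsize_list_data rev_map[symmetric] del: rev_map)
  then show ?thesis using dsize_list_data_items[of l] by simp
qed

lemma ptime_drev:
  assumes "ptime f"
  shows "ptime (\<lambda>F v. drev (f F v))"
  unfolding drev_foldl
  by (rule ptime_foldl_additive[where b = "\<lambda>n. n + 1" and Inv = "\<lambda>_ _ _. True"])
     (auto intro!: ptime_base polyf_intros assms)

text \<open>Reversing \<open>w\<close> twice replaces the end of its spine by \<open>Leaf\<close>,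
  as \<open>dapp\<close> demands.\<close>

lemma dapp_foldl: "dapp u w = foldl (\<lambda>u x. Node x u) (drev (drev w)) (items (drev u))"
  by (simp add: dapp_def drev_def foldl_Node) (simp add: list_data_def)

lemma dsize_dapp: "dsize (dapp u w) \<le> dsize u + dsize w"
  using dsize_list_data_items[of u] dsize_list_data_items[of w]
  by (simp add: dapp_def dsize_list_data)

lemma ptime_dapp:
  assumes "ptime f" "ptime g"
  shows "ptime (\<lambda>F v. dapp (f F v) (g F v))"
  unfolding dapp_foldl
  by (rule ptime_foldl_additive[where b = "\<lambda>n. n + 1" and Inv = "\<lambda>_ _ _. True"])
     (auto intro!: ptime_base ptime_drev polyf_intros assms)

lemma dcmap_foldl: "dcmap f l = foldl (\<lambda>u x. dapp (f x) u) Leaf (items (drev l))"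
proof -
  have "foldl (\<lambda>u x. dapp (f x) u) (list_data a) (rev xs) = 
    list_data (concat (map (\<lambda>x. items (f x)) xs) @ a)" for a xs
    by (induction xs arbitrary: a) (auto simp: dapp_def)
  from this[of "[]" "items l"] show ?thesis by (simp add: dcmap_def drev_def)
qed

lemma ptime_dcmap:
  assumes f: "ptime (\<lambda>F w. f F (dfst w) (dsnd w))" and l: "ptime l"
  shows "ptime (\<lambda>F v. dcmap (f F v) (l F v))"
proof -
  obtain b where b: "polyf b" "\<And>F w. dsize (f F (dfst w) (dsnd w)) \<le> b (dsize w)"
    using f unfolding ptime_def by blast
  have "dsize (dapp (f F v x) u) \<le> dsize u + b (dsize v + dsize x + 1)" for F v x u
    using dsize_dapp[of "f F v x" u] b(2)[of F "Node v x"] by simp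
  moreover have "polyf (\<lambda>n. b (n + 1))" by (rule polyf_comp[OF b(1)]) (intro polyf_intros)
  moreover have "ptime (\<lambda>F w. dapp (f F (dfst w) (dsnd (dsnd w))) (dfst (dsnd w)))"
    by (intro ptime_dapp ptime_lift2[OF f] ptime_base)
  ultimately show ?thesis
    unfolding dcmap_foldl
    by (intro ptime_foldl_additive[where b = "\<lambda>n. b (n + 1)" and Inv = "\<lambda>_ _ _. True"]
        ptime_Leaf ptime_drev l) auto
qed

lemma ptime_dmap:
  assumes f: "ptime (\<lambda>F w. f F (dfst w) (dsnd w))" and l: "ptime l"
  shows "ptime (\<lambda>F v. dmap (f F v) (l F v))"
proof -
  have "dmap f l = dcmap (\<lambda>x. Node (f x) Leaf) l" for f and l :: "'a data"
    by (simp add: dmap_def dcmap_def concat_map_singleton)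
  then show ?thesis using ptime_dcmap[OF ptime_Node[OF f ptime_Leaf] l] by simp
qed

lemma ptime_dfilter:
  assumes f: "ptime (\<lambda>F w. f F (dfst w) (dsnd w))" and l: "ptime l"
  shows "ptime (\<lambda>F v. dfilter (f F v) (l F v))"
proof -
  have "concat (map (\<lambda>x. items (if P x then Node x Leaf else Leaf)) xs) = filter P xs"
    for P and xs :: "'a data list"
    by (induction xs) auto
  then have "dfilter f l = dcmap (\<lambda>x. if f x \<noteq> Leaf then Node x Leaf else Leaf) l" for f and l :: "'a data"
    by (simp add: dfilter_def dcmap_def)
  then show ?thesis
    using ptime_dcmap[OF ptime_if[OF f ptime_Node[OF ptime_dsnd[OF ptime_id] ptime_Leaf] ptime_Leaf] l] by simp
qed

text \<open>The list \<open>u\<close> acts as a unary number. This stands in for integer arithmetic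
  and also compares lengths: the result is empty exactly if \<open>w\<close> is no longer than
  \<open>u\<close>, for proper lists.\<close>

definition ddrop :: "'u data \<Rightarrow> 'u data \<Rightarrow> 'u data" where
  "ddrop u w = foldl (\<lambda>a x. dsnd a) w (items u)"

lemma ptime_ddrop:
  assumes "ptime f" "ptime g"
  shows "ptime (\<lambda>F v. ddrop (f F v) (g F v))"
  unfolding ddrop_def
  by (rule ptime_foldl_additive[where b = "\<lambda>n. n" and Inv = "\<lambda>_ _ _. True"])
     (auto intro!: ptime_base polyf_intros assms trans_le_add1 dsize_dsnd)

lemma ddrop_list_data: "ddrop u (list_data vs) = list_data (drop (length (items u)) vs)"
proof -
  have "foldl (\<lambda>a x. dsnd a) (list_data vs) xs = list_data (drop (length xs) vs)" for xs :: "'a data list"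
  proof (induction xs arbitrary: vs)
    case (Cons x xs)
    show ?case using Cons.IH[of "tl vs"] by (cases vs) auto
  qed simp
  then show ?thesis by (simp add: ddrop_def)
qed

definition dbutlast :: "'u data \<Rightarrow> 'u data" where
  "dbutlast u = drev (dsnd (drev u))"

lemma ptime_dbutlast: "ptime f \<Longrightarrow> ptime (\<lambda>F v. dbutlast (f F v))"
  unfolding dbutlast_def by (intro ptime_drev ptime_base)

definition dprefixes :: "'u data \<Rightarrow> 'u data" where
  "dprefixes u = foldl (\<lambda>a x. Node (dbutlast (dfst a)) a) (Node u Leaf) (items u)"

lemma dsize_dbutlast: "dsize (dbutlast u) \<le> dsize u"
  unfolding dbutlast_def by (meson dsize_drev dsize_dsnd le_trans)

text \<open>Each step adds a shortened copy of the head, so without the invariant that the head is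
  no larger than the input the size could double.\<close>

lemma ptime_dprefixes:
  assumes "ptime f"
  shows "ptime (\<lambda>F v. dprefixes (f F v))"
proof -
  have "ptime (\<lambda>F (v :: 'a data). dprefixes v)"
    unfolding dprefixes_def
    by (rule ptime_foldl_additive[where b = "\<lambda>n. n + 1" and Inv = "\<lambda>_ v a. dsize (dfst a) \<le> dsize v"])
       (auto intro!: ptime_base ptime_dbutlast polyf_intros intro: order_trans[OF dsize_dbutlast] trans_le_add1)
  then show ?thesis using assms by (rule ptime_comp)
qed

text \<open>The accumulator \<open>Leaf\<close> records a mismatch; otherwise the unread rest of
  \<open>w\<close> is wrapped in a node, so that an exhausted \<open>w\<close> differs from
  failure.\<close>

definition dprefix :: "'u ring \<Rightarrow> 'u data \<Rightarrow> 'u data \<Rightarrow> 'u data" where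
  "dprefix F u w = foldl (\<lambda>a x. if prim_sem F PEq (Node x (dfst (dsnd a))) \<noteq> Leaf
     then Node Leaf (dsnd (dsnd a)) else Leaf) (Node Leaf w) (items u)"

lemma ptime_dprefix:
  assumes "ptime f" "ptime g"
  shows "ptime (\<lambda>F v. dprefix F (f F v) (g F v))"
proof -
  \<comment> \<open>A successful test forces the accumulator to be a node, and then the new node is
    no larger.\<close>
  have "dsize (if e \<noteq> Leaf then Node Leaf (dsnd (dsnd a)) else Leaf) \<le> dsize a"
    if "dsnd a = Leaf \<Longrightarrow> e = Leaf" for a e :: "'a data"
  proof (cases "e = Leaf")
    case True
    then show ?thesis using dsize_pos[of a] by simp
  next
    case False
    then have "dsnd a \<noteq> Leaf" using that by blast
    then show ?thesis
      using dsize_dsnd[of "dsnd a"] dsize_pos[of "dfst a"] by (cases a) auto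
  qed
  moreover have "prim_sem F PEq (Node x (dfst (dsnd a))) = Leaf" if "dsnd a = Leaf" for F a and x :: "'a data"
    using that by (auto split: data.splits)
  ultimately have *: "dsize (if prim_sem F PEq (Node x (dfst (dsnd a))) \<noteq> Leaf
     then Node Leaf (dsnd (dsnd a)) else Leaf) \<le> dsize a" for F a and x :: "'a data"
    by blast
  show ?thesis
    unfolding dprefix_def
    by (rule ptime_foldl_additive[where b = "\<lambda>n. n" and Inv = "\<lambda>_ _ _. True"])
       (intro ptime_base polyf_intros assms TrueI trans_le_add1 *)+
qed

section \<open>Membership, classes and label tables\<close>

definition dnot :: "'u data \<Rightarrow> 'u data" where
  "dnot u = (if u \<noteq> Leaf then Leaf else Node Leaf Leaf)"

definition deq :: "'u ring \<Rightarrow> 'u data \<Rightarrow> 'u data \<Rightarrow> 'u data" where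
  "deq F u w = (if dprefix F u w \<noteq> Leaf then dprefix F w u else Leaf)"

definition dmem :: "'u ring \<Rightarrow> 'u data \<Rightarrow> 'u data \<Rightarrow> 'u data" where
  "dmem F x l = dfilter (\<lambda>y. deq F x y) l"

definition dremdups :: "'u ring \<Rightarrow> 'u data \<Rightarrow> 'u data" where
  "dremdups F l = foldl (\<lambda>a x. if dmem F x a \<noteq> Leaf then a else Node x a) Leaf (items l)"

text \<open>If no prefix is queried, the filtered list is \<open>Leaf\<close>, and
  \<open>dfst\<close> returns \<open>Leaf\<close>, the code of the empty tuple; this is the default
  of \<open>cls\<close>.\<close>

definition dcls :: "'u ring \<Rightarrow> 'u data \<Rightarrow> 'u data \<Rightarrow> 'u data" where
  "dcls F Q a = dfst (dfilter (\<lambda>p. dmem F p Q) (drev (dprefixes a)))"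

definition doverlay :: "'u data \<Rightarrow> 'u data \<Rightarrow> 'u data" where
  "doverlay x w = dapp x (ddrop x w)"

definition dlookup :: "'u ring \<Rightarrow> 'u data \<Rightarrow> 'u data \<Rightarrow> 'u data" where
  "dlookup F x l = dsnd (dfst (dfilter (\<lambda>e. deq F (dfst e) x) l))"

text \<open>Quick-find on an association list: one merge rewrites every entry that carries the label
  of the second endpoint.\<close>

definition dmerge :: "'u ring \<Rightarrow> 'u data \<Rightarrow> 'u data \<Rightarrow> 'u data" where
  "dmerge F a e = dmap (\<lambda>n. Node (dfst n)
     (if deq F (dsnd n) (dlookup F (dsnd e) a) \<noteq> Leaf then dlookup F (dfst e) a else dsnd n)) a"

definition dlabels :: "'u ring \<Rightarrow> 'u data \<Rightarrow> 'u data \<Rightarrow> 'u data" where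
  "dlabels F a E = foldl (dmerge F) a (items E)"

lemma ptime_dnot: "ptime f \<Longrightarrow> ptime (\<lambda>F v. dnot (f F v))"
  unfolding dnot_def by (intro ptime_base)

lemma ptime_deq: "ptime f \<Longrightarrow> ptime g \<Longrightarrow> ptime (\<lambda>F v. deq F (f F v) (g F v))"
  unfolding deq_def by (intro ptime_base ptime_dprefix)

lemma ptime_dmem: "ptime f \<Longrightarrow> ptime g \<Longrightarrow> ptime (\<lambda>F v. dmem F (f F v) (g F v))"
  by (rule ptime_lift2) (unfold dmem_def, intro ptime_dfilter ptime_deq ptime_base)

lemma ptime_dremdups:
  assumes "ptime f"
  shows "ptime (\<lambda>F v. dremdups F (f F v))"
  unfolding dremdups_def
  by (rule ptime_foldl_additive[where b = "\<lambda>n. n + 1" and Inv = "\<lambda>_ _ _. True"])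
     (auto intro!: ptime_base ptime_dmem polyf_intros assms)

lemma ptime_dcls: "ptime f \<Longrightarrow> ptime g \<Longrightarrow> ptime (\<lambda>F v. dcls F (f F v) (g F v))"
  by (rule ptime_lift2) (unfold dcls_def, intro ptime_dfilter ptime_dmem ptime_drev ptime_dprefixes ptime_base)

lemma ptime_doverlay: "ptime f \<Longrightarrow> ptime g \<Longrightarrow> ptime (\<lambda>F v. doverlay (f F v) (g F v))"
  unfolding doverlay_def by (intro ptime_dapp ptime_ddrop)

lemma ptime_dlookup: "ptime f \<Longrightarrow> ptime g \<Longrightarrow> ptime (\<lambda>F v. dlookup F (f F v) (g F v))"
  by (rule ptime_lift2) (unfold dlookup_def, intro ptime_dfilter ptime_deq ptime_base)

lemma ptime_dmerge: "ptime f \<Longrightarrow> ptime g \<Longrightarrow> ptime (\<lambda>F v. dmerge F (f F v) (g F v))"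
  by (rule ptime_lift2) (unfold dmerge_def, intro ptime_dmap ptime_deq ptime_dlookup ptime_base)

lemma dlookup_bound:
  assumes "\<And>n. n \<in> set (items a) \<Longrightarrow> dsize (dsnd n) \<le> M" "1 \<le> M"
  shows "dsize (dlookup F x a) \<le> M"
proof (cases "filter (\<lambda>e. deq F (dfst e) x \<noteq> Leaf) (items a)")
  case (Cons e es)
  have "e \<in> set (filter (\<lambda>e. deq F (dfst e) x \<noteq> Leaf) (items a))" unfolding Cons by simp
  then have "e \<in> set (items a)" by simp
  then show ?thesis using assms(1) Cons by (simp add: dlookup_def dfilter_def)
qed (use assms in \<open>simp add: dlookup_def dfilter_def\<close>)

lemma dmerge_bound:
  assumes "\<And>n. n \<in> set (items a) \<Longrightarrow> dsize (dfst n) \<le> M \<and> dsize (dsnd n) \<le> M"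
    "length (items a) \<le> M" "1 \<le> M"
  shows "dsize (dmerge F a e) \<le> 1 + M * (2 * M + 2)"
    "length (items (dmerge F a e)) \<le> M"
    "n \<in> set (items (dmerge F a e)) \<Longrightarrow> dsize (dfst n) \<le> M \<and> dsize (dsnd n) \<le> M"
proof -
  let ?f = "\<lambda>n. Node (dfst n)
     (if deq F (dsnd n) (dlookup F (dsnd e) a) \<noteq> Leaf then dlookup F (dfst e) a else dsnd n)"
  have l: "dsize (dlookup F x a) \<le> M" for x using assms by (intro dlookup_bound) auto
  have f: "dsize (dfst (?f n)) \<le> M \<and> dsize (dsnd (?f n)) \<le> M" "dsize (?f n) \<le> 2 * M + 1"
    if "n \<in> set (items a)" for n
    using assms(1)[OF that] l[of "dfst e"] by auto
  have "dsize (dmerge F a e) = 1 + (\<Sum>n\<leftarrow>items a. dsize (?f n) + 1)"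
    by (simp add: dmerge_def dmap_def dsize_list_data comp_def del: dsize.simps)
  also have "(\<Sum>n\<leftarrow>items a. dsize (?f n) + 1) \<le> (\<Sum>n\<leftarrow>items a. 2 * M + 2)"
    using f(2) by (intro sum_list_mono) (auto simp del: dsize.simps)
  also have "(\<Sum>n\<leftarrow>items a. 2 * M + 2) \<le> M * (2 * M + 2)"
    using assms(2) unfolding sum_list_triv by (intro mult_right_mono) auto
  finally show "dsize (dmerge F a e) \<le> 1 + M * (2 * M + 2)" by simp
  show "length (items (dmerge F a e)) \<le> M"
    using assms(2) by (simp add: dmerge_def dmap_def)
  assume "n \<in> set (items (dmerge F a e))"
  then obtain n' where "n' \<in> set (items a)" "n = ?f n'" by (auto simp: dmerge_def dmap_def)
  then show "dsize (dfst n) \<le> M \<and> dsize (dsnd n) \<le> M" using f(1) by blast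
qed

text \<open>Merging only copies labels that are already present, so keys and labels never outgrow
  those of the initial table, however many edges are processed.\<close>

lemma ptime_dlabels:
  fixes f g :: "'a ring \<Rightarrow> 'a data \<Rightarrow> 'a data"
  assumes f: "ptime f" and g: "ptime g"
  shows "ptime (\<lambda>F v. dlabels F (f F v) (g F v))"
proof -
  obtain c where c: "polyf c" "\<And>F v. dsize (f F v) \<le> c (dsize v)"
    using f unfolding ptime_def by blast
  let ?b = "\<lambda>n. c n + (1 + c n * (2 * c n + 2))"
  have s: "ptime (\<lambda>F w. dmerge F (dfst (dsnd w)) (dsnd (dsnd w)))"
    by (intro ptime_dmerge ptime_base)
  have "polyf ?b" by (intro polyf_intros c(1))
  then show ?thesis
    unfolding dlabels_def
  proof (rule ptime_foldl[where s = "\<lambda>F v. dmerge F", OF s f g])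
    fix F and v :: "'a data" and k
    let ?M = "c (dsize v)"
    let ?u = "\<lambda>k. foldl (dmerge F) (f F v) (take k (items (g F v)))"
    have M: "dsize (f F v) \<le> ?M" by (rule c(2))
    assume "k \<le> length (items (g F v))"
    then have "dsize (?u k) \<le> ?b (dsize v) \<and> length (items (?u k)) \<le> ?M \<and>
      (\<forall>n\<in>set (items (?u k)). dsize (dfst n) \<le> ?M \<and> dsize (dsnd n) \<le> ?M)"
    proof (induction k)
      case 0
      have "dsize (dfst n) \<le> ?M \<and> dsize (dsnd n) \<le> ?M" if "n \<in> set (items (f F v))" for n
        using dsize_items[OF that] dsize_dfst[of n] dsize_dsnd[of n] M by linarith
      then show ?case using M length_items[of "f F v"] by auto
    next
      case (Suc k)
      then have IH: "\<And>n. n \<in> set (items (?u k)) \<Longrightarrow> dsize (dfst n) \<le> ?M \<and> dsize (dsnd n) \<le> ?M"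
        "length (items (?u k)) \<le> ?M" by auto
      have "1 \<le> ?M" using M dsize_pos[of "f F v"] by linarith
      note * = dmerge_bound[OF IH this]
      have "?u (Suc k) = dmerge F (?u k) (items (g F v) ! k)"
        using Suc.prems by (simp add: take_Suc_conv_app_nth)
      then show ?case using *(1,2)[of F "items (g F v) ! k"] *(3)[of _ F "items (g F v) ! k"] by auto
    qed
    then show "dsize (?u k) \<le> ?b (dsize v)" by blast
  qed
qed

lemmas ptime_intros = ptime_base ptime_drev ptime_dapp ptime_dcmap ptime_dmap ptime_dfilter ptime_ddrop
  ptime_dbutlast ptime_dprefixes ptime_dprefix ptime_dnot ptime_deq ptime_dmem ptime_dremdups
  ptime_dcls ptime_doverlay ptime_dlookup ptime_dlabels

section \<open>The constraint locator\<close>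

text \<open>
  The input \<open>v\<close> is the pair of the enumeration of the sets and the list of queries; \<open>a_T\<close>, \<open>a_Tp\<close>, \<open>a_S\<close>
  compute the sets \<open>T\<close>, \<open>Tp\<close>, \<open>S\<close> above. Intermediate results are recomputed at every use, which
  only affects the degree of the polynomial.
\<close>

definition a_T :: "'u data \<Rightarrow> 'u data" where
  "a_T v = dcmap dprefixes (Node Leaf (dsnd v))"

definition a_Tp :: "'u data \<Rightarrow> 'u data" where
  "a_Tp v = Node Leaf (dcmap (\<lambda>p. dmap (\<lambda>c. dapp p (Node c Leaf)) (dfst (ddrop p (dfst v)))) (a_T v))"

definition a_base :: "'u data \<Rightarrow> 'u data" where
  "a_base v = dmap dfst (dfst v)"

definition a_S :: "'u data \<Rightarrow> 'u data" where
  "a_S v = dcmap (\<lambda>u. dcmap (\<lambda>x. dmap (\<lambda>y.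
     drev (doverlay y (drev (doverlay x (doverlay u (drev (a_base v)))))))
     (a_Tp v)) (a_Tp v)) (dprefixes (a_base v))"

text \<open>\<open>base\<close> has length \<open>m\<close>, so one more letter gives a tuple longer
  than every class.\<close>

definition a_dead :: "'u ring \<Rightarrow> 'u data \<Rightarrow> 'u data" where
  "a_dead F v = Node (Elem \<zero>\<^bsub>F\<^esub>) (a_base v)"

definition a_V :: "'u ring \<Rightarrow> 'u data \<Rightarrow> 'u data" where
  "a_V F v = Node (a_dead F v) (Node Leaf (dsnd v))"

text \<open>The characteristic is not part of the input; whether it is 2 is found by computing
  \<open>1 + 1\<close>. Edges to the dead vertex mark the classes on which a constraint must
  vanish.\<close>

definition a_edges :: "'u ring \<Rightarrow> 'u data \<Rightarrow> 'u data" where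
  "a_edges F v = dapp
     (dmap (\<lambda>s. Node (dcls F (dsnd v) s) (dcls F (dsnd v) (drev s))) (a_S v))
     (dapp
       (if prim_sem F PEq (Node (prim_sem F PAdd (Node (Elem \<one>\<^bsub>F\<^esub>) (Elem \<one>\<^bsub>F\<^esub>))) (Elem \<zero>\<^bsub>F\<^esub>)) \<noteq> Leaf
        then dmap (\<lambda>s. Node (dcls F (dsnd v) s) (a_dead F v)) (dfilter (\<lambda>s. deq F (drev s) s) (a_S v))
        else Leaf)
       (if dmem F Leaf (dsnd v) \<noteq> Leaf then Leaf else Node (Node Leaf (a_dead F v)) Leaf))"

definition a_lab :: "'u ring \<Rightarrow> 'u data \<Rightarrow> 'u data \<Rightarrow> 'u data" where
  "a_lab F v x = dlookup F x (dlabels F (dmap (\<lambda>x. Node x x) (a_V F v)) (a_edges F v))"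

definition a_ex :: "'u ring \<Rightarrow> 'u data \<Rightarrow> 'u data \<Rightarrow> 'u data" where
  "a_ex F v p = dfilter (\<lambda>c. dnot (dmem F (dapp p (Node c Leaf)) (a_T v))) (dfst (ddrop p (dfst v)))"

definition a_T1 :: "'u ring \<Rightarrow> 'u data \<Rightarrow> 'u data" where
  "a_T1 F v = dfilter (\<lambda>p. a_ex F v p) (a_T v)"

text \<open>\<open>ddrop q p\<close> is nonempty exactly if \<open>p\<close> is longer than
  \<open>q\<close>, so the nodes of least depth survive; \<open>a_T3\<close> compares numbers of
  exits in the same way.\<close>

definition a_T2 :: "'u ring \<Rightarrow> 'u data \<Rightarrow> 'u data" where
  "a_T2 F v = dfilter (\<lambda>p. dnot (dfilter (\<lambda>q. ddrop q p) (a_T1 F v))) (a_T1 F v)"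

definition a_T3 :: "'u ring \<Rightarrow> 'u data \<Rightarrow> 'u data" where
  "a_T3 F v = dfilter (\<lambda>p. dnot (dfilter (\<lambda>q. ddrop (a_ex F v p) (a_ex F v q)) (a_T2 F v))) (a_T2 F v)"

definition a_g :: "'u ring \<Rightarrow> 'u data \<Rightarrow> 'u data" where
  "a_g F v = dcls F (dsnd v) (dfst (a_T3 F v))"

definition a_R :: "'u ring \<Rightarrow> 'u data \<Rightarrow> 'u data" where
  "a_R F v = dremdups F (dfilter (\<lambda>s.
     dnot (deq F (a_lab F v (dcls F (dsnd v) s)) (a_lab F v (a_g F v)))) (a_S v))"

definition a_U :: "'u ring \<Rightarrow> 'u data \<Rightarrow> 'u data \<Rightarrow> 'u data \<Rightarrow> 'u data" where
  "a_U F v l x = (if deq F (a_lab F v x) l \<noteq> Leaf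
     then (if deq F l (a_lab F v (a_dead F v)) \<noteq> Leaf then Elem \<zero>\<^bsub>F\<^esub> else Elem \<one>\<^bsub>F\<^esub>)
     else Elem \<zero>\<^bsub>F\<^esub>)"

definition a_row :: "'u ring \<Rightarrow> 'u data \<Rightarrow> 'u data \<Rightarrow> 'u data" where
  "a_row F v l = Node (prim_sem F PNeg (a_U F v l (a_g F v)))
     (dapp
       (dmap (\<lambda>a. prim_sem F PAdd (Node (a_U F v l (a_g F v))
         (prim_sem F PNeg (a_U F v l (dcls F (dsnd v) a))))) (a_R F v))
       (dmap (\<lambda>x. if x \<noteq> Leaf
         then prim_sem F PAdd (Node (a_U F v l x)
           (prim_sem F PNeg (a_U F v l (dcls F (dsnd v) (dbutlast x)))))
         else a_U F v l x) (dsnd v)))"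

text \<open>The leading \<open>Leaf\<close> encodes \<bottom>. Vertices with a common label repeat a
  row, and the component of the dead vertex gives zero rows; neither affects the kernel.\<close>

definition locator :: "'u ring \<Rightarrow> 'u data \<Rightarrow> 'u data" where
  "locator F v = Node (Node Leaf (a_R F v)) (dmap (\<lambda>x. a_row F v (a_lab F v x)) (a_V F v))"

lemma ptime_a_T: "ptime f \<Longrightarrow> ptime (\<lambda>F v. a_T (f F v))"
  unfolding a_T_def by (intro ptime_intros)

lemma ptime_a_Tp: "ptime f \<Longrightarrow> ptime (\<lambda>F v. a_Tp (f F v))"
  by (rule ptime_comp[rotated], assumption) (unfold a_Tp_def, intro ptime_intros ptime_a_T)

lemma ptime_a_base: "ptime f \<Longrightarrow> ptime (\<lambda>F v. a_base (f F v))"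
  unfolding a_base_def by (intro ptime_intros)

lemma ptime_a_S: "ptime f \<Longrightarrow> ptime (\<lambda>F v. a_S (f F v))"
  by (rule ptime_comp[rotated], assumption) (unfold a_S_def, intro ptime_intros ptime_a_Tp ptime_a_base)

lemma ptime_a_dead: "ptime f \<Longrightarrow> ptime (\<lambda>F v. a_dead F (f F v))"
  unfolding a_dead_def by (intro ptime_intros ptime_a_base)

lemma ptime_a_V: "ptime f \<Longrightarrow> ptime (\<lambda>F v. a_V F (f F v))"
  unfolding a_V_def by (intro ptime_intros ptime_a_dead)

lemma ptime_a_edges: "ptime f \<Longrightarrow> ptime (\<lambda>F v. a_edges F (f F v))"
  by (rule ptime_comp[rotated], assumption) (unfold a_edges_def, intro ptime_intros ptime_a_S ptime_a_dead)

lemma ptime_a_lab: "ptime f \<Longrightarrow> ptime g \<Longrightarrow> ptime (\<lambda>F v. a_lab F (f F v) (g F v))"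
  unfolding a_lab_def by (intro ptime_intros ptime_a_V ptime_a_edges)

lemma ptime_a_ex: "ptime f \<Longrightarrow> ptime g \<Longrightarrow> ptime (\<lambda>F v. a_ex F (f F v) (g F v))"
  by (rule ptime_lift2) (unfold a_ex_def, intro ptime_intros ptime_a_T)

lemma ptime_a_T1: "ptime f \<Longrightarrow> ptime (\<lambda>F v. a_T1 F (f F v))"
  by (rule ptime_comp[rotated], assumption) (unfold a_T1_def, intro ptime_intros ptime_a_ex ptime_a_T)

lemma ptime_a_T2: "ptime f \<Longrightarrow> ptime (\<lambda>F v. a_T2 F (f F v))"
  by (rule ptime_comp[rotated], assumption) (unfold a_T2_def, intro ptime_intros ptime_a_T1)

lemma ptime_a_T3: "ptime f \<Longrightarrow> ptime (\<lambda>F v. a_T3 F (f F v))"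
  by (rule ptime_comp[rotated], assumption) (unfold a_T3_def, intro ptime_intros ptime_a_ex ptime_a_T2)

lemma ptime_a_g: "ptime f \<Longrightarrow> ptime (\<lambda>F v. a_g F (f F v))"
  unfolding a_g_def by (intro ptime_intros ptime_a_T3)

lemma ptime_a_R: "ptime f \<Longrightarrow> ptime (\<lambda>F v. a_R F (f F v))"
  by (rule ptime_comp[rotated], assumption) (unfold a_R_def, intro ptime_intros ptime_a_S ptime_a_lab ptime_a_g)

lemma ptime_a_U: "ptime f \<Longrightarrow> ptime g \<Longrightarrow> ptime h \<Longrightarrow> ptime (\<lambda>F v. a_U F (f F v) (g F v) (h F v))"
  unfolding a_U_def by (intro ptime_intros ptime_a_lab ptime_a_dead)

lemma ptime_a_row: "ptime f \<Longrightarrow> ptime g \<Longrightarrow> ptime (\<lambda>F v. a_row F (f F v) (g F v))"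
  by (rule ptime_lift2) (unfold a_row_def, intro ptime_intros ptime_a_U ptime_a_g ptime_a_R)

lemma ptime_locator: "ptime locator"
proof -
  have "ptime (\<lambda>F v. locator F v)"
    unfolding locator_def by (intro ptime_intros ptime_a_R ptime_a_row ptime_a_lab ptime_a_V)
  then show ?thesis .
qed

section \<open>Trees that encode tuples\<close>

lemma tuple_data_simps [simp]:
  "tuple_data [] = Leaf" "tuple_data (c # x) = Node (Elem c) (tuple_data x)"
  by (auto simp: tuple_data_def)

lemma tuples_data_simps [simp]:
  "tuples_data [] = Leaf" "tuples_data (x # xs) = Node (tuple_data x) (tuples_data xs)"
  by (auto simp: tuples_data_def)

lemma items_tuple_data [simp]: "items (tuple_data x) = map Elem x"
  by (simp add: tuple_data_def)

lemma items_tuples_data [simp]: "items (tuples_data xs) = map tuple_data xs"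
  by (simp add: tuples_data_def)

lemma tuple_data_eq_Leaf [simp]: "tuple_data x = Leaf \<longleftrightarrow> x = []"
  by (cases x) auto

lemma tuples_data_eq_Leaf [simp]: "tuples_data xs = Leaf \<longleftrightarrow> xs = []"
  by (cases xs) auto

lemma drev_tuple [simp]: "drev (tuple_data x) = tuple_data (rev x)"
  by (simp add: drev_def tuple_data_def rev_map)

lemma drev_tuples [simp]: "drev (tuples_data xs) = tuples_data (rev xs)"
  by (simp add: drev_def tuples_data_def rev_map)

lemma dapp_tuple [simp]: "dapp (tuple_data x) (tuple_data y) = tuple_data (x @ y)"
  by (simp add: dapp_def tuple_data_def)

lemma dapp_list_data [simp]: "dapp (list_data us) (list_data ws) = list_data (us @ ws)"
  by (simp add: dapp_def)

lemma ddrop_tuple [simp]: "ddrop (tuple_data x) (tuple_data y) = tuple_data (drop (length x) y)"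
  by (simp add: tuple_data_def ddrop_list_data drop_map)

lemma ddrop_tuples [simp]: "ddrop (tuple_data x) (tuples_data ys) = tuples_data (drop (length x) ys)"
  by (simp add: tuple_data_def tuples_data_def ddrop_list_data drop_map)

lemma dbutlast_tuple [simp]: "dbutlast (tuple_data x) = tuple_data (butlast x)"
proof -
  have "dsnd (tuple_data y) = tuple_data (tl y)" for y :: "'a list" by (cases y) auto
  then show ?thesis by (simp add: dbutlast_def butlast_rev[symmetric])
qed

lemma doverlay_tuple [simp]: "doverlay (tuple_data x) (tuple_data y) = tuple_data (overlay x y)"
  by (simp add: doverlay_def overlay_def)

lemma dprefixes_tuple [simp]: "dprefixes (tuple_data u) = tuples_data (prefixes u)"
proof -
  \<comment> \<open>The fold uses its list only as a counter, so the induction is over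
    \<open>u\<close> with any list of that length.\<close>
  have "foldl (\<lambda>a x. Node (dbutlast (dfst a)) a) (Node (tuple_data u) r) xs =
    foldr Node (map tuple_data (prefixes u)) r" if "length xs = length u" for r and xs :: "'a data list"
    using that
  proof (induction u arbitrary: xs r rule: rev_induct)
    case Nil
    then show ?case by simp
  next
    case (snoc c u)
    then obtain x xs' where xs: "xs = x # xs'" "length xs' = length u" by (cases xs) auto
    show ?case using snoc.IH[OF xs(2)] by (simp add: xs(1))
  qed
  from this[of "map Elem u" Leaf] show ?thesis
    by (simp add: dprefixes_def tuples_data_def list_data_def)
qed

lemma dprefix_tuple [simp]: "dprefix F (tuple_data u) (tuple_data w) = Leaf \<longleftrightarrow> \<not> prefix u w"
proof -
  let ?s = "\<lambda>a x. if prim_sem F PEq (Node x (dfst (dsnd a))) \<noteq> Leaf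
     then Node Leaf (dsnd (dsnd a)) else Leaf"
  have 0: "foldl ?s Leaf xs = Leaf" for xs by (induction xs) (auto split: data.splits)
  have "foldl ?s (Node Leaf (tuple_data w)) (map Elem u) = Leaf \<longleftrightarrow> \<not> prefix u w"
  proof (induction u arbitrary: w)
    case (Cons c u)
    then show ?case
    proof (cases w)
      case (Cons d w')
      then show ?thesis using Cons.IH[of w'] 0 by (simp add: truth_def)
    qed (use 0 in simp)
  qed simp
  then show ?thesis by (simp add: dprefix_def)
qed

lemma deq_tuple [simp]: "deq F (tuple_data x) (tuple_data y) = Leaf \<longleftrightarrow> x \<noteq> y"
  by (auto simp: deq_def)

lemma dnot_eq_Leaf [simp]: "dnot u = Leaf \<longleftrightarrow> u \<noteq> Leaf"
  by (simp add: dnot_def)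

lemma dfilter_tuples:
  assumes "\<And>x. x \<in> set xs \<Longrightarrow> f (tuple_data x) = Leaf \<longleftrightarrow> \<not> P x"
  shows "dfilter f (tuples_data xs) = tuples_data (filter P xs)"
  using assms by (simp add: dfilter_def tuples_data_def filter_map comp_def cong: filter_cong)

lemma dfilter_tuple:
  assumes "\<And>c. c \<in> set x \<Longrightarrow> f (Elem c) = Leaf \<longleftrightarrow> \<not> P c"
  shows "dfilter f (tuple_data x) = tuple_data (filter P x)"
  using assms by (simp add: dfilter_def tuple_data_def filter_map comp_def cong: filter_cong)

lemma dmap_tuples:
  assumes "\<And>x. x \<in> set xs \<Longrightarrow> f (tuple_data x) = tuple_data (g x)"
  shows "dmap f (tuples_data xs) = tuples_data (map g xs)"
  using assms by (simp add: dmap_def tuples_data_def cong: map_cong)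

lemma dmap_tuples_list_data: "dmap f (tuples_data xs) = list_data (map (\<lambda>x. f (tuple_data x)) xs)"
  by (simp add: dmap_def comp_def)

lemma dcmap_tuples:
  assumes "\<And>x. x \<in> set xs \<Longrightarrow> f (tuple_data x) = tuples_data (g x)"
  shows "dcmap f (tuples_data xs) = tuples_data (concat (map g xs))"
proof -
  have "map (\<lambda>x. items (f (tuple_data x))) xs = map (\<lambda>x. map tuple_data (g x)) xs"
    using assms by (intro map_cong) auto
  then have "concat (map (\<lambda>x. items (f (tuple_data x))) xs) = concat (map (\<lambda>x. map tuple_data (g x)) xs)"
    by (simp only:)
  then show ?thesis by (simp only: dcmap_def tuples_data_def items_list_data map_map comp_def map_concat)
qed

lemma dmem_tuples [simp]: "dmem F (tuple_data x) (tuples_data xs) = Leaf \<longleftrightarrow> x \<notin> set xs"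
proof -
  have "dmem F (tuple_data x) (tuples_data xs) = tuples_data (filter (\<lambda>y. x = y) xs)"
    unfolding dmem_def by (rule dfilter_tuples) simp
  then show ?thesis by (auto simp: filter_empty_conv)
qed

lemma dremdups_tuples:
  "\<exists>ys. dremdups F (tuples_data xs) = tuples_data ys \<and> distinct ys \<and> set ys = set xs"
proof -
  let ?s = "\<lambda>a x. if dmem F x a \<noteq> Leaf then a else Node x a"
  have "\<exists>ys. foldl ?s (tuples_data as) (map tuple_data xs) = tuples_data ys \<and> distinct ys \<and>
    set ys = set as \<union> set xs" if "distinct as" for as
    using that
  proof (induction xs arbitrary: as)
    case (Cons x xs)
    show ?case
    proof (cases "x \<in> set as")
      case True
      then show ?thesis using Cons.IH[OF Cons.prems] by auto
    next
      case False
      then show ?thesis using Cons.IH[of "x # as"] Cons.prems by auto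
    qed
  qed auto
  from this[of "[]"] show ?thesis by (simp add: dremdups_def)
qed

lemma dcls_tuple [simp]: "dcls F (tuples_data qs) (tuple_data a) = tuple_data (cls (set qs) a)"
proof -
  have "dfilter (\<lambda>p. dmem F p (tuples_data qs)) (tuples_data (rev (prefixes a))) =
    tuples_data (filter (\<lambda>x. x \<in> set qs) (rev (prefixes a)))"
    by (rule dfilter_tuples) simp
  then have "dcls F (tuples_data qs) (tuple_data a) =
    dfst (tuples_data (filter (\<lambda>x. x \<in> set qs) (rev (prefixes a))))"
    by (simp only: dcls_def dprefixes_tuple drev_tuples)
  then show ?thesis
    by (cases "filter (\<lambda>x. x \<in> set qs) (rev (prefixes a))") (simp_all add: cls_def)
qed

section \<open>Merging labels along edges\<close>

definition relabel :: "('a \<Rightarrow> 'a) \<Rightarrow> 'a \<times> 'a \<Rightarrow> 'a \<Rightarrow> 'a" where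
  "relabel l e z = (if l z = l (snd e) then l (fst e) else l z)"

lemma relabel_cong: "l x = l y \<Longrightarrow> relabel l e x = relabel l e y"
  by (simp add: relabel_def)

lemma relabel_edge: "relabel l (x, y) x = relabel l (x, y) y"
  by (simp add: relabel_def)

text \<open>A merge acts on labels and not on vertices, so labels that have become equal stay
  equal.\<close>

lemma foldl_relabel_edge: "(x, y) \<in> set E \<Longrightarrow> foldl relabel l E x = foldl relabel l E y"
proof (induction E rule: rev_induct)
  case (snoc e E)
  show ?case
  proof (cases "(x, y) = e")
    case True
    have "relabel k e x = relabel k e y" for k unfolding True[symmetric] by (rule relabel_edge)
    then show ?thesis by simp
  next
    case False
    then have "foldl relabel l E x = foldl relabel l E y" using snoc by simp
    from relabel_cong[of "foldl relabel l E", OF this, of e] show ?thesis by simp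
  qed
qed simp

text \<open>A merge joins only the labels of two related vertices, so each vertex stays related to
  its label: merging is never too coarse, just as \<open>foldl_relabel_edge\<close> shows that it is
  never too fine.\<close>

lemma foldl_relabel_equivp:
  assumes "equivp R" "\<And>x y. (x, y) \<in> set E \<Longrightarrow> R x y" "\<And>z. R z (l z)"
  shows "R z (foldl relabel l E z)"
  using assms(2)
proof (induction E arbitrary: z rule: rev_induct)
  case Nil
  then show ?case using assms(3) by simp
next
  case (snoc e E)
  let ?l = "foldl relabel l E"
  have IH: "R z (?l z)" for z using snoc by auto
  have "R (fst e) (snd e)" using snoc.prems[of "fst e" "snd e"] by simp
  \<comment> \<open>The chain runs from \<open>z\<close> to its label, which is that of
    \<open>snd e\<close>, then to \<open>snd e\<close>, to \<open>fst e\<close> and to the label of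
    \<open>fst e\<close>.\<close>
  then have "R z (?l (fst e))" if "?l z = ?l (snd e)"
    using IH[of z] IH[of "fst e"] IH[of "snd e"] that assms(1)
    by (metis equivp_symp equivp_transp)
  then show ?case using IH by (simp add: relabel_def[of ?l])
qed

definition label_data :: "('u list \<Rightarrow> 'u list) \<Rightarrow> 'u list list \<Rightarrow> 'u data" where
  "label_data l V = list_data (map (\<lambda>x. Node (tuple_data x) (tuple_data (l x))) V)"

lemma dlookup_label_data:
  assumes "x \<in> set V"
  shows "dlookup F (tuple_data x) (label_data l V) = tuple_data (l x)"
proof -
  have "dfilter (\<lambda>e. deq F (dfst e) (tuple_data x)) (label_data l V) =
    list_data (map (\<lambda>x. Node (tuple_data x) (tuple_data (l x))) (filter (\<lambda>y. y = x) V))"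
    by (simp add: dfilter_def label_data_def filter_map comp_def)
  moreover have "filter (\<lambda>y. y = x) V \<noteq> []" using assms by (auto simp: filter_empty_conv)
  moreover have "hd (filter (\<lambda>y. y = x) V) = x"
    using hd_in_set[OF calculation(2)] by simp
  ultimately show ?thesis
    by (cases "filter (\<lambda>y. y = x) V") (auto simp: dlookup_def)
qed

lemma dmerge_label_data:
  assumes "x \<in> set V" "y \<in> set V"
  shows "dmerge F (label_data l V) (Node (tuple_data x) (tuple_data y)) = label_data (relabel l (x, y)) V"
proof -
  have g: "(if deq F (tuple_data (l z)) (tuple_data (l y)) \<noteq> Leaf then tuple_data (l x) else tuple_data (l z)) =
    tuple_data (relabel l (x, y) z)" for z
    by (simp add: relabel_def)
  show ?thesis
    unfolding dmerge_def dfst.simps dsnd.simps assms[THEN dlookup_label_data]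
    unfolding dmap_def label_data_def items_list_data map_map comp_def dfst.simps dsnd.simps g ..
qed

lemma dlabels_label_data:
  assumes "\<And>x y. (x, y) \<in> set E \<Longrightarrow> x \<in> set V \<and> y \<in> set V"
  shows "dlabels F (label_data l V) (list_data (map (\<lambda>(x, y). Node (tuple_data x) (tuple_data y)) E)) =
    label_data (foldl relabel l E) V"
  using assms
proof (induction E rule: rev_induct)
  case Nil
  then show ?case by (simp add: dlabels_def)
next
  case (snoc e E)
  obtain x y where e: "e = (x, y)" by (cases e)
  have "x \<in> set V" "y \<in> set V" using snoc.prems[of x y] e by auto
  moreover have "dlabels F (label_data l V) (list_data (map (\<lambda>(x, y). Node (tuple_data x) (tuple_data y)) E)) =
    label_data (foldl relabel l E) V"
    using snoc.prems by (intro snoc.IH) auto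
  ultimately show ?case by (simp add: e dlabels_def dmerge_label_data)
qed

lemma dmap_tuples_elems:
  assumes "\<And>x. x \<in> set xs \<Longrightarrow> f (tuple_data x) = Elem (h x)"
  shows "dmap f (tuples_data xs) = tuple_data (map h xs)"
  using assms by (simp add: dmap_tuples_list_data tuple_data_def cong: map_cong)

section \<open>Intermediate results of the locator as lists of tuples\<close>

locale locator_input = field F + query L "set qs"
  for F :: "'a ring" (structure) and L :: "'a list list" and qs :: "'a list list"
begin

abbreviation "dead \<equiv> \<zero> # base"

sublocale sym_enc F L "set qs" dead
  by unfold_locales (simp add: base_def)

abbreviation "I \<equiv> set qs"

definition inp :: "'a data" where
  "inp = Node (tuples_data L) (tuples_data qs)"

text \<open>At depth \<open>m\<close> no alphabet is left, and the program reads
  \<open>Leaf\<close>; the empty list matches this.\<close>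

definition letters :: "'a list \<Rightarrow> 'a list" where
  "letters p = (if length p < m then L ! length p else [])"

definition Tl :: "'a list list" where
  "Tl = concat (map prefixes ([] # qs))"

definition Tpl :: "'a list list" where
  "Tpl = [] # concat (map (\<lambda>p. map (\<lambda>c. p @ [c]) (letters p)) Tl)"

definition Sl :: "'a list list" where
  "Sl = concat (map (\<lambda>u. concat (map (\<lambda>x. map (\<lambda>y.
     graft (overlay u (rev base)) x y) Tpl) Tpl)) (prefixes base))"

definition V :: "'a list list" where
  "V = dead # [] # qs"

definition El :: "('a list \<times> 'a list) list" where
  "El = map (\<lambda>s. (cls I s, cls I (rev s))) Sl @
     (if \<one> \<oplus> \<one> = \<zero> then map (\<lambda>s. (cls I s, dead)) (filter (\<lambda>s. rev s = s) Sl) else []) @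
     (if [] \<in> I then [] else [([], dead)])"

definition lab :: "'a list \<Rightarrow> 'a list" where
  "lab = foldl relabel (\<lambda>x. x) El"

definition exl :: "'a list \<Rightarrow> 'a list" where
  "exl p = filter (\<lambda>c. p @ [c] \<notin> T) (letters p)"

definition T1l :: "'a list list" where
  "T1l = filter (\<lambda>p. exl p \<noteq> []) Tl"

definition T2l :: "'a list list" where
  "T2l = filter (\<lambda>p. \<forall>q\<in>set T1l. length p \<le> length q) T1l"

definition T3l :: "'a list list" where
  "T3l = filter (\<lambda>p. \<forall>q\<in>set T2l. length (exl q) \<le> length (exl p)) T2l"

definition root :: "'a list" where
  "root = (case T3l of [] \<Rightarrow> [] | p # _ \<Rightarrow> p)"

definition g :: "'a list" where
  "g = cls I root"

lemma dfst_inp [simp]: "dfst inp = tuples_data L" and dsnd_inp [simp]: "dsnd inp = tuples_data qs"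
  by (auto simp: inp_def)

lemma dfst_tuples: "dfst (tuples_data xs) = tuple_data (case xs of [] \<Rightarrow> [] | x # _ \<Rightarrow> x)"
  by (cases xs) auto

lemma dletters: "dfst (ddrop (tuple_data p) (tuples_data L)) = tuple_data (letters p)"
proof (cases "length p < m")
  case True
  then show ?thesis by (simp add: letters_def Cons_nth_drop_Suc[symmetric])
qed (simp add: letters_def)

lemma a_T_inp: "a_T inp = tuples_data Tl"
proof -
  have "a_T inp = dcmap dprefixes (tuples_data ([] # qs))" by (simp add: a_T_def)
  then show ?thesis by (simp only: Tl_def dcmap_tuples[of "[] # qs" dprefixes prefixes, OF dprefixes_tuple])
qed

lemma set_Tl: "set Tl = T"
  by (auto simp: Tl_def T_def)

lemma dsnoc: "dapp (tuple_data p) (Node (Elem c) Leaf) = tuple_data (p @ [c])"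
  using dapp_tuple[of p "[c]"] by simp

lemma a_Tp_inp: "a_Tp inp = tuples_data Tpl"
proof -
  have "dmap (\<lambda>c. dapp (tuple_data p) (Node c Leaf)) (tuple_data x) = tuples_data (map (\<lambda>c. p @ [c]) x)"
    for p x :: "'a list"
    by (simp add: dmap_def tuples_data_def comp_def dsnoc)
  then have "dcmap (\<lambda>p. dmap (\<lambda>c. dapp p (Node c Leaf)) (dfst (ddrop p (dfst inp)))) (tuples_data Tl) =
    tuples_data (concat (map (\<lambda>p. map (\<lambda>c. p @ [c]) (letters p)) Tl))"
    by (intro dcmap_tuples) (simp only: dfst_inp dletters)
  then show ?thesis by (simp add: a_Tp_def a_T_inp Tpl_def)
qed

lemma set_Tpl: "set Tpl = Tp"
  by (auto simp: Tpl_def Tp_def set_Tl letters_def split: if_splits)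

lemma a_base_inp: "a_base inp = tuple_data base"
proof -
  have "dfst (tuple_data x) = Elem (hd x)" if "x \<in> set L" for x
    using nonempty that by (cases x) (auto simp: in_set_conv_nth)
  then have "map (\<lambda>x. dfst (tuple_data x)) L = map (\<lambda>x. Elem (hd x)) L" by (intro map_cong) auto
  then show ?thesis
    by (simp only: a_base_def dfst_inp dmap_tuples_list_data tuple_data_def base_def map_map comp_def)
qed

lemma a_S_inp: "a_S inp = tuples_data Sl"
  unfolding a_S_def a_base_inp a_Tp_inp Sl_def dprefixes_tuple
  by (intro dcmap_tuples dmap_tuples) (simp add: graft_def)

lemma set_Sl: "set Sl = S"
proof -
  have "set Sl = (\<Union>u\<in>{u. prefix u base}. \<Union>x\<in>Tp. graft (overlay u (rev base)) x ` Tp)"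
    by (simp add: Sl_def set_Tpl set_prefixes_eq)
  then show ?thesis unfolding S_def by blast
qed

lemma a_dead_inp: "a_dead F inp = tuple_data dead"
  by (simp add: a_dead_def a_base_inp)

lemma a_V_inp: "a_V F inp = tuples_data V"
  by (simp add: a_V_def a_dead_inp V_def)

lemma cls_V: "cls I a \<in> set V"
  using cls_in[of I a] by (auto simp: V_def)

lemma El_V: "(x, y) \<in> set El \<Longrightarrow> x \<in> set V \<and> y \<in> set V"
  using cls_V by (auto simp: El_def V_def split: if_splits)

lemma a_edges_inp:
  "a_edges F inp = list_data (map (\<lambda>(x, y). Node (tuple_data x) (tuple_data y)) El)"
proof -
  let ?enc = "\<lambda>E. list_data (map (\<lambda>(x, y). Node (tuple_data x) (tuple_data y)) E)"
  have 1: "dmap (\<lambda>s. Node (dcls F (tuples_data qs) s) (dcls F (tuples_data qs) (drev s))) (tuples_data Sl) =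
    ?enc (map (\<lambda>s. (cls I s, cls I (rev s))) Sl)"
    by (simp add: dmap_tuples_list_data comp_def)
  have "dfilter (\<lambda>s. deq F (drev s) s) (tuples_data Sl) = tuples_data (filter (\<lambda>s. rev s = s) Sl)"
    by (rule dfilter_tuples) simp
  then have 2: "dmap (\<lambda>s. Node (dcls F (tuples_data qs) s) (tuple_data dead))
      (dfilter (\<lambda>s. deq F (drev s) s) (tuples_data Sl)) =
    ?enc (map (\<lambda>s. (cls I s, dead)) (filter (\<lambda>s. rev s = s) Sl))"
    by (simp add: dmap_tuples_list_data comp_def)
  have 3: "dmem F Leaf (tuples_data qs) = Leaf \<longleftrightarrow> [] \<notin> I"
    using dmem_tuples[of F "[]" qs] by simp
  have two: "prim_sem F PEq (Node (prim_sem F PAdd (Node (Elem \<one>) (Elem \<one>))) (Elem \<zero>)) \<noteq> Leaf \<longleftrightarrow>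
    \<one> \<oplus> \<one> = \<zero>" by (simp add: truth_def)
  have c: "(if \<one> \<oplus> \<one> = \<zero> then ?enc E else Leaf) = ?enc (if \<one> \<oplus> \<one> = \<zero> then E else [])" for E
    by simp
  have n: "(if dmem F Leaf (tuples_data qs) \<noteq> Leaf then Leaf else Node (Node Leaf (tuple_data dead)) Leaf) =
    ?enc (if [] \<in> I then [] else [([], dead)])"
    using 3 by auto
  show ?thesis
    unfolding a_edges_def dsnd_inp a_S_inp a_dead_inp 1 2 two c n dapp_list_data El_def map_append ..
qed

lemma a_lab_inp:
  assumes "x \<in> set V"
  shows "a_lab F inp (tuple_data x) = tuple_data (lab x)"
proof -
  have "dmap (\<lambda>x. Node x x) (tuples_data V) = label_data (\<lambda>x. x) V"
    by (simp add: dmap_tuples_list_data label_data_def)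
  then show ?thesis
    unfolding a_lab_def a_V_inp a_edges_inp lab_def
    using dlabels_label_data[OF El_V, of _ F "\<lambda>x. x"] dlookup_label_data[OF assms] by simp
qed

lemma a_ex_inp: "a_ex F inp (tuple_data p) = tuple_data (exl p)"
  unfolding a_ex_def dfst_inp dletters a_T_inp exl_def
  by (rule dfilter_tuple) (simp add: dsnoc set_Tl)

lemma a_T1_inp: "a_T1 F inp = tuples_data T1l"
  unfolding a_T1_def a_T_inp T1l_def by (rule dfilter_tuples) (simp add: a_ex_inp)

lemma a_T2_inp: "a_T2 F inp = tuples_data T2l"
  unfolding a_T2_def a_T1_inp T2l_def
proof (rule dfilter_tuples)
  fix p
  have "dfilter (\<lambda>q. ddrop q (tuple_data p)) (tuples_data T1l) =
    tuples_data (filter (\<lambda>q. \<not> length p \<le> length q) T1l)"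
    by (rule dfilter_tuples) simp
  then show "dnot (dfilter (\<lambda>q. ddrop q (tuple_data p)) (tuples_data T1l)) = Leaf \<longleftrightarrow>
    \<not> (\<forall>q\<in>set T1l. length p \<le> length q)"
    by (simp add: filter_empty_conv)
qed

lemma a_T3_inp: "a_T3 F inp = tuples_data T3l"
  unfolding a_T3_def a_T2_inp T3l_def
proof (rule dfilter_tuples)
  fix p
  have "dfilter (\<lambda>q. ddrop (a_ex F inp (tuple_data p)) (a_ex F inp q)) (tuples_data T2l) =
    tuples_data (filter (\<lambda>q. \<not> length (exl q) \<le> length (exl p)) T2l)"
    by (rule dfilter_tuples) (simp add: a_ex_inp)
  then show "dnot (dfilter (\<lambda>q. ddrop (a_ex F inp (tuple_data p)) (a_ex F inp q)) (tuples_data T2l)) = Leaf \<longleftrightarrow>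
    \<not> (\<forall>q\<in>set T2l. length (exl q) \<le> length (exl p))"
    by (simp add: filter_empty_conv)
qed

lemma a_g_inp: "a_g F inp = tuple_data g"
  by (simp add: a_g_def a_T3_inp dfst_tuples g_def root_def)

lemma g_V: "g \<in> set V"
  by (simp add: g_def cls_V)

section \<open>Correctness of the root, the labels and the output\<close>

lemma set_exl: "set (exl p) = ex p"
  by (auto simp: exl_def letters_def ex_def)

lemma length_exl: "length (exl p) = card (ex p)"
proof -
  have "distinct (exl p)" using dist by (auto simp: exl_def letters_def)
  then show ?thesis using distinct_card set_exl by metis
qed

lemma set_T1l: "set T1l = T1"
proof -
  have "exl p = [] \<longleftrightarrow> ex p = {}" for p unfolding set_exl[symmetric] by simp
  then show ?thesis by (simp add: T1l_def T1_def set_Tl)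
qed

lemma optimal_root: "optimal_exit root"
proof (cases "T1 = {}")
  case True
  then have "T1l = []" using set_T1l by simp
  then have "root = []" by (simp add: root_def T3l_def T2l_def)
  then show ?thesis using True by (simp add: optimal_exit_def)
next
  case False
  then obtain p0 where "p0 \<in> T1" by blast
  then obtain p where "p \<in> T1" "\<And>q. q \<in> T1 \<Longrightarrow> length p \<le> length q"
    using ex_has_least_nat[of "\<lambda>p. p \<in> T1" p0 length] by blast
  then have ne: "set T2l \<noteq> {}" by (auto simp: T2l_def set_T1l)
  let ?M = "Max ((\<lambda>p. length (exl p)) ` set T2l)"
  have "?M \<in> (\<lambda>p. length (exl p)) ` set T2l" using ne by (intro Max_in) auto
  then obtain q where q: "q \<in> set T2l" "length (exl q) = ?M" by auto
  have "length (exl r) \<le> length (exl q)" if "r \<in> set T2l" for r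
    unfolding q(2) using that by (intro Max_ge) auto
  then have "q \<in> set T3l" using q(1) by (simp add: T3l_def)
  then have "root \<in> set T3l" by (cases T3l) (auto simp: root_def)
  then have r: "root \<in> set T2l" "\<And>q. q \<in> set T2l \<Longrightarrow> length (exl q) \<le> length (exl root)"
    by (auto simp: T3l_def)
  then have r1: "root \<in> T1" "\<And>q. q \<in> T1 \<Longrightarrow> length root \<le> length q"
    by (auto simp: T2l_def set_T1l)
  have "card (ex q) \<le> card (ex root)" if "q \<in> T1" "length q = length root" for q
  proof -
    have "q \<in> set T2l" using that r1 by (simp add: T2l_def set_T1l)
    then show ?thesis using r(2) by (simp add: length_exl)
  qed
  then show ?thesis using False r1 by (simp add: optimal_exit_def)
qed

lemma lab_edge: "(x, y) \<in> set El \<Longrightarrow> lab x = lab y"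
  unfolding lab_def by (rule foldl_relabel_edge)

text \<open>Edges are drawn only for elements of \<open>S\<close>, but every full tuple shares its
  class and that of its reversal with one of them.\<close>

lemma lab_sym:
  assumes "a \<in> full"
  shows "lab (cls I a) = lab (cls I (rev a))"
proof -
  obtain s where s: "s \<in> S" "cls I s = cls I a" "cls I (rev s) = cls I (rev a)"
    using S_represents[OF assms] by blast
  have "(cls I s, cls I (rev s)) \<in> (\<lambda>s. (cls I s, cls I (rev s))) ` S"
    using s(1) by (rule imageI)
  then have "(cls I s, cls I (rev s)) \<in> set El" by (simp add: El_def set_Sl)
  then show ?thesis using lab_edge s by metis
qed

lemma lab_pal:
  assumes "a \<in> full" "rev a = a" "\<one> \<oplus> \<one> = \<zero>"
  shows "lab (cls I a) = lab dead"
proof -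
  obtain s where s: "s \<in> S" "cls I s = cls I a" "rev s = s"
    using S_represents[OF assms(1)] assms(2) by blast
  then have "(cls I s, dead) \<in> (\<lambda>s. (cls I s, dead)) ` {s \<in> S. rev s = s}"
    by (intro image_eqI[of _ _ s]) auto
  then have "(cls I s, dead) \<in> set El" using assms(3) by (simp add: El_def set_Sl)
  then show ?thesis using lab_edge s by metis
qed

lemma lab_Nil: "[] \<notin> I \<Longrightarrow> lab [] = lab dead"
  by (rule lab_edge) (simp add: El_def)

lemma lab_flow: "flow_equiv y (lab y)"
  unfolding lab_def
proof (rule foldl_relabel_equivp[OF equivp_flow_equiv _ flow_equiv_refl])
  fix x y assume "(x, y) \<in> set El"
  then show "flow_equiv x y"
    using flow_equiv_reverse flow_equiv_palindrome flow_equiv_Nil S_full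
    by (auto simp: El_def set_Sl split: if_splits)
qed

definition N :: "'a list set" where
  "N = {a \<in> full. lab (cls I a) \<noteq> lab g}"

text \<open>For \<open>m = 0\<close> the empty tuple is both \<bottom> and the only full tuple; it
  then lies in the class of the root, so the column of \<bottom> never collides with another
  one.\<close>

lemma Nil_N: "[] \<notin> N"
proof
  assume n: "[] \<in> N"
  then have "m = 0" using fullD(1)[of "[]"] by (simp add: N_def)
  then have "ex p = {}" for p unfolding ex_def by simp
  then have "root = []" using optimal_root by (simp add: optimal_exit_def T1_def)
  then show False using n by (simp add: N_def g_def)
qed

lemma card_N: "card N \<le> card I ^ 2 * m ^ 2"
  unfolding N_def g_def by (rule card_outsiders[OF lab_sym optimal_root])

text \<open>Filtering \<open>S\<close> loses nothing: every full tuple outside the component of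
  \<open>g\<close> belongs to \<open>S\<close>.\<close>

lemma a_R_inp: "\<exists>rs. a_R F inp = tuples_data rs \<and> distinct rs \<and> set rs = N"
proof -
  have "dfilter (\<lambda>s. dnot (deq F (a_lab F inp (dcls F (dsnd inp) s)) (a_lab F inp (a_g F inp)))) (a_S inp) =
    tuples_data (filter (\<lambda>s. lab (cls I s) \<noteq> lab g) Sl)"
    unfolding a_S_inp a_g_inp dsnd_inp
    by (rule dfilter_tuples) (simp add: a_lab_inp cls_V g_V)
  moreover have "set (filter (\<lambda>s. lab (cls I s) \<noteq> lab g) Sl) = N"
    using S_full outsiders_in_S[OF lab_sym optimal_root] by (auto simp: N_def set_Sl g_def)
  ultimately show ?thesis
    unfolding a_R_def using dremdups_tuples[of F "filter (\<lambda>s. lab (cls I s) \<noteq> lab g) Sl"] by simp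
qed

lemma a_U_inp: "x \<in> set V \<Longrightarrow> a_U F inp (tuple_data l) (tuple_data x) = Elem (cind lab l x)"
proof -
  have "dead \<in> set V" by (simp add: V_def)
  note d = a_lab_inp[OF this]
  show "x \<in> set V \<Longrightarrow> a_U F inp (tuple_data l) (tuple_data x) = Elem (cind lab l x)"
    unfolding a_U_def a_dead_inp d by (simp add: a_lab_inp cind_def)
qed

lemma a_row_inp:
  assumes rs: "a_R F inp = tuples_data rs" "[] \<notin> set rs"
  shows "a_row F inp (tuple_data l) = tuple_data (map (Zrow lab g l) (map Inl ([] # rs) @ map Inr qs))"
proof -
  let ?U = "\<lambda>x. cind lab l x"
  have U: "a_U F inp (tuple_data l) (tuple_data x) = Elem (?U x)" if "x \<in> set V" for x
    using a_U_inp[OF that] .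
  have U0: "a_U F inp (tuple_data l) Leaf = Elem (?U [])"
    using U[of "[]"] by (simp add: V_def)
  have 1: "dmap (\<lambda>a. prim_sem F PAdd (Node (a_U F inp (tuple_data l) (tuple_data g))
      (prim_sem F PNeg (a_U F inp (tuple_data l) (dcls F (tuples_data qs) a))))) (tuples_data rs) =
    tuple_data (map (Zrow lab g l) (map Inl rs))"
    unfolding map_map using rs(2) by (intro dmap_tuples_elems) (auto simp: U g_V cls_V Zrow_def)
  have 2: "dmap (\<lambda>x. if x \<noteq> Leaf then prim_sem F PAdd (Node (a_U F inp (tuple_data l) x)
      (prim_sem F PNeg (a_U F inp (tuple_data l) (dcls F (tuples_data qs) (dbutlast x)))))
      else a_U F inp (tuple_data l) x) (tuples_data qs) =
    tuple_data (map (Zrow lab g l) (map Inr qs))"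
    unfolding map_map
  proof (rule dmap_tuples_elems)
    fix x assume "x \<in> set qs"
    then have "x \<in> set V" by (simp add: V_def)
    then show "(if tuple_data x \<noteq> Leaf then prim_sem F PAdd (Node (a_U F inp (tuple_data l) (tuple_data x))
        (prim_sem F PNeg (a_U F inp (tuple_data l) (dcls F (tuples_data qs) (dbutlast (tuple_data x))))))
        else a_U F inp (tuple_data l) (tuple_data x)) = Elem ((Zrow lab g l \<circ> Inr) x)"
      using U0 by (simp add: U cls_V Zrow_def zc_def)
  qed
  have 3: "prim_sem F PNeg (a_U F inp (tuple_data l) (tuple_data g)) = Elem (Zrow lab g l (Inl []))"
    by (simp add: U g_V Zrow_def)
  show ?thesis
    unfolding a_row_def a_g_inp rs(1) dsnd_inp 1 2 3 dapp_tuple by simp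
qed

lemma locator_inp:
  "\<exists>rs. locator F inp = Node (tuples_data ([] # rs))
      (matrix_data (length V) (\<lambda>j. Zrow lab g (lab (V ! j))) (map Inl ([] # rs) @ map Inr qs)) \<and>
    distinct ([] # rs) \<and> set rs = N"
proof -
  obtain rs where rs: "a_R F inp = tuples_data rs" "distinct rs" "set rs = N" using a_R_inp by blast
  have n: "[] \<notin> set rs" using rs(3) Nil_N by simp
  let ?cs = "map Inl ([] # rs) @ map Inr qs"
  have "dmap (\<lambda>x. a_row F inp (a_lab F inp x)) (tuples_data V) =
    tuples_data (map (\<lambda>x. map (Zrow lab g (lab x)) ?cs) V)"
    by (rule dmap_tuples) (simp only: a_lab_inp a_row_inp[OF rs(1) n])
  also have "map (\<lambda>x. map (Zrow lab g (lab x)) ?cs) V =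
    map (\<lambda>j. map (Zrow lab g (lab (V ! j))) ?cs) [0..<length V]"
    by (rule nth_equalityI) auto
  finally have "dmap (\<lambda>x. a_row F inp (a_lab F inp x)) (tuples_data V) =
    matrix_data (length V) (\<lambda>j. Zrow lab g (lab (V ! j))) ?cs"
    by (simp only: matrix_data_def)
  then have "locator F inp = Node (tuples_data ([] # rs))
      (matrix_data (length V) (\<lambda>j. Zrow lab g (lab (V ! j))) ?cs)"
    by (simp add: locator_def a_V_inp rs(1))
  then show ?thesis using rs n by auto
qed

lemma locates_N:
  assumes "f \<in> (full \<union> {[]}) \<rightarrow>\<^sub>E carrier F" "f [] = (\<Oplus>a\<in>full. f a)" "\<beta> \<in> I \<rightarrow>\<^sub>E carrier F"
  shows "restrict (case_sum f \<beta>) (insert [] N <+> I) \<in>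
      kernel_on F (length V) (insert [] N <+> I) (\<lambda>j. Zrow lab g (lab (V ! j))) \<longleftrightarrow>
    (\<exists>G\<in>anti. \<forall>x\<in>I. psum (\<lambda>a. f a \<oplus> G a) x = \<beta> x)"
  using assms by (intro locates lab_sym lab_pal lab_Nil lab_flow Nil_N) (auto simp: V_def N_def)

end

section \<open>Tuples over the given sets\<close>

lemma listset_nth: "listset As = {y. length y = length As \<and> (\<forall>k<length As. y ! k \<in> As ! k)}"
proof (induction As)
  case (Cons B As)
  show ?case
  proof (rule Set.set_eqI)
    fix y
    show "y \<in> listset (B # As) \<longleftrightarrow>
      y \<in> {y. length y = length (B # As) \<and> (\<forall>k<length (B # As). y ! k \<in> (B # As) ! k)}"
      by (cases y) (auto simp: set_Cons_def Cons All_less_Suc2)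
  qed
qed simp

lemma prod_sets_nth:
  "prod_sets A i j = {y. length y = j - i \<and> (\<forall>k<j - i. y ! k \<in> A (Suc (i + k)))}"
  unfolding prod_sets_def listset_nth by (auto simp del: upt_Suc)

lemma full_tuples_nth: "full_tuples A m = {y. length y = m \<and> (\<forall>k<m. y ! k \<in> A (Suc k))}"
  by (simp add: full_tuples_def prod_sets_nth)

lemma partial_tuples_nth:
  "partial_tuples A m = {y. length y \<le> m \<and> (\<forall>k<length y. y ! k \<in> A (Suc k))}"
  by (auto simp: partial_tuples_def prod_sets_nth)

section \<open>The encoding in terms of prefix sums\<close>

locale instance_input = locator_input F L qs
  for F :: "'a ring" (structure) and L :: "'a list list" and qs :: "'a list list" +
  fixes A :: "nat \<Rightarrow> 'a set"
  assumes A: "\<And>i. i < m \<Longrightarrow> set (L ! i) = A (Suc i)"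
    and fin_carrier: "finite (carrier F)"
begin

lemma full_tuples_eq: "full_tuples A m = full"
  using A by (auto simp: full_tuples_nth full_def part_def)

lemma partial_tuples_eq: "partial_tuples A m = part"
  using A by (auto simp: partial_tuples_nth part_def)

lemma AntiSym_eq: "AntiSym F A m = anti"
  by (simp add: AntiSym_def anti_def full_tuples_eq)

text \<open>The support is everything because the space is finite, by finiteness of the field, and
  contains the zero function.\<close>

lemma set_pmf_AntiSym: "set_pmf (pmf_of_set (AntiSym F A m)) = anti"
proof -
  have "finite (full \<rightarrow>\<^sub>E carrier F)" using finite_full fin_carrier by (intro finite_PiE) auto
  then have "finite anti" by (rule finite_subset[rotated]) (auto simp: anti_def)
  moreover have "restrict (\<lambda>_. \<zero>) full \<in> anti" by (intro antiI) auto
  ultimately show ?thesis unfolding AntiSym_eq by (intro set_pmf_of_set) auto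
qed

lemma prefix_full_image:
  assumes "x \<in> part"
  shows "{a \<in> full. prefix x a} = (@) x ` prod_sets A (length x) m"
proof (intro Set.set_eqI iffI)
  fix a assume "a \<in> {a \<in> full. prefix x a}"
  then obtain y where y: "a = x @ y" "a \<in> full" by (auto elim: prefixE)
  have "y ! k \<in> A (Suc (length x + k))" if "k < m - length x" for k
    using fullD[OF y(2)] A[of "length x + k"] that y(1)
    by (metis add.commute less_diff_conv nth_append_length_plus)
  then have "y \<in> prod_sets A (length x) m"
    using fullD(1)[OF y(2)] y(1) by (auto simp: prod_sets_nth)
  then show "a \<in> (@) x ` prod_sets A (length x) m" using y(1) by blast
next
  fix a assume "a \<in> (@) x ` prod_sets A (length x) m"
  then obtain y where y: "a = x @ y" "length y = m - length x"
    "\<And>k. k < m - length x \<Longrightarrow> y ! k \<in> A (Suc (length x + k))"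
    by (auto simp: prod_sets_nth)
  have x: "length x \<le> m" "\<And>i. i < length x \<Longrightarrow> x ! i \<in> set (L ! i)" using assms by (auto simp: part_def)
  have "a \<in> full"
  proof (rule fullI)
    fix i assume i: "i < m"
    show "a ! i \<in> set (L ! i)"
    proof (cases "i < length x")
      case False
      then show ?thesis using y(3)[of "i - length x"] i A[OF i] by (simp add: y(1) nth_append)
    qed (use x in \<open>simp add: y(1) nth_append\<close>)
  qed (use x y in simp)
  then show "a \<in> {a \<in> full. prefix x a}" using y(1) by simp
qed

lemma enc_eq:
  assumes "x \<in> part" "\<And>a. a \<in> full \<Longrightarrow> f a \<in> carrier F" "G \<in> anti"
  shows "enc_Sigma_AntiSym F A m f G x = psum (\<lambda>a. f a \<oplus> G a) x"
proof -
  let ?w = "\<lambda>x\<in>full. f x \<oplus> G x"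
  have w: "?w a \<in> carrier F" if "a \<in> full" for a
    using that assms anti_closed by simp
  have sub: "(@) x ` prod_sets A (length x) m \<subseteq> full"
    unfolding prefix_full_image[OF assms(1), symmetric] by blast
  have "enc_Sigma_AntiSym F A m f G x = (\<Oplus>y\<in>prod_sets A (length x) m. ?w (x @ y))"
    using assms(1) by (simp add: enc_Sigma_AntiSym_def Sigma_sum_def partial_tuples_eq full_tuples_eq)
  also have "\<dots> = (\<Oplus>a\<in>(@) x ` prod_sets A (length x) m. ?w a)"
    using w sub by (intro finsum_reindex[symmetric]) (auto simp: inj_on_def simp del: restrict_apply)
  also have "\<dots> = (\<Oplus>a\<in>{a \<in> full. prefix x a}. ?w a)"
    by (simp only: prefix_full_image[OF assms(1)])
  also have "\<dots> = (\<Oplus>a\<in>full. if prefix x a then f a \<oplus> G a else \<zero>)"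
    using finite_full assms anti_closed
    by (intro add.finprod_mono_neutral_cong_left) auto
  finally show ?thesis by (simp add: psum_def)
qed

lemma locates_constraints_N:
  "locates_constraints F (messages F A m) (pmf_of_set (AntiSym F A m)) (enc_Sigma_AntiSym F A m)
     I (insert [] N) (length V) (\<lambda>j. Zrow lab g (lab (V ! j)))"
  unfolding locates_constraints_def set_pmf_AntiSym
proof (intro conjI ballI allI impI)
  fix f \<beta>
  assume f: "f \<in> messages F A m" and \<beta>: "\<beta> \<in> I \<rightarrow>\<^sub>E carrier F"
  have f': "f \<in> (full \<union> {[]}) \<rightarrow>\<^sub>E carrier F" "f [] = (\<Oplus>a\<in>full. f a)"
    using f by (auto simp: messages_def full_tuples_eq)
  have fc: "f a \<in> carrier F" if "a \<in> full" for a using f' that by auto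
  have "restrict (enc_Sigma_AntiSym F A m f G) I = \<beta> \<longleftrightarrow> (\<forall>x\<in>I. psum (\<lambda>a. f a \<oplus> G a) x = \<beta> x)"
    if "G \<in> anti" for G
  proof -
    have "enc_Sigma_AntiSym F A m f G x = psum (\<lambda>a. f a \<oplus> G a) x" if "x \<in> I" for x
      using that I_part fc \<open>G \<in> anti\<close> by (intro enc_eq) auto
    moreover have "restrict (enc_Sigma_AntiSym F A m f G) I = \<beta> \<longleftrightarrow>
      (\<forall>x\<in>I. enc_Sigma_AntiSym F A m f G x = \<beta> x)"
      using \<beta> by (auto simp: fun_eq_iff PiE_def extensional_def restrict_def)
    ultimately show ?thesis by simp
  qed
  then show "restrict (case_sum f \<beta>) (insert [] N <+> I) \<in>
      kernel_on F (length V) (insert [] N <+> I) (\<lambda>j. Zrow lab g (lab (V ! j))) \<longleftrightarrow>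
    (\<exists>G\<in>anti. restrict (enc_Sigma_AntiSym F A m f G) I = \<beta>)"
    unfolding locates_N[OF f' \<beta>] by blast
qed (rule Zrow_closed)

end

section \<open>Size of the input and the final bounds\<close>

lemma dsize_tuple_data: "dsize (tuple_data x) = 2 * length x + 1"
  by (induction x) auto

lemma dsize_tuples_data: "dsize (tuples_data xs) = 1 + (\<Sum>x\<leftarrow>xs. 2 * length x + 2)"
  by (induction xs) (auto simp: dsize_tuple_data)

text \<open>The 3 counts the pair and the two list ends. The sets cost \<open>2 * n\<close>, where
  the summand \<open>m\<close> of \<open>n\<close> pays for the cells of the outer list and the ends
  of the inner ones; at most \<open>n\<close> queries of length at most \<open>n\<close> cost the
  rest.\<close>

lemma dsize_input:
  assumes "enumerates L A m" "distinct qs" "set qs \<subseteq> partial_tuples A m"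
    "n = (\<Sum>i=1..m. card (A i)) + m + card (set qs)"
  shows "dsize (Node (tuples_data L) (tuples_data qs)) \<le> 3 + 2 * n + n * (2 * n + 2)"
proof -
  have len: "length L = m" using assms(1) by (simp add: enumerates_def)
  have "(\<Sum>x\<leftarrow>L. 2 * length x + 2) = (\<Sum>i<m. 2 * length (L ! i) + 2)"
    by (simp add: sum_list_sum_nth len atLeast0LessThan)
  also have "\<dots> = (\<Sum>i<m. 2 * card (A (Suc i)) + 2)"
    using assms(1) distinct_card by (intro sum.cong) (fastforce simp: enumerates_def)+
  also have "\<dots> = 2 * (\<Sum>i<m. card (A (Suc i))) + 2 * m"
    by (simp only: sum.distrib sum_distrib_left[symmetric] sum_constant card_lessThan) simp
  also have "(\<Sum>i<m. card (A (Suc i))) = (\<Sum>i=1..m. card (A i))"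
    by (rule sum.reindex_bij_witness[of _ "\<lambda>i. i - 1" Suc]) auto
  finally have L: "(\<Sum>x\<leftarrow>L. 2 * length x + 2) \<le> 2 * n" using assms(4) by simp
  have "(\<Sum>x\<leftarrow>qs. 2 * length x + 2) \<le> (\<Sum>x\<leftarrow>qs. 2 * n + 2)"
    using assms(3,4) by (intro sum_list_mono) (fastforce simp: partial_tuples_nth)
  also have "\<dots> = card (set qs) * (2 * n + 2)"
    using distinct_card[OF assms(2)] by (simp add: sum_list_triv)
  also have "\<dots> \<le> n * (2 * n + 2)" using assms(4) by (intro mult_right_mono) auto
  finally have Q: "(\<Sum>x\<leftarrow>qs. 2 * length x + 2) \<le> n * (2 * n + 2)" .
  show ?thesis using L Q by (simp only: dsize.simps dsize_tuples_data)
qed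

theorem theorem7p2:
  "\<exists>(P :: prog) (C :: real) (c :: nat) (d :: nat).
     \<forall>(F :: 'u ring) (m :: nat) (A :: nat \<Rightarrow> 'u set) (L :: 'u list list).
       field F \<longrightarrow> finite (carrier F) \<longrightarrow>
       (\<forall>i\<in>{1..m}. A i \<noteq> {} \<and> A i \<subseteq> carrier F \<and> A i = A (m - i + 1)) \<longrightarrow>
       enumerates L A m \<longrightarrow>
       constraint_locator F
         (full_tuples A m \<union> {[]}) (partial_tuples A m) (messages F A m)
         (pmf_of_set (AntiSym F A m)) (enc_Sigma_AntiSym F A m)
         (tuples_data L)
         (\<lambda>n. real n ^ 2 * real m ^ 2 + 1 + C * (real n ^ 4 * real m ^ 4 / real (card (full_tuples A m))))
         (\<lambda>n. c * ((\<Sum>i=1..m. card (A i)) + m + n) ^ d + c)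
         P"
proof -
  \<comment> \<open>The ring is quantified inside \<open>ptime\<close>, so one program and one
    polynomial serve all fields.\<close>
  obtain P b where b: "polyf b"
    and P: "\<And>(F :: 'u ring) v. \<exists>t\<le>b (dsize v). run F P v t (locator F v)"
    using ptime_locator unfolding ptime_def by blast
  have "polyf (\<lambda>n. b (3 + 2 * n + n * (2 * n + 2)))"
    by (rule polyf_comp[OF b]) (intro polyf_intros)
  then obtain c d where cd: "\<And>n. b (3 + 2 * n + n * (2 * n + 2)) \<le> c * n ^ d + c"
    using polyf_bound by blast
  \<comment> \<open>The claim is proved with \<open>C = 0\<close>: the bound obtained is
    \<open>n^2 m^2 + 1\<close>, where the 1 counts the empty tuple.\<close>
  have "constraint_locator F
      (full_tuples A m \<union> {[]}) (partial_tuples A m) (messages F A m)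
      (pmf_of_set (AntiSym F A m)) (enc_Sigma_AntiSym F A m)
      (tuples_data L)
      (\<lambda>n. real n ^ 2 * real m ^ 2 + 1 + 0 * (real n ^ 4 * real m ^ 4 / real (card (full_tuples A m))))
      (\<lambda>n. c * ((\<Sum>i=1..m. card (A i)) + m + n) ^ d + c) P"
    if "field F" and fin: "finite (carrier F)"
      and A: "\<forall>i\<in>{1..m}. A i \<noteq> {} \<and> A i \<subseteq> carrier F \<and> A i = A (m - i + 1)"
      and L: "enumerates L A m"
    for F :: "'u ring" and m A and L :: "'u list list"
    unfolding constraint_locator_def
  proof (intro allI impI)
    fix qs assume qs: "distinct qs \<and> set qs \<subseteq> partial_tuples A m"
    have len: "length L = m" and LA: "\<And>i. i < m \<Longrightarrow> distinct (L ! i) \<and> set (L ! i) = A (Suc i)"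
      using L by (auto simp: enumerates_def)
    interpret field F by fact
    interpret instance_input F L qs A
    proof unfold_locales
      fix i assume i: "i < length L"
      have "Suc i \<in> {1..m}" using i len by simp
      note Ai = conjunct1[OF bspec[OF A this]] conjunct2[OF conjunct2[OF bspec[OF A this]]]
      show LAi: "distinct (L ! i)" "set (L ! i) = A (Suc i)" using LA[of i] i len by simp_all
      show "L ! i \<noteq> []" using Ai(1) LAi(2) by (simp add: set_empty[symmetric] del: set_empty)
      note Ai(2)
      moreover have "m - Suc i + 1 = Suc (length L - 1 - i)" using i len by simp
      ultimately show "set (L ! i) = set (L ! (length L - 1 - i))"
        using LAi(2) LA[of "length L - 1 - i"] i len by simp
    next
      fix q assume "q \<in> set qs"
      then have q: "length q \<le> m" "\<And>k. k < length q \<Longrightarrow> q ! k \<in> A (Suc k)"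
        using qs by (auto simp: partial_tuples_nth)
      then show "length q \<le> length L" using len by simp
      show "q ! i \<in> set (L ! i)" if "i < length q" for i using q LA that by simp
    qed (use fin in auto)
    obtain rs where rs: "locator F inp = Node (tuples_data ([] # rs))
        (matrix_data (length V) (\<lambda>j. Zrow lab g (lab (V ! j))) (map Inl ([] # rs) @ map Inr qs))"
      "distinct ([] # rs)" "set rs = N"
      using locator_inp by blast
    let ?n = "(\<Sum>i=1..m. card (A i)) + m + card (set qs)"
    obtain t where t: "t \<le> b (dsize inp)" "run F P inp t (locator F inp)" using P by blast
    have "b (dsize inp) \<le> b (3 + 2 * ?n + ?n * (2 * ?n + 2))"
      unfolding inp_def using dsize_input[OF L] qs by (intro polyf_mono[OF b]) simp
    then have "t \<le> c * ?n ^ d + c" using t(1) cd[of ?n] by linarith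
    moreover have "real (card (set ([] # rs))) \<le> real (card (set qs)) ^ 2 * real m ^ 2 + 1"
    proof -
      have "finite N" using finite_set[of rs] unfolding rs(3) .
      then have "card (set ([] # rs)) = card N + 1" using rs(3) Nil_N by simp
      also have "\<dots> \<le> card (set qs) ^ 2 * m ^ 2 + 1" using card_N len by simp
      finally have "real (card (set ([] # rs))) \<le> real (card (set qs) ^ 2 * m ^ 2 + 1)"
        by (rule of_nat_mono)
      then show ?thesis by (simp only: of_nat_add of_nat_mult of_nat_power of_nat_1)
    qed
    moreover have "set ([] # rs) \<subseteq> full_tuples A m \<union> {[]}"
      using rs(3) full_tuples_eq len by (auto simp: N_def)
    moreover have "locates_constraints F (messages F A m) (pmf_of_set (AntiSym F A m)) (enc_Sigma_AntiSym F A m)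
        (set qs) (set ([] # rs)) (length V) (\<lambda>j. Zrow lab g (lab (V ! j)))"
      using locates_constraints_N rs(3) len by simp
    moreover have "run F P (Node (tuples_data L) (tuples_data qs)) t (Node (tuples_data ([] # rs))
        (matrix_data (length V) (\<lambda>j. Zrow lab g (lab (V ! j))) (map Inl ([] # rs) @ map Inr qs)))"
      using t(2) rs(1) by (simp only: inp_def)
    ultimately show "\<exists>t rs k Z.
           run F P (Node (tuples_data L) (tuples_data qs)) t
             (Node (tuples_data rs) (matrix_data k Z (map Inl rs @ map Inr qs))) \<and>
           t \<le> c * ((\<Sum>i=1..m. card (A i)) + m + card (set qs)) ^ d + c \<and>
           distinct rs \<and> set rs \<subseteq> full_tuples A m \<union> {[]} \<and>
           real (card (set rs)) \<le> real (card (set qs)) ^ 2 * real m ^ 2 + 1 +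
             0 * (real (card (set qs)) ^ 4 * real m ^ 4 / real (card (full_tuples A m))) \<and>
           locates_constraints F (messages F A m) (pmf_of_set (AntiSym F A m)) (enc_Sigma_AntiSym F A m)
             (set qs) (set rs) k Z"
      using rs(2)
      by (intro exI[of _ t] exI[of _ "[] # rs"] exI[of _ "length V"]
          exI[of _ "\<lambda>j. Zrow lab g (lab (V ! j))"] conjI) (simp_all only: mult_zero_left add_0_right)
  qed
  then show ?thesis by (intro exI[of _ P] exI[of _ "0 :: real"] exI[of _ c] exI[of _ d] allI impI) assumption
qed

end
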